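(* Assume the $D$-Hurwitz assumption holds. Then: (1) For every $\tau>0$, $$\limsup_{\varepsilon\searrow 0}\lambda(\Sigma^\varepsilon_{\mathcal K,\tau})\le\lambda(\bar\Sigma_\tau);$$ in particular, if $\bar\Sigma_\tau$ is ES then $\Sigma^\varepsilon_{\mathcal K,\tau}$ is ES for every $\varepsilon>0$ small enough. (2) If $\tilde\lambda(\hat\Sigma)<0$, then $$\limsup_{\varepsilon\searrow 0}\lambda(\Sigma^\varepsilon_{\mathcal K})\le\lambda(\tilde\Sigma);$$ in particular, if moreover $\tilde\Sigma$ is ES then $\Sigma^\varepsilon_{\mathcal K}$ is ES for every $\varepsilon>0$ small enough.
   Context: Setup. Fix an integer $d\ge 2$ and a compact set $\mathcal K\subset\{1,\dots,d-1\}\times \mathrm{GL}(d,\mathbb R)\times M_d(\mathbb R)\times M_d(\mathbb R)$, whose elements are written $\sigma=(\ell,P,\Lambda,R)$. For $\ell\in\{1,\dots,d\}$ and $\varepsilon\ge 0$, $E^\varepsilon_\ell$ is the $d\times d$ diagonal matrix whose first $\ell$ diagonal entries are $1$ and the others $\varepsilon$. For a set $\mathcal Z$ and $\tau\ge 0$, $\mathcal S_{\mathcal Z,\tau}$ is the set of right-continuous piecewise-constant functions $Z:\mathbb R_{\ge 0}\to\mathcal Z$ whose switching times $0=t_0<t_1<t_2<\cdots$ (finitely or infinitely many, without finite accumulation point) satisfy $t_{k+1}-t_k\ge\tau$; $Z_k$ denotes the value of $Z$ on $[t_k,t_{k+1})$, and $\mathcal S_{\mathcal Z}=\mathcal S_{\mathcal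 Z,0}$. For $\varepsilon>0$, $\tau\ge0$, the system $\Sigma^\varepsilon_{\mathcal K,\tau}$ is: for $\sigma=(\ell,P,\Lambda,R)\in\mathcal S_{\mathcal K,\tau}$, $E^\varepsilon_{\ell_k}P_k\dot X(t)=\Lambda_k X(t)$ for $t\in[t_k,t_{k+1})$, and $X(t_k)=R_{k-1}X(t_k^-)$ at each switching time $t_k$, $k\ge 1$; $\Sigma^\varepsilon_{\mathcal K}:=\Sigma^\varepsilon_{\mathcal K,0}$. For any (possibly dimension-varying) linear switched system $\Sigma$ with admissible signal class $\mathcal S$ and flow matrices $\Phi_\sigma(t,0)$, $\lambda(\Sigma)=\limsup_{t\to\infty}\sup_{\sigma\in\mathcal S}\frac{\log\|\Phi_\sigma(t,0)\|}{t}$ (with $\log 0=-\infty$, $\|\cdot\|$ the operator norm induced by Euclidean norms); $\Sigma$ is ES if there exist $c,\delta>0$ with $\|\Phi_\sigma(t,0)\|\le ce^{-\delta t}$ for all $t\ge0$ and all $\sigma\in\mathcal S$. Block notation. For $\sigma=(\ell,P,\Lambda,R)\in\mathcal K$ write $\Lambda P^{-1}=\begin{pmatrix}A&B\\ C&D\end{pmatrix}$ with $A\in M_\ell(\mathbb R)$, $D\in M_{d-\ell}(\mathbb R)$. The $D$-Hurwitz assumption: $D(\sigma)$ is Hurwitz for every $\sigma\in\mathcal K$. Under it set $M(\sigma)=A-BD^{-1}C\in M_\ell(\mathbb R)$ and $T(\sigma)=\begin{pmatrix}I_\ell&0\\ D^{-1}C&I_{d-\ell}\end{pmatrix}P$.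 For a matrix $Q$, $(Q)_{\ell,c}$ is its upper-left $\ell\times c$ block. Subscript $k$ means evaluation at $\sigma_k$. Auxiliary systems. $\bar\Sigma_\tau$ ($\tau\ge0$): for $\sigma\in\mathcal S_{\mathcal K,\tau}$, the state $\bar x(t)\in\mathbb R^{\ell_k}$ on $[t_k,t_{k+1})$ evolves by $\dot{\bar x}=M_k\bar x$, with jumps $\bar x(t_k)=(T_kR_{k-1}T_{k-1}^{-1})_{\ell_k,\ell_{k-1}}\bar x(t_k^-)$. $\hat\Sigma$: for $\sigma\in\mathcal S_{\mathcal K}$ with switching times $s_k$, state $y(s)\in\mathbb R^d$ with $\dot y=\mathrm{diag}(0_{\ell_k},D_k)y$ on $[s_k,s_{k+1})$ and $y(s_k)=T_kR_{k-1}T_{k-1}^{-1}y(s_k^-)$; with flow $\Phi^{\hat\Sigma}_\sigma$, $\tilde\lambda(\hat\Sigma)=\limsup_{s\to\infty}\sup\{\frac{\log\|\Phi^{\hat\Sigma}_\sigma(s,0)\|}{s}:\sigma\in\mathcal S_{\mathcal K},\ s=s_k \text{ a switching time of }\sigma, k\ge1\}$. $\hat{\mathcal F}=\{I_d\}\cup\{\prod_{i=1}^n R_iT_i^{-1}\mathrm{diag}(I_{\ell_i},e^{s_iD_i})T_i: n\in\mathbb N,\ s_i>0,\ \sigma_i=(\ell_i,P_i,\Lambda_i,R_i)\in\mathcal K\}$. $\tilde\Sigma$: for $\sigma\in\mathcal S_{\mathcal K}$ and any choice of matrices $F_0,F_1,\dots\in\hat{\mathcal F}$, state $\tilde x(t)\in\mathbb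 R^{\ell_k}$ on $[t_k,t_{k+1})$ with $\dot{\tilde x}=M_k\tilde x$ and jumps $\tilde x(t_k)=(T_kF_{k-1}R_{k-1}T_{k-1}^{-1})_{\ell_k,\ell_{k-1}}\tilde x(t_k^-)$ (the supremum in $\lambda(\tilde\Sigma)$ is over $\sigma$ and the choices of $F_k$). *)

theory Defs
  imports "Jordan_Normal_Form.Char_Poly" "HOL-Analysis.Function_Topology" "HOL-Library.Extended_Real" "HOL-Library.Liminf_Limsup"
begin

definition minv :: "real mat \<Rightarrow> real mat" where
  "minv A = (THE B. inverts_mat A B \<and> inverts_mat B A)"

definition mexp :: "real mat \<Rightarrow> real mat" where
  "mexp A = mat (dim_row A) (dim_col A) (\<lambda>(i,j). \<Sum>k. (A ^\<^sub>m k) $$ (i,j) / fact k)"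

definition vnorm :: "real vec \<Rightarrow> real" where
  "vnorm v = sqrt (\<Sum>i<dim_vec v. (v $ i)^2)"

definition opnorm :: "real mat \<Rightarrow> real" where
  "opnorm A = Sup {vnorm (A *\<^sub>v v) | v. v \<in> carrier_vec (dim_col A) \<and> vnorm v \<le> 1}"

definition ul_block :: "nat \<Rightarrow> nat \<Rightarrow> real mat \<Rightarrow> real mat" where
  "ul_block r c Q = mat r c (\<lambda>ij. Q $$ ij)"

definition E_mat :: "nat \<Rightarrow> nat \<Rightarrow> real \<Rightarrow> real mat" where
  "E_mat d l \<epsilon> = mat d d (\<lambda>(i,j). if i = j then (if i < l then 1 else \<epsilon>) else 0)"

definition hurwitz :: "real mat \<Rightarrow> bool" where
  "hurwitz D \<longleftrightarrow> (\<forall>\<mu>. eigenvalue (map_mat complex_of_real D) \<mu> \<longrightarrow> Re \<mu> < 0)"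

text \<open>Embedding of a matrix into the function space (product topology), used to state compactness.\<close>
definition mat_fun :: "real mat \<Rightarrow> nat \<times> nat \<Rightarrow> real" where
  "mat_fun A = (\<lambda>(i,j). if i < dim_row A \<and> j < dim_col A then A $$ (i,j) else 0)"

type_synonym mode = "nat \<times> real mat \<times> real mat \<times> real mat"

definition ml :: "mode \<Rightarrow> nat" where "ml \<sigma> = fst \<sigma>"
definition mP :: "mode \<Rightarrow> real mat" where "mP \<sigma> = fst (snd \<sigma>)"
definition mLam :: "mode \<Rightarrow> real mat" where "mLam \<sigma> = fst (snd (snd \<sigma>))"
definition mR :: "mode \<Rightarrow> real mat" where "mR \<sigma> = snd (snd (snd \<sigma>))"
definition mdim :: "mode \<Rightarrow> nat" where "mdim \<sigma> = dim_row (mP \<sigma>)"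

definition mode_embed :: "mode \<Rightarrow> nat \<times> (nat \<times> nat \<Rightarrow> real) \<times> (nat \<times> nat \<Rightarrow> real) \<times> (nat \<times> nat \<Rightarrow> real)" where
  "mode_embed \<sigma> = (ml \<sigma>, mat_fun (mP \<sigma>), mat_fun (mLam \<sigma>), mat_fun (mR \<sigma>))"

definition blocks :: "mode \<Rightarrow> real mat \<times> real mat \<times> real mat \<times> real mat" where
  "blocks \<sigma> = split_block (mLam \<sigma> * minv (mP \<sigma>)) (ml \<sigma>) (ml \<sigma>)"

definition bA :: "mode \<Rightarrow> real mat" where "bA \<sigma> = fst (blocks \<sigma>)"
definition bB :: "mode \<Rightarrow> real mat" where "bB \<sigma> = fst (snd (blocks \<sigma>))"
definition bC :: "mode \<Rightarrow> real mat" where "bC \<sigma> = fst (snd (snd (blocks \<sigma>)))"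
definition bD :: "mode \<Rightarrow> real mat" where "bD \<sigma> = snd (snd (snd (blocks \<sigma>)))"

definition Mm :: "mode \<Rightarrow> real mat" where
  "Mm \<sigma> = bA \<sigma> - bB \<sigma> * minv (bD \<sigma>) * bC \<sigma>"

definition Tm :: "mode \<Rightarrow> real mat" where
  "Tm \<sigma> = four_block_mat (1\<^sub>m (ml \<sigma>)) (0\<^sub>m (ml \<sigma>) (mdim \<sigma> - ml \<sigma>))
             (minv (bD \<sigma>) * bC \<sigma>) (1\<^sub>m (mdim \<sigma> - ml \<sigma>)) * mP \<sigma>"

text \<open>Generator of E^eps_l P Xdot = Lambda X, i.e. Xdot = (E^eps_l P)^{-1} Lambda X.\<close>
definition gen :: "real \<Rightarrow> mode \<Rightarrow> real mat" where
  "gen \<epsilon> \<sigma> = minv (E_mat (mdim \<sigma>) (ml \<sigma>) \<epsilon> * mP \<sigma>) * mLam \<sigma>"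

text \<open>A signal in S_{Z,tau} is encoded by its number m of switching times t_1,...,t_m
  (m may be infinite), the switching times t_0 = 0 < t_1 < ... and the values z_k on [t_k, t_{k+1}).
  Values at consecutive intervals differ (the t_k, k>=1, are exactly the switching times).\<close>
definition signal :: "'z set \<Rightarrow> real \<Rightarrow> enat \<Rightarrow> (nat \<Rightarrow> real) \<Rightarrow> (nat \<Rightarrow> 'z) \<Rightarrow> bool" where
  "signal Z \<tau> m t z \<longleftrightarrow> t 0 = 0 \<and> (\<forall>k. enat k \<le> m \<longrightarrow> z k \<in> Z) \<and>
     (\<forall>k. enat (Suc k) \<le> m \<longrightarrow> t k < t (Suc k) \<and> \<tau> \<le> t (Suc k) - t k \<and> z (Suc k) \<noteq> z k) \<and>
     (m = \<infinity> \<longrightarrow> filterlim t at_top sequentially)"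

text \<open>A realization (m, t, A, J): on [t_k, t_{k+1}) the state obeys xdot = A k x, and at t_{k+1}
  the state jumps by x(t_{k+1}) = J k x(t_{k+1}^-).\<close>
type_synonym realization = "enat \<times> (nat \<Rightarrow> real) \<times> (nat \<Rightarrow> real mat) \<times> (nat \<Rightarrow> real mat)"

fun psi :: "(nat \<Rightarrow> real) \<Rightarrow> (nat \<Rightarrow> real mat) \<Rightarrow> (nat \<Rightarrow> real mat) \<Rightarrow> nat \<Rightarrow> real mat" where
  "psi t A J 0 = 1\<^sub>m (dim_row (A 0))"
| "psi t A J (Suc k) = J k * mexp ((t (Suc k) - t k) \<cdot>\<^sub>m A k) * psi t A J k"

definition sidx :: "enat \<Rightarrow> (nat \<Rightarrow> real) \<Rightarrow> real \<Rightarrow> nat" where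
  "sidx m t s = (THE k. enat k \<le> m \<and> t k \<le> s \<and> (enat (Suc k) \<le> m \<longrightarrow> s < t (Suc k)))"

definition flow :: "realization \<Rightarrow> real \<Rightarrow> real mat" where
  "flow r s = (case r of (m, t, A, J) \<Rightarrow>
     (let k = sidx m t s in mexp ((s - t k) \<cdot>\<^sub>m A k) * psi t A J k))"

definition elog :: "real \<Rightarrow> ereal" where
  "elog x = (if x = 0 then -\<infinity> else ereal (ln x))"

definition lyap :: "realization set \<Rightarrow> ereal" where
  "lyap S = Limsup at_top (\<lambda>s. SUP r\<in>S. elog (opnorm (flow r s)) / ereal s)"

definition ES :: "realization set \<Rightarrow> bool" where
  "ES S \<longleftrightarrow> (\<exists>c>0. \<exists>\<delta>>0. \<forall>r\<in>S. \<forall>s\<ge>0. opnorm (flow r s) \<le> c * exp (- \<delta> * s))"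

definition lyap_sw :: "realization set \<Rightarrow> ereal" where
  "lyap_sw S = Limsup at_top (\<lambda>s. SUP rk\<in>{(r, k). r \<in> S \<and> 1 \<le> k \<and> enat k \<le> fst r \<and> fst (snd r) k = s}.
       elog (opnorm (flow (fst rk) s)) / ereal s)"

definition sys_eps :: "mode set \<Rightarrow> real \<Rightarrow> real \<Rightarrow> realization set" where
  "sys_eps K \<tau> \<epsilon> = {(m, t, \<lambda>k. gen \<epsilon> (z k), \<lambda>k. mR (z k)) | m t z. signal K \<tau> m t z}"

definition sys_bar :: "mode set \<Rightarrow> real \<Rightarrow> realization set" where
  "sys_bar K \<tau> = {(m, t, \<lambda>k. Mm (z k),
      \<lambda>k. ul_block (ml (z (Suc k))) (ml (z k)) (Tm (z (Suc k)) * mR (z k) * minv (Tm (z k))))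
      | m t z. signal K \<tau> m t z}"

definition sys_hat :: "mode set \<Rightarrow> realization set" where
  "sys_hat K = {(m, t,
      \<lambda>k. four_block_mat (0\<^sub>m (ml (z k)) (ml (z k))) (0\<^sub>m (ml (z k)) (mdim (z k) - ml (z k)))
                         (0\<^sub>m (mdim (z k) - ml (z k)) (ml (z k))) (bD (z k)),
      \<lambda>k. Tm (z (Suc k)) * mR (z k) * minv (Tm (z k)))
      | m t z. signal K 0 m t z}"

definition Fhat :: "nat \<Rightarrow> mode set \<Rightarrow> real mat set" where
  "Fhat d K = {1\<^sub>m d} \<union>
     {foldr (*) (map (\<lambda>(s, \<sigma>). mR \<sigma> * minv (Tm \<sigma>) *
          four_block_mat (1\<^sub>m (ml \<sigma>)) (0\<^sub>m (ml \<sigma>) (d - ml \<sigma>)) (0\<^sub>m (d - ml \<sigma>) (ml \<sigma>))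
                         (mexp (s \<cdot>\<^sub>m bD \<sigma>)) * Tm \<sigma>) xs) (1\<^sub>m d)
      | xs. xs \<noteq> [] \<and> (\<forall>(s, \<sigma>) \<in> set xs. 0 < s \<and> \<sigma> \<in> K)}"

definition sys_tilde :: "nat \<Rightarrow> mode set \<Rightarrow> realization set" where
  "sys_tilde d K = {(m, t, \<lambda>k. Mm (z k),
      \<lambda>k. ul_block (ml (z (Suc k))) (ml (z k)) (Tm (z (Suc k)) * F k * mR (z k) * minv (Tm (z k))))
      | m t z F. signal K 0 m t z \<and> (\<forall>k. F k \<in> Fhat d K)}"

end

theory Submission
  imports Defs "HOL-Analysis.Derivative" "HOL-Analysis.Bounded_Continuous_Function"
    "HOL-Analysis.Bounded_Linear_Function" "Jordan_Normal_Form.Spectral_Radius"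
begin

text \<open>In the coordinates \<open>T X\<close> the generator of a mode is
  \<open>[[M, B], [Q M, D / \<epsilon> + Q B]]\<close> with \<open>Q = D\<^sup>-\<^sup>1 C\<close>. Duhamel's formula shows that its flow is
  \<open>diag (exp (t M), exp (t D / \<epsilon>))\<close> up to an error \<open>O(\<epsilon>) exp (\<omega> t)\<close>, uniformly over the compact set of
  modes, for any rate \<open>\<omega>\<close> above the growth rates of the matrices \<open>M\<close>; in the fast component the error is even
  \<open>O(min \<epsilon> t) exp (\<omega> t)\<close>. The flow of the switched system is a product of such factors, and a discrete
  Duhamel argument compares it with the product of the unperturbed ones.

  With a dwell time \<open>\<tau>\<close> the fast part has died out before each jump, and the unperturbed products are those of
  the bar system. Without dwell time, the hypothesis on the hat system forces every jump
  to annihilate the slow component, and the unperturbed products decay like \<open>exp (- \<delta> t / \<epsilon>)\<close>, which absorbs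
  the errors \<open>O(min \<epsilon> t)\<close> even if arbitrarily many jumps accumulate. Since the jumps of the tilde system
  then vanish as well, its exponent is governed by the modes without switching.

  Matrices of all sizes are treated as elements of one Banach algebra of bounded operators that contains
  countably many matrix units.\<close>

section \<open>A Banach algebra with matrix units\<close>

text \<open>The dimension of the slow part varies from mode to mode, and no constant may depend on
  the mode or the signal. The slow-fast estimates are therefore stated for abstract corner
  projections with all constants fixed beforehand, and compactness of \<open>K\<close> supplies
  these constants. The coordinate change works because \<open>D Q = C\<close>: subtracting the
  quasi-stationary value of the fast variable removes the large entry \<open>C / \<epsilon>\<close>,
  and only bounded couplings remain. Comparison products carry a prefactor that must not be paid at
  every jump. The discrete Duhamel argument charges it only together with an error, so every
  interval has to leave a margin: its gain towards the target rate \<open>\<omega>'\<close> must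
  dominate its error. With dwell time the gain is at least the constant
  \<open>1 - exp (- (\<omega>' - \<omega>) * \<tau>)\<close>, and an error
  \<open>O(\<epsilon>)\<close> fits. Without it, both are measured in the fast time
  \<open>x = t / \<epsilon>\<close>: the gain is at least a multiple of \<open>min 1 x\<close> and
  the error at most a multiple of \<open>\<epsilon> * min 1 x\<close>, down to \<open>x = 0\<close>.
  The growth bound for \<open>exp (t M)\<close> is then read off from the realizations of the tilde
  system without switching.\<close>

instance bcontfun :: (metric_space, banach) banach ..

text \<open>A separate type makes composition the multiplication of a class instance, so that
  \<open>exp\<close> and its calculus apply to matrices of every size. Bounded continuous functions
  on the real line form a Banach space with countably many point evaluations and functions dual to
  them.\<close>

typedef bop = "UNIV :: ((real \<Rightarrow>\<^sub>C real) \<Rightarrow>\<^sub>L (real \<Rightarrow>\<^sub>C real)) set"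
  morphisms blf Bop by simp

setup_lifting type_definition_bop

instantiation bop :: real_normed_algebra_1
begin

lift_definition zero_bop :: bop is 0 .
lift_definition one_bop :: bop is id_blinfun .
lift_definition plus_bop :: "bop \<Rightarrow> bop \<Rightarrow> bop" is "(+)" .
lift_definition minus_bop :: "bop \<Rightarrow> bop \<Rightarrow> bop" is "(-)" .
lift_definition uminus_bop :: "bop \<Rightarrow> bop" is uminus .
lift_definition times_bop :: "bop \<Rightarrow> bop \<Rightarrow> bop" is "(o\<^sub>L)" .
lift_definition scaleR_bop :: "real \<Rightarrow> bop \<Rightarrow> bop" is "(*\<^sub>R)" .
lift_definition norm_bop :: "bop \<Rightarrow> real" is norm .
definition dist_bop :: "bop \<Rightarrow> bop \<Rightarrow> real" where "dist_bop a b = norm (a - b)"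
definition sgn_bop :: "bop \<Rightarrow> bop" where "sgn_bop a = scaleR (inverse (norm a)) a"
definition uniformity_bop :: "(bop \<times> bop) filter"
  where "uniformity_bop = (INF e\<in>{0 <..}. principal {(x, y). dist x y < e})"
definition open_bop :: "bop set \<Rightarrow> bool"
  where "open_bop S = (\<forall>x\<in>S. \<forall>\<^sub>F (x', y) in uniformity. x' = x \<longrightarrow> y \<in> S)"

instance
proof
  have one: "norm (id_blinfun :: (real \<Rightarrow>\<^sub>C real) \<Rightarrow>\<^sub>L (real \<Rightarrow>\<^sub>C real)) = 1"
  proof -
    have "const_bcontfun 1 \<noteq> (0 :: real \<Rightarrow>\<^sub>C real)"
    proof
      assume "const_bcontfun 1 = (0 :: real \<Rightarrow>\<^sub>C real)"
      then have "apply_bcontfun (const_bcontfun 1 :: real \<Rightarrow>\<^sub>C real) 0 = apply_bcontfun 0 (0::real)"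
        by (rule arg_cong)
      then show False by (simp add: const_bcontfun.rep_eq)
    qed
    have "norm (const_bcontfun 1 :: real \<Rightarrow>\<^sub>C real) \<le>
        norm (id_blinfun :: (real \<Rightarrow>\<^sub>C real) \<Rightarrow>\<^sub>L (real \<Rightarrow>\<^sub>C real)) * norm (const_bcontfun 1 :: real \<Rightarrow>\<^sub>C real)"
      using norm_blinfun[of "id_blinfun" "const_bcontfun 1 :: real \<Rightarrow>\<^sub>C real"] by (simp only: id_blinfun.rep_eq id_apply)
    moreover have "norm (const_bcontfun 1 :: real \<Rightarrow>\<^sub>C real) > 0"
      using \<open>const_bcontfun 1 \<noteq> 0\<close> by simp
    ultimately show ?thesis
      using norm_blinfun_id_le[where 'a="real \<Rightarrow>\<^sub>C real"] by (intro antisym) auto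
  qed
  show "(0::bop) \<noteq> 1"
    apply transfer using one by auto
  show "norm (1::bop) = 1"
    by transfer (rule one)
  show "norm (a * b) \<le> norm a * norm b" for a b :: bop
    by transfer (rule norm_blinfun_compose)
  show "a * b * c = a * (b * c)" for a b c :: bop
    by (transfer, rule blinfun_eqI, simp)
  show "1 * a = a" "a * 1 = a" for a :: bop
    by (transfer, rule blinfun_eqI, simp)+
  show "(a + b) * c = a * c + b * c" "c * (a + b) = c * a + c * b" for a b c :: bop
    by (transfer, rule blinfun_eqI, simp add: blinfun.bilinear_simps)+
  show "scaleR r a * b = scaleR r (a * b)" "a * scaleR r b = scaleR r (a * b)" for r and a b :: bop
    by (transfer, rule blinfun_eqI, simp add: blinfun.bilinear_simps)+
  show "a + b + c = a + (b + c)" "a + b = b + a" "0 + a = a" "- a + a = 0" "a - b = a + - b" for a b c :: bop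
    by (transfer, simp)+
  show "scaleR r (a + b) = scaleR r a + scaleR r b" "scaleR (r + s) a = scaleR r a + scaleR s a"
    "scaleR r (scaleR s a) = scaleR (r * s) a" "scaleR 1 a = a" for r s and a b :: bop
    by (transfer, simp add: scaleR_add_left scaleR_add_right)+
  show "norm (scaleR r a) = \<bar>r\<bar> * norm a" "norm (a + b) \<le> norm a + norm b" "norm a = 0 \<longleftrightarrow> a = 0" for r and a b :: bop
    by (transfer, simp add: norm_triangle_ineq)+
qed (simp_all add: dist_bop_def sgn_bop_def uniformity_bop_def open_bop_def)

end

instance bop :: banach
proof
  fix X :: "nat \<Rightarrow> bop"
  assume "Cauchy X"
  have n: "norm (blf a - blf b) = norm (a - b)" for a b
    by (simp add: minus_bop.rep_eq norm_bop.rep_eq)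
  have "Cauchy (\<lambda>n. blf (X n))"
    using \<open>Cauchy X\<close> unfolding Cauchy_def dist_norm n .
  then have "convergent (\<lambda>n. blf (X n))"
    by (rule Cauchy_convergent)
  then obtain L where L: "(\<lambda>n. blf (X n)) \<longlonglongrightarrow> L"
    unfolding convergent_def by auto
  have "norm (X k - Bop L) = norm (blf (X k) - L)" for k
    using n[of "X k" "Bop L"] by (simp only: Bop_inverse[OF UNIV_I])
  with L have "X \<longlonglongrightarrow> Bop L"
    unfolding LIMSEQ_def dist_norm by simp
  then show "convergent X"
    by (auto simp: convergent_def)
qed

text \<open>Tent functions have the values \<open>\<delta>\<^sub>i\<^sub>j\<close> at the natural numbers, so that \<open>munit i j\<close> below behaves like a matrix unit.\<close>

definition tent :: "nat \<Rightarrow> (real \<Rightarrow>\<^sub>C real)"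
  where "tent i = Bcontfun (\<lambda>x. max 0 (1 - \<bar>x - real i\<bar>))"

lemma apply_tent: "apply_bcontfun (tent i) x = max 0 (1 - \<bar>x - real i\<bar>)"
proof -
  have "(\<lambda>x. max 0 (1 - \<bar>x - real i\<bar>)) \<in> bcontfun"
    unfolding bcontfun_def bounded_iff mem_Collect_eq
    by (intro conjI continuous_intros exI[of _ 1] ballI) auto
  then show ?thesis
    unfolding tent_def by (simp add: Bcontfun_inverse)
qed

lemma apply_tent_nat: "apply_bcontfun (tent i) (real j) = (if i = j then 1 else 0)"
  unfolding apply_tent by (cases i j rule: linorder_cases) auto

lemma norm_tent: "norm (tent i) = 1"
proof (rule antisym)
  show "norm (tent i) \<le> 1"
    by (rule norm_bound) (simp add: apply_tent)
  show "1 \<le> norm (tent i)"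
    using norm_bounded[of "tent i" "real i"] by (simp add: apply_tent)
qed

definition munit :: "nat \<Rightarrow> nat \<Rightarrow> bop"
  where "munit i j = Bop (Blinfun (\<lambda>v. apply_bcontfun v (real j) *\<^sub>R tent i))"

lemma munit_bounded_linear:
  "bounded_linear (\<lambda>v :: real \<Rightarrow>\<^sub>C real. apply_bcontfun v (real j) *\<^sub>R tent i)"
proof (rule bounded_linear_intro[where K=1])
  show "norm (apply_bcontfun v (real j) *\<^sub>R tent i) \<le> norm v * 1" for v :: "real \<Rightarrow>\<^sub>C real"
    using norm_bounded[of v "real j"] by (simp add: norm_tent)
qed (auto simp: plus_bcontfun.rep_eq scaleR_bcontfun.rep_eq scaleR_add_left)

lemma blf_munit: "blinfun_apply (blf (munit i j)) v = apply_bcontfun v (real j) *\<^sub>R tent i"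
  unfolding munit_def Bop_inverse[OF UNIV_I] by (subst bounded_linear_Blinfun_apply[OF munit_bounded_linear]) simp

lemma munit_mult: "munit i j * munit k l = (if j = k then munit i l else 0)"
proof -
  have "blf (munit i j * munit k l) = blf (if j = k then munit i l else 0)"
    by (rule blinfun_eqI)
      (auto simp: times_bop.rep_eq blf_munit zero_bop.rep_eq scaleR_bcontfun.rep_eq apply_tent_nat)
  then show ?thesis by (simp add: blf_inject)
qed

lemma norm_munit: "norm (munit i j) = 1"
proof (rule antisym)
  show "norm (munit i j) \<le> 1"
    unfolding norm_bop.rep_eq
  proof (rule norm_blinfun_bound)
    show "norm (blinfun_apply (blf (munit i j)) v) \<le> 1 * norm v" for v
      using norm_bounded[of v "real j"] by (simp add: blf_munit norm_tent)
  qed simp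
  have "norm (blinfun_apply (blf (munit i j)) (tent j)) \<le> norm (munit i j) * norm (tent j)"
    unfolding norm_bop.rep_eq by (rule norm_blinfun)
  then show "1 \<le> norm (munit i j)"
    by (simp add: blf_munit norm_tent apply_tent_nat)
qed

section \<open>Duhamel estimates\<close>

text \<open>The relation passes to powers and then to the series. It carries coordinate changes and
  projections through exponentials without any invertibility.\<close>

lemma exp_intertwine:
  fixes X A B :: "'a::{real_normed_algebra_1,banach}"
  assumes "X * A = B * X"
  shows "X * exp A = exp B * X"
proof -
  have pow: "X * A ^ n = B ^ n * X" for n
  proof (induction n)
    case (Suc n)
    have "X * A ^ Suc n = B * (X * A ^ n)"
      using assms by (simp add: mult.assoc[symmetric])
    then show ?case
      by (simp add: Suc mult.assoc)
  qed simp
  have "(\<lambda>n. X * (A ^ n /\<^sub>R fact n)) sums (X * exp A)"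
    unfolding exp_def by (intro sums_mult summable_sums summable_exp_generic)
  moreover have "(\<lambda>n. (B ^ n /\<^sub>R fact n) * X) sums (exp B * X)"
    unfolding exp_def by (intro sums_mult2 summable_sums summable_exp_generic)
  ultimately show ?thesis
    by (simp add: pow sums_unique2)
qed

lemma exp_intertwine_scaleR:
  fixes X A B :: "'a::{real_normed_algebra_1,banach}"
  assumes "X * A = B * X"
  shows "X * exp (t *\<^sub>R A) = exp (t *\<^sub>R B) * X"
  by (rule exp_intertwine) (simp add: assms)

lemma exp_scaleR_add:
  fixes A :: "'a::{real_normed_algebra_1,banach}"
  shows "exp ((s + t) *\<^sub>R A) = exp (s *\<^sub>R A) * exp (t *\<^sub>R A)"
  by (subst exp_add_commuting[symmetric]) (auto simp: scaleR_add_left)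

text \<open>The derivative of \<open>exp ((t - r) *\<^sub>R A) * y r\<close> in \<open>r\<close> is
  \<open>exp ((t - r) *\<^sub>R A) * f r\<close>. The mean value inequality against the primitive
  \<open>\<phi>\<close> replaces the integral of the usual formula.\<close>

lemma duhamel_bound:
  fixes y f :: "real \<Rightarrow> 'a::{real_normed_algebra_1,banach}" and \<phi> \<phi>' :: "real \<Rightarrow> real"
  assumes "0 \<le> t"
    and y: "\<And>r. (y has_vector_derivative A * y r + f r) (at r)"
    and phi: "\<And>r. (\<phi> has_real_derivative \<phi>' r) (at r)"
    and bnd: "\<And>r. 0 \<le> r \<Longrightarrow> r \<le> t \<Longrightarrow> norm (exp ((t - r) *\<^sub>R A) * f r) \<le> \<phi>' r"
  shows "norm (y t - exp (t *\<^sub>R A) * y 0) \<le> \<phi> t - \<phi> 0"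
proof (cases "t = 0")
  case False
  define g where "g r = exp ((t - r) *\<^sub>R A) * y r" for r
  have e: "((\<lambda>r. exp ((t - r) *\<^sub>R A)) has_vector_derivative - (exp ((t - r) *\<^sub>R A) * A)) (at r)" for r
  proof -
    have "((\<lambda>r. t - r) has_vector_derivative -1) (at r)"
      by (auto intro!: derivative_eq_intros)
    from vector_diff_chain_at[OF this exp_scaleR_has_vector_derivative_right[of A "t - r" UNIV]]
    show ?thesis by (simp add: o_def)
  qed
  have g': "(g has_vector_derivative exp ((t - r) *\<^sub>R A) * f r) (at r)" for r
    unfolding g_def using has_vector_derivative_mult[OF e[of r] y[of r]]
    by (simp add: algebra_simps)
  have "norm (g t - g 0) \<le> \<phi> t - \<phi> 0"
  proof (rule differentiable_bound_general)
    show "0 < t" using assms False by simp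
    show "continuous_on {0..t} g"
      using g' by (meson continuous_at_imp_continuous_on has_vector_derivative_continuous)
    show "continuous_on {0..t} \<phi>"
      using phi by (meson DERIV_isCont continuous_at_imp_continuous_on)
    show "(\<phi> has_vector_derivative \<phi>' r) (at r)" for r
      using phi by (simp add: has_real_derivative_iff_has_vector_derivative)
  qed (use g' bnd in auto)
  then show ?thesis by (simp add: g_def)
qed simp

text \<open>The quotients are the convolutions of \<open>exp (\<kappa> * t)\<close> with the two
  exponentials of the forcing. Two rates are provided because the fast component consists of a
  smooth part and an initial layer.\<close>

lemma duhamel_exp_bound:
  fixes y f :: "real \<Rightarrow> 'a::{real_normed_algebra_1,banach}"
  assumes "0 \<le> t"
    and y: "\<And>r. (y has_vector_derivative A * y r + f r) (at r)"
    and ne: "\<kappa> \<noteq> \<mu>" "\<kappa> \<noteq> \<nu>"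
    and bnd: "\<And>r. 0 \<le> r \<Longrightarrow> r \<le> t \<Longrightarrow>
      norm (exp ((t - r) *\<^sub>R A) * f r) \<le> exp (\<kappa> * (t - r)) * (K * exp (\<mu> * r) + L * exp (\<nu> * r))"
  shows "norm (y t - exp (t *\<^sub>R A) * y 0) \<le>
    K * ((exp (\<mu> * t) - exp (\<kappa> * t)) / (\<mu> - \<kappa>)) + L * ((exp (\<nu> * t) - exp (\<kappa> * t)) / (\<nu> - \<kappa>))"
proof -
  define \<phi> where "\<phi> r = K * exp (\<kappa> * t) * exp ((\<mu> - \<kappa>) * r) / (\<mu> - \<kappa>)
    + L * exp (\<kappa> * t) * exp ((\<nu> - \<kappa>) * r) / (\<nu> - \<kappa>)" for r
  define \<phi>' where "\<phi>' r = K * exp (\<kappa> * t) * exp ((\<mu> - \<kappa>) * r)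
    + L * exp (\<kappa> * t) * exp ((\<nu> - \<kappa>) * r)" for r
  have "(\<phi> has_real_derivative \<phi>' r) (at r)" for r
    unfolding \<phi>_def \<phi>'_def using ne by (auto intro!: derivative_eq_intros)
  moreover have "norm (exp ((t - r) *\<^sub>R A) * f r) \<le> \<phi>' r" if "0 \<le> r" "r \<le> t" for r
    using bnd[OF that] by (simp add: \<phi>'_def algebra_simps exp_diff exp_add)
  ultimately have "norm (y t - exp (t *\<^sub>R A) * y 0) \<le> \<phi> t - \<phi> 0"
    using assms(1) y by (intro duhamel_bound[where f=f and \<phi>'=\<phi>']) auto
  also have "\<phi> t - \<phi> 0 = K * ((exp (\<mu> * t) - exp (\<kappa> * t)) / (\<mu> - \<kappa>)) + L * ((exp (\<nu> * t) - exp (\<kappa> * t)) / (\<nu> - \<kappa>))"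
  proof -
    have "exp (\<kappa> * t) * exp ((\<mu> - \<kappa>) * t) = exp (\<mu> * t)" for \<mu>
      by (simp add: exp_add[symmetric] algebra_simps)
    then have "K * exp (\<kappa> * t) * exp ((\<mu> - \<kappa>) * t) = K * exp (\<mu> * t)" for \<mu> K
      by (simp only: mult.assoc)
    then show ?thesis
      unfolding \<phi>_def by (simp only:) (simp add: right_diff_distrib diff_divide_distrib)
  qed
  finally show ?thesis .
qed

lemma norm_mult3: "norm (a * b * c) \<le> norm a * norm b * norm (c :: 'a::real_normed_algebra)"
  by (rule order_trans[OF norm_mult_ineq]) (intro mult_right_mono norm_mult_ineq norm_ge_zero)

section \<open>Perturbation of ordered products\<close>

primrec oprod :: "(nat \<Rightarrow> 'a::monoid_mult) \<Rightarrow> nat \<Rightarrow> nat \<Rightarrow> 'a" where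
  "oprod W j 0 = 1"
| "oprod W j (Suc n) = W (j + n) * oprod W j n"

lemma oprod_Suc_right: "oprod W j (Suc n) = oprod W (Suc j) n * W j"
  by (induction n) (simp_all add: mult.assoc)

lemma oprod_shift: "oprod W j n = oprod (\<lambda>i. W (j + i)) 0 n"
  by (induction n) simp_all

lemma oprod_cong: "(\<And>i. j \<le> i \<Longrightarrow> i < j + n \<Longrightarrow> W i = V i) \<Longrightarrow> oprod W j n = oprod V j n"
  by (induction n) simp_all

text \<open>Discrete Duhamel formula. The bound \<open>C\<close> on blocks of the unperturbed
  product is not submultiplicative, so \<open>C\<close> enters once globally and once for each error
  \<open>v i\<close>.\<close>

lemma oprod_perturbation:
  fixes W U :: "nat \<Rightarrow> 'a::real_normed_algebra_1"
  assumes C: "1 \<le> C"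
    and U: "\<And>j m. j + m \<le> n \<Longrightarrow> norm (oprod U j m) \<le> C * (\<Prod>i=j..<j+m. u i)"
    and WU: "\<And>i. i < n \<Longrightarrow> norm (W i - U i) \<le> v i"
    and pos: "\<And>i. i < n \<Longrightarrow> 0 \<le> u i" "\<And>i. i < n \<Longrightarrow> 0 \<le> v i"
  shows "norm (oprod W 0 n) \<le> C * (\<Prod>i<n. u i + C * v i)"
proof -
  \<comment> \<open>The claim is generalized to mixed products, unperturbed after perturbed.
    Exchanging \<open>W j\<close> for \<open>U j\<close> lengthens the unperturbed block by one
    factor, and the difference term contributes the summand \<open>C * v j\<close>.\<close>
  have "norm (oprod U j m * oprod W 0 j) \<le> C * (\<Prod>i<j. u i + C * v i) * (\<Prod>i=j..<j+m. u i)"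
    if "j + m \<le> n" for j m
    using that
  proof (induction j arbitrary: m)
    case 0
    then show ?case using U[of 0 m] by simp
  next
    case (Suc j)
    let ?a = "\<Prod>i<j. u i + C * v i" and ?b = "\<Prod>i=Suc j..<Suc j+m. u i"
    have jn: "j < n" using Suc.prems by simp
    have a0: "0 \<le> ?a"
      using Suc.prems C pos by (intro prod_nonneg add_nonneg_nonneg mult_nonneg_nonneg) auto
    have b0: "0 \<le> ?b"
      using Suc.prems pos by (intro prod_nonneg) auto
    have "oprod U (Suc j) m * oprod W 0 (Suc j) =
        oprod U j (Suc m) * oprod W 0 j + oprod U (Suc j) m * (W j - U j) * oprod W 0 j"
      unfolding oprod_Suc_right[of U j m] by (simp add: algebra_simps)
    also have "norm \<dots> \<le> norm (oprod U j (Suc m) * oprod W 0 j)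
        + norm (oprod U (Suc j) m) * norm (W j - U j) * norm (oprod W 0 j)"
      by (intro order_trans[OF norm_triangle_ineq] add_left_mono norm_mult3)
    also have "norm (oprod U j (Suc m) * oprod W 0 j) \<le> C * ?a * (\<Prod>i=j..<j+Suc m. u i)"
      using Suc.IH[of "Suc m"] Suc.prems by simp
    also have "(\<Prod>i=j..<j+Suc m. u i) = u j * ?b"
      by (subst prod.atLeast_Suc_lessThan) auto
    also have "norm (oprod U (Suc j) m) * norm (W j - U j) * norm (oprod W 0 j) \<le> C * ?b * v j * (C * ?a)"
    proof (intro mult_mono)
      show "norm (oprod U (Suc j) m) \<le> C * ?b" using U Suc.prems by blast
      show "norm (oprod W 0 j) \<le> C * ?a" using Suc.IH[of 0] Suc.prems by simp
      show "norm (W j - U j) \<le> v j" using WU jn by blast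
    qed (use C b0 pos jn in auto)
    also have "C * ?a * (u j * ?b) + C * ?b * v j * (C * ?a) = C * (\<Prod>i<Suc j. u i + C * v i) * ?b"
      by (simp add: algebra_simps)
    finally show ?case by simp
  qed
  from this[of n 0] show ?thesis by simp
qed

section \<open>Slow-fast generators\<close>

text \<open>The block generator in the coordinates \<open>T X\<close>: \<open>M\<close> and
  \<open>B\<close> form the slow row, \<open>N\<close> and \<open>S\<close> stand for
  \<open>Q M\<close> and \<open>Q B\<close>, the bounded parts of the fast row. Since
  \<open>p + q\<close> is the unit of a corner only, exponentials have to be cut off by projections.
  The scalars are parameters so that one choice of them can serve all modes.\<close>

locale slow_fast =
  fixes p q M D B N S :: "'a::{real_normed_algebra_1,banach}" and b C0 C1 \<omega> c :: real
  assumes pq: "p * p = p" "q * q = q" "p * q = 0" "q * p = 0"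
    and corners: "p * M = M" "M * p = M" "q * D = D" "D * q = D" "p * B = B" "B * q = B"
      "q * N = N" "N * p = N" "q * S = S" "S * q = S"
    and norms: "norm p \<le> b" "norm q \<le> b" "norm B \<le> b" "norm N \<le> b" "norm S \<le> b"
    and bounds: "1 \<le> b" "1 \<le> C0" "1 \<le> C1" "0 < c"
    and slow: "\<And>t. 0 \<le> t \<Longrightarrow> norm (exp (t *\<^sub>R M) * p) \<le> C0 * exp (\<omega> * t)"
    and fast: "\<And>s. 0 \<le> s \<Longrightarrow> norm (exp (s *\<^sub>R D) * q) \<le> C1 * exp (- c * s)"
begin

definition full_gen :: "real \<Rightarrow> 'a" where
  "full_gen \<epsilon> = M + B + N + S + (1 / \<epsilon>) *\<^sub>R D"

definition sol :: "real \<Rightarrow> real \<Rightarrow> 'a" where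
  "sol \<epsilon> t = exp (t *\<^sub>R full_gen \<epsilon>) * (p + q)"

lemma cross: "p * D = 0" "q * M = 0" "q * B = 0" "p * N = 0" "p * S = 0"
proof -
  have "p * D = (p * q) * D" by (simp add: corners mult.assoc)
  then show "p * D = 0" by (simp add: pq)
  have "q * M = (q * p) * M" by (simp add: corners mult.assoc)
  then show "q * M = 0" by (simp add: pq)
  have "q * B = (q * p) * B" by (simp add: corners mult.assoc)
  then show "q * B = 0" by (simp add: pq)
  have "p * N = (p * q) * N" by (simp add: corners mult.assoc)
  then show "p * N = 0" by (simp add: pq)
  have "p * S = (p * q) * S" by (simp add: corners mult.assoc)
  then show "p * S = 0" by (simp add: pq)
qed

lemma slow_deriv:
  "((\<lambda>t. p * sol \<epsilon> t) has_vector_derivative M * (p * sol \<epsilon> t) + B * (q * sol \<epsilon> t)) (at t)"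
proof -
  have "((\<lambda>t. p * sol \<epsilon> t) has_vector_derivative p * (full_gen \<epsilon> * exp (t *\<^sub>R full_gen \<epsilon>) * (p + q))) (at t)"
    unfolding sol_def by (intro bounded_linear.has_vector_derivative[OF bounded_linear_mult_right]
      bounded_linear.has_vector_derivative[OF bounded_linear_mult_left] exp_scaleR_has_vector_derivative_left)
  moreover have "p * full_gen \<epsilon> = M * p + B * q"
    by (simp add: full_gen_def algebra_simps corners cross)
  then have "p * (full_gen \<epsilon> * exp (t *\<^sub>R full_gen \<epsilon>) * (p + q)) = M * (p * sol \<epsilon> t) + B * (q * sol \<epsilon> t)"
    by (simp only: sol_def mult.assoc[symmetric]) (simp add: distrib_right mult.assoc)
  ultimately show ?thesis by simp
qed

lemma fast_deriv:
  "((\<lambda>t. q * sol \<epsilon> t) has_vector_derivative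
     ((1 / \<epsilon>) *\<^sub>R D) * (q * sol \<epsilon> t) + (S * (q * sol \<epsilon> t) + N * (p * sol \<epsilon> t))) (at t)"
proof -
  have "((\<lambda>t. q * sol \<epsilon> t) has_vector_derivative q * (full_gen \<epsilon> * exp (t *\<^sub>R full_gen \<epsilon>) * (p + q))) (at t)"
    unfolding sol_def by (intro bounded_linear.has_vector_derivative[OF bounded_linear_mult_right]
      bounded_linear.has_vector_derivative[OF bounded_linear_mult_left] exp_scaleR_has_vector_derivative_left)
  moreover have "q * full_gen \<epsilon> = ((1 / \<epsilon>) *\<^sub>R D) * q + (S * q + N * p)"
    by (simp add: full_gen_def algebra_simps corners cross)
  then have "q * (full_gen \<epsilon> * exp (t *\<^sub>R full_gen \<epsilon>) * (p + q)) =
      ((1 / \<epsilon>) *\<^sub>R D) * (q * sol \<epsilon> t) + (S * (q * sol \<epsilon> t) + N * (p * sol \<epsilon> t))"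
    by (simp only: sol_def mult.assoc[symmetric]) (simp add: distrib_right mult.assoc)
  ultimately show ?thesis by simp
qed

lemma sol_0: "p * sol \<epsilon> 0 = p" "q * sol \<epsilon> 0 = q"
  by (simp_all add: sol_def distrib_left pq)

lemma exp_slow_mult: "0 \<le> t \<Longrightarrow> norm (exp (t *\<^sub>R M) * (p * z)) \<le> C0 * exp (\<omega> * t) * norm z"
  unfolding mult.assoc[symmetric] by (intro order_trans[OF norm_mult_ineq] mult_right_mono slow) auto

lemma exp_fast_mult:
  assumes "0 < \<epsilon>" "0 \<le> t"
  shows "norm (exp (t *\<^sub>R ((1 / \<epsilon>) *\<^sub>R D)) * (q * z)) \<le> C1 * exp (- (c / \<epsilon>) * t) * norm z"
proof -
  have "norm (exp ((t / \<epsilon>) *\<^sub>R D) * q * z) \<le> C1 * exp (- c * (t / \<epsilon>)) * norm z"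
    using assms by (intro order_trans[OF norm_mult_ineq] mult_right_mono fast) auto
  then show ?thesis by (simp add: mult.assoc)
qed

lemma norm_corner_le: "norm (X::'a) \<le> b \<Longrightarrow> norm (X * z) \<le> b * norm z"
  by (rule order_trans[OF norm_mult_ineq]) (rule mult_right_mono, auto)

text \<open>The second condition on \<open>\<epsilon>\<close> lets the rate
  \<open>c / \<epsilon>\<close> dominate \<open>\<omega>\<close> and \<open>\<omega>'\<close> with
  half of it to spare. The third one closes the loop between slow and fast component in
  \<open>weighted_bounds\<close>.\<close>

context
  fixes \<omega>' \<epsilon> :: real
  assumes lam: "\<omega> < \<omega>'" and eps: "0 < \<epsilon>" "\<epsilon> * (\<bar>\<omega>\<bar> + \<bar>\<omega>'\<bar>) \<le> c / 2"
    "2 * C1 * b * \<epsilon> / c * (C0 * b / (\<omega>' - \<omega>) + 1 + C0) \<le> 1 / 2"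
begin

lemma rates: "c / (2 * \<epsilon>) \<le> c / \<epsilon> + \<omega>'" "c / (2 * \<epsilon>) \<le> c / \<epsilon> + \<omega>"
  "- (c / \<epsilon>) < \<omega>'" "- (c / \<epsilon>) < \<omega>" "0 < c / (2 * \<epsilon>)"
proof -
  have "\<epsilon> * (\<bar>\<omega>\<bar> + \<bar>\<omega>'\<bar>) / \<epsilon> \<le> (c / 2) / \<epsilon>"
    by (rule divide_right_mono[OF eps(2)]) (use eps in auto)
  then have *: "\<bar>\<omega>\<bar> + \<bar>\<omega>'\<bar> \<le> c / (2 * \<epsilon>)"
    using eps by simp
  have "c / \<epsilon> = c / (2 * \<epsilon>) + c / (2 * \<epsilon>)"
    by simp
  moreover show "0 < c / (2 * \<epsilon>)"
    using bounds eps by simp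
  ultimately show "c / (2 * \<epsilon>) \<le> c / \<epsilon> + \<omega>'" "c / (2 * \<epsilon>) \<le> c / \<epsilon> + \<omega>"
    "- (c / \<epsilon>) < \<omega>'" "- (c / \<epsilon>) < \<omega>"
    using * by (auto simp: abs_if split: if_splits)
qed

text \<open>Dropping the negative exponential and using the denominator
  \<open>\<mu> + c / \<epsilon>\<close> gives the factor \<open>\<epsilon>\<close>. The inequality
  \<open>1 - exp (- k t) \<le> k t\<close> gives the factor \<open>t\<close>. Together they yield
  \<open>min \<epsilon> t\<close>, which survives arbitrarily short intervals.\<close>

lemma fast_gap:
  assumes "0 \<le> t" and mu: "c / (2 * \<epsilon>) \<le> c / \<epsilon> + \<mu>"
  shows "(exp (\<mu> * t) - exp (- (c / \<epsilon>) * t)) / (\<mu> - - (c / \<epsilon>)) \<le> (2 / c) * \<epsilon> * exp (\<mu> * t)"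
    and "(exp (\<mu> * t) - exp (- (c / \<epsilon>) * t)) / (\<mu> - - (c / \<epsilon>)) \<le> t * exp (\<mu> * t)"
    and "0 \<le> (exp (\<mu> * t) - exp (- (c / \<epsilon>) * t)) / (\<mu> - - (c / \<epsilon>))"
proof -
  let ?k = "\<mu> + c / \<epsilon>"
  have k: "0 < ?k" "c / (2 * \<epsilon>) \<le> ?k"
    using rates(5) mu by auto
  have "(exp (\<mu> * t) - exp (- (c / \<epsilon>) * t)) / ?k \<le> exp (\<mu> * t) / ?k"
    by (rule divide_right_mono) (use k in auto)
  also have "\<dots> \<le> exp (\<mu> * t) / (c / (2 * \<epsilon>))"
    by (rule divide_left_mono[OF k(2)]) (use mult_pos_pos[OF k(1) rates(5)] in auto)
  finally show "(exp (\<mu> * t) - exp (- (c / \<epsilon>) * t)) / (\<mu> - - (c / \<epsilon>)) \<le> (2 / c) * \<epsilon> * exp (\<mu> * t)"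
    by (simp add: field_simps)
  have "exp (- (c / \<epsilon>) * t) = exp (\<mu> * t) * exp (- (?k * t))"
    by (simp add: exp_add[symmetric] algebra_simps)
  also have "\<dots> \<ge> exp (\<mu> * t) * (1 - ?k * t)"
    using exp_ge_add_one_self[of "- (?k * t)"] by (intro mult_left_mono) auto
  finally have "exp (\<mu> * t) - exp (- (c / \<epsilon>) * t) \<le> t * exp (\<mu> * t) * ?k"
    by (simp add: algebra_simps)
  then show "(exp (\<mu> * t) - exp (- (c / \<epsilon>) * t)) / (\<mu> - - (c / \<epsilon>)) \<le> t * exp (\<mu> * t)"
    using k by (simp add: pos_divide_le_eq)
  have "- (c / \<epsilon>) * t \<le> \<mu> * t"
    using k assms(1) by (intro mult_right_mono) auto
  then show "0 \<le> (exp (\<mu> * t) - exp (- (c / \<epsilon>) * t)) / (\<mu> - - (c / \<epsilon>))"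
    using k by simp
qed

text \<open>\<open>K1\<close> is the gain from the fast to the slow component in the sup norm with
  weight \<open>exp (- \<omega>' * r)\<close>, \<open>K2\<close> the resulting a priori bound, and
  \<open>K3\<close> is \<open>C1 * b * K2\<close> times the factor \<open>2 / c\<close> of
  \<open>fast_gap\<close>.\<close>

definition "K1 = C0 * b / (\<omega>' - \<omega>)"
definition "K2 = C0 + 4 * (K1 + 1) * C1 * b"
definition "K3 = 2 * C1 * b * K2 / c"

lemma fast_approx_weighted:
  assumes "0 \<le> t" "0 \<le> \<alpha>" "0 \<le> \<beta>"
    and x: "\<And>r. 0 \<le> r \<Longrightarrow> r \<le> t \<Longrightarrow> norm (p * sol \<epsilon> r) \<le> \<alpha> * exp (\<omega>' * r)"
    and w: "\<And>r. 0 \<le> r \<Longrightarrow> r \<le> t \<Longrightarrow> norm (q * sol \<epsilon> r) \<le> \<beta> * exp (\<omega>' * r)"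
  shows "norm (q * sol \<epsilon> t - exp (t *\<^sub>R ((1 / \<epsilon>) *\<^sub>R D)) * q)
    \<le> C1 * b * (\<alpha> + \<beta>) * ((exp (\<omega>' * t) - exp (- (c / \<epsilon>) * t)) / (\<omega>' - - (c / \<epsilon>)))"
proof -
  have bnd: "norm (exp ((t - r) *\<^sub>R ((1 / \<epsilon>) *\<^sub>R D)) * (S * (q * sol \<epsilon> r) + N * (p * sol \<epsilon> r)))
     \<le> exp (- (c / \<epsilon>) * (t - r)) * ((C1 * b * (\<alpha> + \<beta>)) * exp (\<omega>' * r) + 0 * exp (\<omega>' * r))"
    if r: "0 \<le> r" "r \<le> t" for r
  proof -
    let ?z = "S * (q * sol \<epsilon> r) + N * (p * sol \<epsilon> r)"
    have "norm ?z \<le> b * norm (q * sol \<epsilon> r) + b * norm (p * sol \<epsilon> r)"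
      by (intro order_trans[OF norm_triangle_ineq] add_mono norm_corner_le norms)
    also have "\<dots> \<le> b * (\<beta> * exp (\<omega>' * r)) + b * (\<alpha> * exp (\<omega>' * r))"
      using x[OF r] w[OF r] bounds by (intro add_mono mult_left_mono) auto
    finally have z: "norm ?z \<le> b * (\<alpha> + \<beta>) * exp (\<omega>' * r)"
      by (simp add: algebra_simps)
    have "q * ?z = ?z"
      by (simp add: distrib_left mult.assoc[symmetric] corners)
    then have "norm (exp ((t - r) *\<^sub>R ((1 / \<epsilon>) *\<^sub>R D)) * ?z) \<le> C1 * exp (- (c / \<epsilon>) * (t - r)) * norm ?z"
      using exp_fast_mult[OF eps(1), of "t - r" ?z] r by simp
    also have "\<dots> \<le> C1 * exp (- (c / \<epsilon>) * (t - r)) * (b * (\<alpha> + \<beta>) * exp (\<omega>' * r))"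
      using z bounds by (intro mult_left_mono) auto
    finally show ?thesis by (simp add: algebra_simps)
  qed
  have "norm (q * sol \<epsilon> t - exp (t *\<^sub>R ((1 / \<epsilon>) *\<^sub>R D)) * (q * sol \<epsilon> 0)) \<le>
    C1 * b * (\<alpha> + \<beta>) * ((exp (\<omega>' * t) - exp (- (c / \<epsilon>) * t)) / (\<omega>' - - (c / \<epsilon>)))
    + 0 * ((exp (\<omega>' * t) - exp (- (c / \<epsilon>) * t)) / (\<omega>' - - (c / \<epsilon>)))"
    using rates by (intro duhamel_exp_bound[OF assms(1) fast_deriv _ _ bnd]) auto
  then show ?thesis by (simp add: sol_0)
qed

text \<open>The term with rate \<open>\<nu>\<close> leaves room for the initial layer of the fast
  component: with \<open>\<nu> = - (c / \<epsilon>)\<close> it integrates to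
  \<open>O(\<epsilon>)\<close>, although it is of order 1 at time 0. With
  \<open>\<gamma> = 0\<close> the same statement gives the a priori bound.\<close>

lemma slow_approx_weighted:
  assumes "0 \<le> t" and ne: "\<omega> \<noteq> \<nu>"
    and w: "\<And>r. 0 \<le> r \<Longrightarrow> r \<le> t \<Longrightarrow> norm (q * sol \<epsilon> r) \<le> \<beta> * exp (\<omega>' * r) + \<gamma> * exp (\<nu> * r)"
  shows "norm (p * sol \<epsilon> t - exp (t *\<^sub>R M) * p)
    \<le> C0 * b * \<beta> * ((exp (\<omega>' * t) - exp (\<omega> * t)) / (\<omega>' - \<omega>))
      + C0 * b * \<gamma> * ((exp (\<nu> * t) - exp (\<omega> * t)) / (\<nu> - \<omega>))"
proof -
  have bnd: "norm (exp ((t - r) *\<^sub>R M) * (B * (q * sol \<epsilon> r)))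
     \<le> exp (\<omega> * (t - r)) * ((C0 * b * \<beta>) * exp (\<omega>' * r) + (C0 * b * \<gamma>) * exp (\<nu> * r))"
    if r: "0 \<le> r" "r \<le> t" for r
  proof -
    let ?z = "B * (q * sol \<epsilon> r)"
    have "norm ?z \<le> b * norm (q * sol \<epsilon> r)"
      by (intro norm_corner_le norms)
    also have "\<dots> \<le> b * (\<beta> * exp (\<omega>' * r) + \<gamma> * exp (\<nu> * r))"
      using w[OF r] bounds by (intro mult_left_mono) auto
    finally have z: "norm ?z \<le> b * (\<beta> * exp (\<omega>' * r) + \<gamma> * exp (\<nu> * r))" .
    have "p * ?z = ?z"
      by (simp add: mult.assoc[symmetric] corners)
    then have "norm (exp ((t - r) *\<^sub>R M) * ?z) \<le> C0 * exp (\<omega> * (t - r)) * norm ?z"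
      using exp_slow_mult[of "t - r" ?z] r by simp
    also have "\<dots> \<le> C0 * exp (\<omega> * (t - r)) * (b * (\<beta> * exp (\<omega>' * r) + \<gamma> * exp (\<nu> * r)))"
      using z bounds by (intro mult_left_mono) auto
    finally show ?thesis by (simp add: algebra_simps)
  qed
  have "norm (p * sol \<epsilon> t - exp (t *\<^sub>R M) * (p * sol \<epsilon> 0)) \<le>
    C0 * b * \<beta> * ((exp (\<omega>' * t) - exp (\<omega> * t)) / (\<omega>' - \<omega>))
    + C0 * b * \<gamma> * ((exp (\<nu> * t) - exp (\<omega> * t)) / (\<nu> - \<omega>))"
    using lam ne by (intro duhamel_exp_bound[OF assms(1) slow_deriv _ _ bnd]) auto
  then show ?thesis by (simp add: sol_0)
qed

lemma weighted_max:
  fixes f :: "real \<Rightarrow> 'a"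
  assumes "continuous_on {0..t} f" "0 \<le> t"
  obtains r where "0 \<le> r" "r \<le> t"
    "\<And>s. 0 \<le> s \<Longrightarrow> s \<le> t \<Longrightarrow> norm (f s) \<le> norm (f r) * exp (- (\<omega>' * r)) * exp (\<omega>' * s)"
proof -
  have "continuous_on {0..t} (\<lambda>s. norm (f s) * exp (- (\<omega>' * s)))"
    using assms by (intro continuous_intros)
  from continuous_attains_sup[OF _ _ this] assms obtain r where r: "r \<in> {0..t}"
    "\<And>s. s \<in> {0..t} \<Longrightarrow> norm (f s) * exp (- (\<omega>' * s)) \<le> norm (f r) * exp (- (\<omega>' * r))"
    by auto
  show thesis
  proof (rule that)
    show "norm (f s) \<le> norm (f r) * exp (- (\<omega>' * r)) * exp (\<omega>' * s)" if "0 \<le> s" "s \<le> t" for s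
      using r(2)[of s] that by (simp add: exp_minus field_simps)
  qed (use r in auto)
qed

lemma K1_pos: "0 < K1"
  unfolding K1_def using bounds lam by auto

lemma K2_ge: "1 \<le> K2"
  unfolding K2_def using bounds K1_pos by (intro add_increasing2) auto

text \<open>Both components are estimated at the points where their weighted norms are maximal. This
  couples the two maxima by \<open>\<alpha> \<le> C0 + K1 * \<beta>\<close> and
  \<open>\<beta> \<le> C1 * b + \<eta> * (\<alpha> + \<beta>)\<close>, which can be solved because
  \<open>\<eta>\<close> is of order \<open>\<epsilon>\<close>.\<close>

lemma weighted_bounds:
  assumes "0 \<le> t"
  obtains \<alpha> \<beta> where "0 \<le> \<alpha>" "0 \<le> \<beta>" "\<alpha> + \<beta> \<le> K2"
    "\<And>r. 0 \<le> r \<Longrightarrow> r \<le> t \<Longrightarrow> norm (p * sol \<epsilon> r) \<le> \<alpha> * exp (\<omega>' * r)"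
    "\<And>r. 0 \<le> r \<Longrightarrow> r \<le> t \<Longrightarrow> norm (q * sol \<epsilon> r) \<le> \<beta> * exp (\<omega>' * r)"
proof -
  have cont: "continuous_on {0..t} (\<lambda>t. p * sol \<epsilon> t)" "continuous_on {0..t} (\<lambda>t. q * sol \<epsilon> t)"
    using slow_deriv fast_deriv
    by (meson continuous_at_imp_continuous_on has_vector_derivative_continuous)+
  from weighted_max[OF cont(1) assms] obtain r where r: "0 \<le> r" "r \<le> t"
    "\<And>s. 0 \<le> s \<Longrightarrow> s \<le> t \<Longrightarrow> norm (p * sol \<epsilon> s) \<le> norm (p * sol \<epsilon> r) * exp (- (\<omega>' * r)) * exp (\<omega>' * s)"
    by metis
  from weighted_max[OF cont(2) assms] obtain r' where r': "0 \<le> r'" "r' \<le> t"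
    "\<And>s. 0 \<le> s \<Longrightarrow> s \<le> t \<Longrightarrow> norm (q * sol \<epsilon> s) \<le> norm (q * sol \<epsilon> r') * exp (- (\<omega>' * r')) * exp (\<omega>' * s)"
    by metis
  define \<alpha> where "\<alpha> = norm (p * sol \<epsilon> r) * exp (- (\<omega>' * r))"
  define \<beta> where "\<beta> = norm (q * sol \<epsilon> r') * exp (- (\<omega>' * r'))"
  have pos: "0 \<le> \<alpha>" "0 \<le> \<beta>" by (auto simp: \<alpha>_def \<beta>_def)
  have x: "norm (p * sol \<epsilon> s) \<le> \<alpha> * exp (\<omega>' * s)" if "0 \<le> s" "s \<le> t" for s
    using r(3)[OF that] by (simp add: \<alpha>_def)
  have w: "norm (q * sol \<epsilon> s) \<le> \<beta> * exp (\<omega>' * s)" if "0 \<le> s" "s \<le> t" for s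
    using r'(3)[OF that] by (simp add: \<beta>_def)
  have mono: "exp (\<omega> * s) \<le> exp (\<omega>' * s)" "exp (- (c / \<epsilon>) * s) \<le> exp (\<omega>' * s)" if "0 \<le> s" for s
    using that lam mult_right_mono[of "- (c / \<epsilon>)" \<omega>' s] rates(3) by (auto intro!: mult_right_mono)
  have le_mult_exp: "x * exp (- a) \<le> X" if "x \<le> X * exp a" for x X a :: real
    using that by (simp add: exp_minus field_simps)
  have \<alpha>: "\<alpha> \<le> C0 + K1 * \<beta>"
  proof -
    have "norm (p * sol \<epsilon> r) \<le> norm (exp (r *\<^sub>R M) * p) + norm (p * sol \<epsilon> r - exp (r *\<^sub>R M) * p)"
      by (rule norm_triangle_sub)
    also have "norm (exp (r *\<^sub>R M) * p) \<le> C0 * exp (\<omega>' * r)"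
      using slow[OF r(1)] mono(1)[OF r(1)] bounds
      by (meson mult_left_mono order_trans zero_le_one)
    also have "norm (p * sol \<epsilon> r - exp (r *\<^sub>R M) * p)
        \<le> C0 * b * \<beta> * ((exp (\<omega>' * r) - exp (\<omega> * r)) / (\<omega>' - \<omega>))"
      using slow_approx_weighted[of r \<omega>' \<beta> 0] r lam w by auto
    also have "\<dots> \<le> C0 * b * \<beta> * (exp (\<omega>' * r) / (\<omega>' - \<omega>))"
      using lam bounds pos by (intro mult_left_mono divide_right_mono) auto
    finally have "norm (p * sol \<epsilon> r) \<le> (C0 + K1 * \<beta>) * exp (\<omega>' * r)"
      by (simp add: K1_def field_simps)
    then show ?thesis
      unfolding \<alpha>_def by (rule le_mult_exp)
  qed
  \<comment> \<open>The factor that \<open>fast_gap\<close> leaves in front of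
    \<open>\<alpha> + \<beta>\<close>. The third condition on \<open>\<epsilon>\<close> says exactly
    that \<open>\<eta> * (K1 + 1 + C0)\<close> is at most \<open>1 / 2\<close>.\<close>
  define \<eta> where "\<eta> = 2 * C1 * b * \<epsilon> / c"
  have \<eta>: "0 \<le> \<eta>" "\<eta> * (K1 + 1 + C0) \<le> 1 / 2"
    using eps bounds by (auto simp: \<eta>_def K1_def)
  have \<beta>: "\<beta> \<le> C1 * b + \<eta> * (\<alpha> + \<beta>)"
  proof -
    have "norm (q * sol \<epsilon> r') \<le> norm (exp (r' *\<^sub>R ((1 / \<epsilon>) *\<^sub>R D)) * (q * q))
       + norm (q * sol \<epsilon> r' - exp (r' *\<^sub>R ((1 / \<epsilon>) *\<^sub>R D)) * q)"
      unfolding pq by (rule norm_triangle_sub)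
    also have "norm (exp (r' *\<^sub>R ((1 / \<epsilon>) *\<^sub>R D)) * (q * q)) \<le> C1 * exp (- (c / \<epsilon>) * r') * norm q"
      by (rule exp_fast_mult[OF eps(1) r'(1)])
    also have "\<dots> \<le> C1 * exp (\<omega>' * r') * b"
      using mono(2)[OF r'(1)] bounds norms by (intro mult_mono) auto
    also have "norm (q * sol \<epsilon> r' - exp (r' *\<^sub>R ((1 / \<epsilon>) *\<^sub>R D)) * q)
        \<le> C1 * b * (\<alpha> + \<beta>) * ((exp (\<omega>' * r') - exp (- (c / \<epsilon>) * r')) / (\<omega>' - - (c / \<epsilon>)))"
      by (rule fast_approx_weighted) (use x w r' pos in auto)
    also have "\<dots> \<le> C1 * b * (\<alpha> + \<beta>) * ((2 / c) * \<epsilon> * exp (\<omega>' * r'))"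
      by (rule mult_left_mono[OF fast_gap(1)[OF r'(1) rates(1)]]) (use bounds pos in auto)
    finally have "norm (q * sol \<epsilon> r') \<le> (C1 * b + \<eta> * (\<alpha> + \<beta>)) * exp (\<omega>' * r')"
      by (simp add: \<eta>_def field_simps)
    then show ?thesis
      unfolding \<beta>_def by (rule le_mult_exp)
  qed
  have bC: "1 \<le> C1 * b"
    using mult_mono[of 1 C1 1 b] bounds by simp
  have half: "\<eta> * C0 \<le> 1 / 2" "\<eta> * (K1 + 1) \<le> 1 / 2"
  proof -
    have "0 \<le> \<eta> * C0" "0 \<le> \<eta> * (K1 + 1)" using \<eta> bounds K1_pos by auto
    then show "\<eta> * C0 \<le> 1 / 2" "\<eta> * (K1 + 1) \<le> 1 / 2" using \<eta>(2) by (simp_all add: algebra_simps)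
  qed
  have "\<eta> * (\<alpha> + \<beta>) \<le> \<eta> * C0 + (\<eta> * (K1 + 1)) * \<beta>"
    using mult_left_mono[OF \<alpha> \<eta>(1)] by (simp add: algebra_simps)
  moreover have "(\<eta> * (K1 + 1)) * \<beta> \<le> 1 / 2 * \<beta>"
    by (rule mult_right_mono[OF half(2) pos(2)])
  moreover note half(1)
  \<comment> \<open>Absorbing \<open>\<beta> / 2\<close> on the left leaves
    \<open>\<beta> \<le> 2 * (C1 * b) + 1\<close>, and \<open>1 \<le> C1 * b\<close>.\<close>
  ultimately have \<beta>4: "\<beta> \<le> 4 * (C1 * b)"
    using \<beta> bC by linarith
  have "\<alpha> + \<beta> \<le> C0 + (K1 + 1) * \<beta>"
    using \<alpha> by (simp add: algebra_simps)
  also have "\<dots> \<le> C0 + (K1 + 1) * (4 * (C1 * b))"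
    using \<beta>4 K1_pos by (intro add_left_mono mult_left_mono) auto
  finally have "\<alpha> + \<beta> \<le> K2"
    by (simp add: K2_def algebra_simps)
  with pos x w show thesis by (intro that) auto
qed

lemma sol_bound:
  assumes "0 \<le> t"
  shows "norm (p * sol \<epsilon> t) \<le> K2 * exp (\<omega>' * t)" "norm (q * sol \<epsilon> t) \<le> K2 * exp (\<omega>' * t)"
proof -
  from weighted_bounds[OF assms] obtain \<alpha> \<beta> where ab: "0 \<le> \<alpha>" "0 \<le> \<beta>" "\<alpha> + \<beta> \<le> K2"
    "norm (p * sol \<epsilon> t) \<le> \<alpha> * exp (\<omega>' * t)" "norm (q * sol \<epsilon> t) \<le> \<beta> * exp (\<omega>' * t)"
    using assms by (metis order_refl)
  have "\<alpha> * exp (\<omega>' * t) \<le> K2 * exp (\<omega>' * t)" "\<beta> * exp (\<omega>' * t) \<le> K2 * exp (\<omega>' * t)"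
    by (rule mult_right_mono; use ab in auto)+
  with ab(4,5) show "norm (p * sol \<epsilon> t) \<le> K2 * exp (\<omega>' * t)" "norm (q * sol \<epsilon> t) \<le> K2 * exp (\<omega>' * t)"
    by (blast intro: order_trans)+
qed

lemma fast_approx:
  assumes "0 \<le> t"
  shows "norm (q * sol \<epsilon> t - exp (t *\<^sub>R ((1 / \<epsilon>) *\<^sub>R D)) * q) \<le> K3 * \<epsilon> * exp (\<omega>' * t)"
    and "norm (q * sol \<epsilon> t - exp (t *\<^sub>R ((1 / \<epsilon>) *\<^sub>R D)) * q) \<le> C1 * b * K2 * t * exp (\<omega>' * t)"
proof -
  let ?g = "(exp (\<omega>' * t) - exp (- (c / \<epsilon>) * t)) / (\<omega>' - - (c / \<epsilon>))"
  from weighted_bounds[OF assms] obtain \<alpha> \<beta> where ab: "0 \<le> \<alpha>" "0 \<le> \<beta>" "\<alpha> + \<beta> \<le> K2"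
    "\<And>r. 0 \<le> r \<Longrightarrow> r \<le> t \<Longrightarrow> norm (p * sol \<epsilon> r) \<le> \<alpha> * exp (\<omega>' * r)"
    "\<And>r. 0 \<le> r \<Longrightarrow> r \<le> t \<Longrightarrow> norm (q * sol \<epsilon> r) \<le> \<beta> * exp (\<omega>' * r)"
    by metis
  note gap = fast_gap[OF assms rates(1)]
  have "norm (q * sol \<epsilon> t - exp (t *\<^sub>R ((1 / \<epsilon>) *\<^sub>R D)) * q) \<le> C1 * b * (\<alpha> + \<beta>) * ?g"
    using ab assms by (intro fast_approx_weighted) auto
  also have "\<dots> \<le> C1 * b * K2 * ?g"
    using ab bounds gap(3) by (intro mult_right_mono mult_left_mono) auto
  finally have *: "norm (q * sol \<epsilon> t - exp (t *\<^sub>R ((1 / \<epsilon>) *\<^sub>R D)) * q) \<le> C1 * b * K2 * ?g" .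
  have nn: "0 \<le> C1 * b * K2" using bounds K2_ge by auto
  show "norm (q * sol \<epsilon> t - exp (t *\<^sub>R ((1 / \<epsilon>) *\<^sub>R D)) * q) \<le> K3 * \<epsilon> * exp (\<omega>' * t)"
    using order_trans[OF * mult_left_mono[OF gap(1) nn]] by (simp add: K3_def field_simps)
  show "norm (q * sol \<epsilon> t - exp (t *\<^sub>R ((1 / \<epsilon>) *\<^sub>R D)) * q) \<le> C1 * b * K2 * t * exp (\<omega>' * t)"
    using order_trans[OF * mult_left_mono[OF gap(2) nn]] by (simp add: field_simps)
qed

text \<open>The fast component is \<open>O(\<epsilon>)\<close> apart from the layer
  \<open>exp (- (c / \<epsilon>) * r)\<close>. The first part enters through the gain
  \<open>K1\<close>, the layer through its integral, which is again
  \<open>O(\<epsilon>)\<close>.\<close>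

lemma slow_approx:
  assumes "0 \<le> t"
  shows "norm (p * sol \<epsilon> t - exp (t *\<^sub>R M) * p) \<le> (K1 * K3 + C0 * b * (C1 * b) * (2 / c)) * \<epsilon> * exp (\<omega>' * t)"
proof -
  have w: "norm (q * sol \<epsilon> r) \<le> K3 * \<epsilon> * exp (\<omega>' * r) + C1 * b * exp (- (c / \<epsilon>) * r)" if "0 \<le> r" for r
  proof -
    have "norm (q * sol \<epsilon> r) \<le> norm (q * sol \<epsilon> r - exp (r *\<^sub>R ((1 / \<epsilon>) *\<^sub>R D)) * q)
       + norm (exp (r *\<^sub>R ((1 / \<epsilon>) *\<^sub>R D)) * (q * q))"
      unfolding pq by (metis diff_add_cancel norm_triangle_ineq)
    also have "norm (q * sol \<epsilon> r - exp (r *\<^sub>R ((1 / \<epsilon>) *\<^sub>R D)) * q) \<le> K3 * \<epsilon> * exp (\<omega>' * r)"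
      by (rule fast_approx(1)[OF that])
    also have "norm (exp (r *\<^sub>R ((1 / \<epsilon>) *\<^sub>R D)) * (q * q)) \<le> C1 * exp (- (c / \<epsilon>) * r) * norm q"
      by (rule exp_fast_mult[OF eps(1) that])
    also have "\<dots> \<le> C1 * exp (- (c / \<epsilon>) * r) * b"
      using norms bounds by (intro mult_left_mono) auto
    finally show ?thesis by (simp add: algebra_simps)
  qed
  have K3: "0 \<le> K3" unfolding K3_def using bounds K2_ge by auto
  have lt: "exp (\<omega> * t) \<le> exp (\<omega>' * t)"
    using assms lam by (auto intro: mult_right_mono)
  have "norm (p * sol \<epsilon> t - exp (t *\<^sub>R M) * p)
    \<le> C0 * b * (K3 * \<epsilon>) * ((exp (\<omega>' * t) - exp (\<omega> * t)) / (\<omega>' - \<omega>))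
      + C0 * b * (C1 * b) * ((exp (- (c / \<epsilon>) * t) - exp (\<omega> * t)) / (- (c / \<epsilon>) - \<omega>))"
    using w rates by (intro slow_approx_weighted assms) auto
  also have "\<dots> \<le> C0 * b * (K3 * \<epsilon>) * (exp (\<omega>' * t) / (\<omega>' - \<omega>))
      + C0 * b * (C1 * b) * ((2 / c) * \<epsilon> * exp (\<omega>' * t))"
  proof (intro add_mono mult_left_mono divide_right_mono)
    \<comment> \<open>Here \<open>- (c / \<epsilon>) < \<omega>\<close>, so both differences are
      negative; reversing them gives the form of \<open>fast_gap\<close> with
      \<open>\<mu> = \<omega>\<close>.\<close>
    have swap: "(x - y) / (u - v) = (y - x) / (v - u)" for x y u v :: real
      using minus_divide_divide[of "y - x" "v - u"] by simp
    have "(exp (- (c / \<epsilon>) * t) - exp (\<omega> * t)) / (- (c / \<epsilon>) - \<omega>)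
        = (exp (\<omega> * t) - exp (- (c / \<epsilon>) * t)) / (\<omega> - - (c / \<epsilon>))"
      by (rule swap)
    also have "\<dots> \<le> (2 / c) * \<epsilon> * exp (\<omega> * t)"
      by (rule fast_gap(1)[OF assms rates(2)])
    also have "\<dots> \<le> (2 / c) * \<epsilon> * exp (\<omega>' * t)"
      using lt bounds eps by (intro mult_left_mono) auto
    finally show "(exp (- (c / \<epsilon>) * t) - exp (\<omega> * t)) / (- (c / \<epsilon>) - \<omega>) \<le> (2 / c) * \<epsilon> * exp (\<omega>' * t)" .
  qed (use bounds K3 eps lam in auto)
  also have "\<dots> = (K1 * K3 + C0 * b * (C1 * b) * (2 / c)) * \<epsilon> * exp (\<omega>' * t)"
    by (simp add: K1_def field_simps)
  finally show ?thesis .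
qed

end

end

text \<open>Restates the estimates outside the locale with the quantifiers in the order needed
  later: \<open>\<epsilon>0\<close> and \<open>C\<close> are chosen before the operators, hence are
  the same for all modes.\<close>

lemma slow_fast_estimates:
  fixes b C0 C1 \<omega> \<omega>' c :: real
  assumes bounds: "1 \<le> b" "1 \<le> C0" "1 \<le> C1" "0 < c" and lam: "\<omega> < \<omega>'"
  obtains \<epsilon>0 C where "0 < \<epsilon>0" "1 \<le> C"
    "\<And>\<epsilon> p q M D B N S t. \<lbrakk>slow_fast p q M D B N (S::'a::{real_normed_algebra_1,banach}) b C0 C1 \<omega> c; 0 < \<epsilon>; \<epsilon> < \<epsilon>0; 0 \<le> t\<rbrakk> \<Longrightarrow>
      let G = M + B + N + S + (1 / \<epsilon>) *\<^sub>R D; z = exp (t *\<^sub>R G) * (p + q) in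
       norm (p * z) \<le> C * exp (\<omega>' * t) \<and> norm (q * z) \<le> C * exp (\<omega>' * t) \<and>
       norm (q * z - exp (t *\<^sub>R ((1 / \<epsilon>) *\<^sub>R D)) * q) \<le> C * min \<epsilon> t * exp (\<omega>' * t) \<and>
       norm (p * z - exp (t *\<^sub>R M) * p) \<le> C * \<epsilon> * exp (\<omega>' * t)"
proof -
  \<comment> \<open>Copies of the locale constants, which exist only once operators and
    \<open>\<epsilon>\<close> are given.\<close>
  define k1 where "k1 = C0 * b / (\<omega>' - \<omega>)"
  define k2 where "k2 = C0 + 4 * (k1 + 1) * C1 * b"
  define k3 where "k3 = 2 * C1 * b * k2 / c"
  define k4 where "k4 = k1 * k3 + C0 * b * (C1 * b) * (2 / c)"
  define C where "C = max (max k2 k3) (max (C1 * b * k2) k4)"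
  \<comment> \<open>Both smallness conditions of the context are linear in
    \<open>\<epsilon>\<close>; this is the smaller of the two solutions.\<close>
  define \<epsilon>0 where "\<epsilon>0 = min (c / 2 / (\<bar>\<omega>\<bar> + \<bar>\<omega>'\<bar>)) (1 / 2 / (2 * C1 * b / c * (k1 + 1 + C0)))"
  have K1: "0 < k1" unfolding k1_def using bounds lam by auto
  have K2: "1 \<le> k2" unfolding k2_def using bounds K1 by (intro add_increasing2) auto
  have l0: "0 < \<bar>\<omega>\<bar> + \<bar>\<omega>'\<bar>" and k0: "0 < 2 * C1 * b / c * (k1 + 1 + C0)"
    using bounds lam K1 by auto
  show thesis
  proof (rule that)
    show "0 < \<epsilon>0" unfolding \<epsilon>0_def min_less_iff_conj
      by (intro conjI divide_pos_pos l0 k0) (use bounds in auto)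
    show "1 \<le> C" unfolding C_def using K2 by simp
    fix \<epsilon> t :: real and p q M D B N S :: 'a
    assume sf: "slow_fast p q M D B N S b C0 C1 \<omega> c" and \<epsilon>: "0 < \<epsilon>" "\<epsilon> < \<epsilon>0" and t: "0 \<le> t"
    interpret slow_fast p q M D B N S b C0 C1 \<omega> c by (rule sf)
    have e1: "\<epsilon> * (\<bar>\<omega>\<bar> + \<bar>\<omega>'\<bar>) \<le> c / 2"
    proof -
      have "\<epsilon> \<le> c / 2 / (\<bar>\<omega>\<bar> + \<bar>\<omega>'\<bar>)" using \<epsilon> by (simp add: \<epsilon>0_def)
      then show ?thesis by (simp only: pos_le_divide_eq[OF l0])
    qed
    have e2: "2 * C1 * b * \<epsilon> / c * (C0 * b / (\<omega>' - \<omega>) + 1 + C0) \<le> 1 / 2"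
    proof -
      have "\<epsilon> \<le> 1 / 2 / (2 * C1 * b / c * (k1 + 1 + C0))" using \<epsilon> by (simp add: \<epsilon>0_def)
      then have "\<epsilon> * (2 * C1 * b / c * (k1 + 1 + C0)) \<le> 1 / 2" by (simp only: pos_le_divide_eq[OF k0])
      then show ?thesis by (simp add: k1_def[symmetric] algebra_simps)
    qed
    note prems = lam \<epsilon>(1) e1 e2
    have defs: "K1 \<omega>' = k1" "K2 \<omega>' = k2" "K3 \<omega>' = k3"
      by (simp_all add: K1_def[OF prems] K2_def[OF prems] K3_def[OF prems] k1_def k2_def k3_def)
    show "let G = M + B + N + S + (1 / \<epsilon>) *\<^sub>R D; z = exp (t *\<^sub>R G) * (p + q) in
       norm (p * z) \<le> C * exp (\<omega>' * t) \<and> norm (q * z) \<le> C * exp (\<omega>' * t) \<and>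
       norm (q * z - exp (t *\<^sub>R ((1 / \<epsilon>) *\<^sub>R D)) * q) \<le> C * min \<epsilon> t * exp (\<omega>' * t) \<and>
       norm (p * z - exp (t *\<^sub>R M) * p) \<le> C * \<epsilon> * exp (\<omega>' * t)"
      unfolding Let_def full_gen_def[symmetric] sol_def[symmetric]
    proof (intro conjI)
      have le: "x \<le> C * r * exp (\<omega>' * t)" if "x \<le> k * r * exp (\<omega>' * t)" "k \<le> C" "0 \<le> r" for x k r
        by (rule order_trans[OF that(1)]) (use that in \<open>auto intro!: mult_right_mono\<close>)
      have Cs: "k2 \<le> C" "k3 \<le> C" "C1 * b * k2 \<le> C" "k4 \<le> C"
        by (auto simp: C_def)
      show "norm (p * sol \<epsilon> t) \<le> C * exp (\<omega>' * t)" "norm (q * sol \<epsilon> t) \<le> C * exp (\<omega>' * t)"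
        using sol_bound[OF prems t] le[of _ k2 1] Cs by (auto simp: defs)
      show "norm (q * sol \<epsilon> t - exp (t *\<^sub>R ((1 / \<epsilon>) *\<^sub>R D)) * q) \<le> C * min \<epsilon> t * exp (\<omega>' * t)"
        using fast_approx[OF prems t, unfolded defs] le[of _ k3 \<epsilon>] le[of _ "C1 * b * k2" t] Cs t \<epsilon>
        by (auto simp: min_def)
      show "norm (p * sol \<epsilon> t - exp (t *\<^sub>R M) * p) \<le> C * \<epsilon> * exp (\<omega>' * t)"
        using slow_approx[OF prems t, unfolded defs, folded k4_def] le[of _ k4 \<epsilon>] Cs \<epsilon>
        by auto
    qed
  qed
qed

section \<open>Matrices as operators\<close>

text \<open>The offsets place a block where it sits inside a larger matrix, so a block decomposition
  becomes a sum. Factors of different sizes live in one algebra, and mismatched index ranges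
  multiply to 0.\<close>

definition emb :: "nat \<Rightarrow> nat \<Rightarrow> real mat \<Rightarrow> bop" where
  "emb r c A = (\<Sum>i<dim_row A. \<Sum>j<dim_col A. (A $$ (i, j)) *\<^sub>R munit (r + i) (c + j))"

definition pj :: "nat \<Rightarrow> nat \<Rightarrow> bop" where
  "pj r n = emb r r (1\<^sub>m n)"

lemma munit_scaleR_mult:
  "(a *\<^sub>R munit i j) * (b *\<^sub>R munit k l) = (if j = k then (a * b) *\<^sub>R munit i l else 0)"
  by (simp add: munit_mult)

lemma emb_mult:
  assumes "dim_col A = dim_row B"
  shows "emb r k A * emb k c B = emb r c (A * B)"
proof -
  have "emb r k A * emb k c B = (\<Sum>i<dim_row A. \<Sum>j<dim_col A. \<Sum>i'<dim_row B. \<Sum>j'<dim_col B.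
     ((A $$ (i, j)) *\<^sub>R munit (r + i) (k + j)) * ((B $$ (i', j')) *\<^sub>R munit (k + i') (c + j')))"
    unfolding emb_def by (simp only: sum_distrib_right) (simp only: sum_distrib_left)
  also have "\<dots> = (\<Sum>i<dim_row A. \<Sum>j<dim_col A. \<Sum>i'<dim_row B.
     (if i' = j then \<Sum>j'<dim_col B. (A $$ (i, j) * B $$ (j, j')) *\<^sub>R munit (r + i) (c + j') else 0))"
    by (intro sum.cong refl) (auto simp: munit_scaleR_mult simp del: mult_scaleR_left mult_scaleR_right)
  also have "\<dots> = (\<Sum>i<dim_row A. \<Sum>j<dim_row B. \<Sum>j'<dim_col B. (A $$ (i, j) * B $$ (j, j')) *\<^sub>R munit (r + i) (c + j'))"
    using assms by simp
  also have "\<dots> = (\<Sum>i<dim_row A. \<Sum>j'<dim_col B. (\<Sum>j<dim_row B. A $$ (i, j) * B $$ (j, j')) *\<^sub>R munit (r + i) (c + j'))"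
    by (subst sum.swap) (simp add: scaleR_left.sum)
  also have "\<dots> = emb r c (A * B)"
    unfolding emb_def using assms by (simp add: scalar_prod_def lessThan_atLeast0)
  finally show ?thesis .
qed

lemma emb_mult_carrier:
  "A \<in> carrier_mat n k \<Longrightarrow> B \<in> carrier_mat k m \<Longrightarrow> emb r c (A * B) = emb r s A * emb s c B"
  by (rule emb_mult[symmetric]) auto

lemma emb_mult_disjoint:
  assumes "k + dim_col A \<le> k' \<or> k' + dim_row B \<le> k"
  shows "emb r k A * emb k' c B = 0"
proof -
  have "emb r k A * emb k' c B = (\<Sum>i<dim_row A. \<Sum>j<dim_col A. \<Sum>i'<dim_row B. \<Sum>j'<dim_col B.
     ((A $$ (i, j)) *\<^sub>R munit (r + i) (k + j)) * ((B $$ (i', j')) *\<^sub>R munit (k' + i') (c + j')))"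
    unfolding emb_def by (simp only: sum_distrib_right) (simp only: sum_distrib_left)
  also have "\<dots> = 0"
    using assms by (intro sum.neutral ballI) (auto simp: munit_scaleR_mult simp del: mult_scaleR_left mult_scaleR_right)
  finally show ?thesis .
qed

lemma emb_one_left: "dim_row A = n \<Longrightarrow> pj r n * emb r c A = emb r c A"
  unfolding pj_def by (subst emb_mult) (auto intro!: arg_cong[where f="emb r c"] left_mult_one_mat[where nr=n and nc="dim_col A"])

lemma emb_one_right: "dim_col A = n \<Longrightarrow> emb r c A * pj c n = emb r c A"
  unfolding pj_def by (subst emb_mult) (auto intro!: arg_cong[where f="emb r c"] right_mult_one_mat[where nr="dim_row A" and nc=n])

lemma pj_idem: "pj r n * pj r n = pj r n"
  using emb_one_left[of "1\<^sub>m n" n r r] by (simp add: pj_def)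

lemma emb_add: "dim_row A = dim_row B \<Longrightarrow> dim_col A = dim_col B \<Longrightarrow> emb r c (A + B) = emb r c A + emb r c B"
  unfolding emb_def by (simp add: scaleR_add_left sum.distrib)

lemma emb_minus: "dim_row A = dim_row B \<Longrightarrow> dim_col A = dim_col B \<Longrightarrow> emb r c (A - B) = emb r c A - emb r c B"
  unfolding emb_def by (simp add: scaleR_left.diff sum_subtractf)

lemma emb_smult: "emb r c (a \<cdot>\<^sub>m A) = a *\<^sub>R emb r c A"
  unfolding emb_def by (simp add: scaleR_sum_right)

lemma emb_zero: "emb r c (0\<^sub>m n k) = 0"
  unfolding emb_def by simp

lemma emb_four_block:
  assumes "A \<in> carrier_mat l l'" "B \<in> carrier_mat l k'" "C \<in> carrier_mat k l'" "D \<in> carrier_mat k k'"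
  shows "emb r c (four_block_mat A B C D) =
    emb r c A + emb r (c + l') B + emb (r + l) c C + emb (r + l) (c + l') D"
proof -
  have split: "(\<Sum>i<a+b. f i) = (\<Sum>i<a. f i) + (\<Sum>i<b. f (a + i))" for f :: "nat \<Rightarrow> bop" and a b
    by (simp add: lessThan_atLeast0 sum.atLeastLessThan_concat[of 0 a "a+b", symmetric]
        sum.atLeastLessThan_shift_0[of f a] add.commute)
  have "emb r c (four_block_mat A B C D) = (\<Sum>i<l+k. \<Sum>j<l'+k'. (four_block_mat A B C D $$ (i, j)) *\<^sub>R munit (r + i) (c + j))"
    unfolding emb_def using assms by simp
  also have "\<dots> = (\<Sum>i<l. \<Sum>j<l'. (A $$ (i, j)) *\<^sub>R munit (r + i) (c + j)) +
     (\<Sum>i<l. \<Sum>j<k'. (B $$ (i, j)) *\<^sub>R munit (r + i) (c + (l' + j))) +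
     ((\<Sum>i<k. \<Sum>j<l'. (C $$ (i, j)) *\<^sub>R munit (r + (l + i)) (c + j)) +
     (\<Sum>i<k. \<Sum>j<k'. (D $$ (i, j)) *\<^sub>R munit (r + (l + i)) (c + (l' + j))))"
    using assms by (simp add: split sum.distrib)
  also have "\<dots> = emb r c A + emb r (c + l') B + emb (r + l) c C + emb (r + l) (c + l') D"
    unfolding emb_def using assms by (simp add: add.assoc)
  finally show ?thesis .
qed

lemma pj_add: "pj r (l + k) = pj r l + pj (r + l) k"
  unfolding pj_def using emb_four_block[of "1\<^sub>m l" l l "0\<^sub>m l k" k "0\<^sub>m k l" k "1\<^sub>m k" r r]
  by (simp add: emb_zero four_block_one_mat)

text \<open>Sandwiching between matrix units reads off an entry. As these units have norm 1, entries
  are bounded by the norm of the operator, and \<open>emb\<close> is injective on matrices of a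
  given size.\<close>

lemma emb_entry:
  assumes "i < dim_row A" "j < dim_col A"
  shows "munit 0 (r + i) * emb r c A * munit (c + j) 0 = (A $$ (i, j)) *\<^sub>R munit 0 0"
proof -
  have "munit 0 (r + i) * emb r c A * munit (c + j) 0 =
     (\<Sum>i'<dim_row A. \<Sum>j'<dim_col A. (A $$ (i', j')) *\<^sub>R (munit 0 (r + i) * munit (r + i') (c + j') * munit (c + j) 0))"
    unfolding emb_def by (simp add: sum_distrib_right sum_distrib_left)
  also have "\<dots> = (\<Sum>i'<dim_row A. if i = i' then (\<Sum>j'<dim_col A. if j = j' then (A $$ (i', j')) *\<^sub>R munit 0 0 else 0) else 0)"
  proof (intro sum.cong refl)
    fix i' j'
    have "munit 0 (r + i) * munit (r + i') (c + j') * munit (c + j) 0 =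
        (if i = i' then if j = j' then munit 0 0 else 0 else 0)" for j'
      by (simp add: munit_mult)
    then show "(\<Sum>j'<dim_col A. (A $$ (i', j')) *\<^sub>R (munit 0 (r + i) * munit (r + i') (c + j') * munit (c + j) 0)) =
        (if i = i' then (\<Sum>j'<dim_col A. if j = j' then (A $$ (i', j')) *\<^sub>R munit 0 0 else 0) else 0)"
      by (simp add: if_distrib[of "(*\<^sub>R) _"] cong: if_cong)
  qed
  also have "\<dots> = (A $$ (i, j)) *\<^sub>R munit 0 0"
    using assms by simp
  finally show ?thesis .
qed

lemma entry_le_norm_emb:
  assumes "i < dim_row A" "j < dim_col A"
  shows "\<bar>A $$ (i, j)\<bar> \<le> norm (emb r c A)"
proof -
  have "\<bar>A $$ (i, j)\<bar> = norm (munit 0 (r + i) * emb r c A * munit (c + j) 0)"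
    unfolding emb_entry[OF assms] by (simp add: norm_munit)
  also have "\<dots> \<le> norm (emb r c A)"
    using norm_mult3[of "munit 0 (r + i)" "emb r c A" "munit (c + j) 0"] by (simp add: norm_munit)
  finally show ?thesis .
qed

lemma norm_emb_le:
  assumes "\<And>i j. i < dim_row A \<Longrightarrow> j < dim_col A \<Longrightarrow> \<bar>A $$ (i, j)\<bar> \<le> K"
  shows "norm (emb r c A) \<le> real (dim_row A * dim_col A) * K"
proof -
  have "norm (emb r c A) \<le> (\<Sum>i<dim_row A. \<Sum>j<dim_col A. K)"
    unfolding emb_def
    by (intro order_trans[OF norm_sum] sum_mono) (use assms in \<open>simp add: norm_munit\<close>)
  then show ?thesis by simp
qed

lemma emb_eqD:
  assumes "dim_row A = dim_row B" "dim_col A = dim_col B" "emb r c A = emb r c B"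
  shows "A = B"
proof (rule eq_matI)
  fix i j assume ij: "i < dim_row B" "j < dim_col B"
  have "\<bar>(A - B) $$ (i, j)\<bar> \<le> norm (emb r c (A - B))"
    by (rule entry_le_norm_emb) (use assms ij in auto)
  then show "A $$ (i, j) = B $$ (i, j)"
    using assms ij by (simp add: emb_minus)
qed (use assms in auto)

text \<open>The factor \<open>pj r n\<close> matters at \<open>k = 0\<close>, where the identity
  matrix embeds as the unit of the corner and not as 1.\<close>

lemma emb_pow:
  assumes "A \<in> carrier_mat n n"
  shows "emb r r (A ^\<^sub>m k) = emb r r A ^ k * pj r n"
proof (induction k)
  case 0
  then show ?case using assms by (simp add: pj_def)
next
  case (Suc k)
  have "emb r r (A ^\<^sub>m Suc k) = emb r r (A ^\<^sub>m k) * emb r r A"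
    using assms pow_carrier_mat[OF assms, of k] by (simp add: emb_mult)
  also have "\<dots> = emb r r A ^ k * (pj r n * emb r r A)"
    by (simp add: Suc mult.assoc)
  also have "pj r n * emb r r A = emb r r A * pj r n"
    using assms by (simp add: emb_one_left emb_one_right)
  finally show ?case by (simp add: power_commutes mult.assoc[symmetric])
qed

text \<open>Entries of powers are dominated by norms in \<open>bop\<close>, which makes the
  entrywise series of \<open>mexp\<close> summable and identifies its sum. Outside the corner
  \<open>exp\<close> is the identity, hence the cut-off by \<open>pj r n\<close>.\<close>

lemma emb_mexp:
  assumes A: "A \<in> carrier_mat n n"
  shows "emb r r (mexp A) = exp (emb r r A) * pj r n"
proof -
  let ?X = "emb r r A"
  let ?f = "\<lambda>i j k. (A ^\<^sub>m k) $$ (i, j) / fact k"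
  have dims: "dim_row (A ^\<^sub>m k) = n" "dim_col (A ^\<^sub>m k) = n" for k
    using pow_carrier_mat[OF A, of k] by auto
  have "summable (?f i j)" if "i < n" "j < n" for i j
  proof (rule summable_comparison_test')
    show "summable (\<lambda>k. norm (?X ^ k /\<^sub>R fact k) * norm (pj r n))"
      by (intro summable_mult2 summable_norm_exp)
    fix k
    have "\<bar>(A ^\<^sub>m k) $$ (i, j)\<bar> \<le> norm (?X ^ k * pj r n)"
      using entry_le_norm_emb[of i "A ^\<^sub>m k" j r r] that dims by (simp add: emb_pow[OF A])
    also have "\<dots> \<le> norm (?X ^ k) * norm (pj r n)"
      by (rule norm_mult_ineq)
    finally have "\<bar>(A ^\<^sub>m k) $$ (i, j)\<bar> / fact k \<le> norm (?X ^ k) * norm (pj r n) / fact k"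
      by (rule divide_right_mono) simp
    then show "norm (?f i j k) \<le> norm (?X ^ k /\<^sub>R fact k) * norm (pj r n)"
      by (simp add: divide_inverse mult_ac abs_mult)
  qed
  then have "(\<lambda>k. \<Sum>i<n. \<Sum>j<n. ?f i j k *\<^sub>R munit (r + i) (r + j)) sums
      (\<Sum>i<n. \<Sum>j<n. (\<Sum>k. ?f i j k) *\<^sub>R munit (r + i) (r + j))"
    by (intro sums_sum sums_scaleR_left summable_sums) auto
  also have "(\<Sum>i<n. \<Sum>j<n. (\<Sum>k. ?f i j k) *\<^sub>R munit (r + i) (r + j)) = emb r r (mexp A)"
    unfolding emb_def mexp_def using A by simp
  also have "(\<lambda>k. \<Sum>i<n. \<Sum>j<n. ?f i j k *\<^sub>R munit (r + i) (r + j)) = (\<lambda>k. (?X ^ k /\<^sub>R fact k) * pj r n)"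
  proof
    fix k
    have "(?X ^ k /\<^sub>R fact k) * pj r n = emb r r (A ^\<^sub>m k) /\<^sub>R fact k"
      by (simp add: emb_pow[OF A])
    also have "emb r r (A ^\<^sub>m k) = (\<Sum>i<n. \<Sum>j<n. ((A ^\<^sub>m k) $$ (i, j)) *\<^sub>R munit (r + i) (r + j))"
      by (simp only: emb_def dims)
    finally show "(\<Sum>i<n. \<Sum>j<n. ?f i j k *\<^sub>R munit (r + i) (r + j)) = (?X ^ k /\<^sub>R fact k) * pj r n"
      by (simp add: scaleR_sum_right divide_inverse mult_ac)
  qed
  finally have "(\<lambda>k. (?X ^ k /\<^sub>R fact k) * pj r n) sums emb r r (mexp A)" .
  moreover have "(\<lambda>k. (?X ^ k /\<^sub>R fact k) * pj r n) sums (exp ?X * pj r n)"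
    unfolding exp_def by (intro sums_mult2 summable_sums summable_exp_generic)
  ultimately show ?thesis by (rule sums_unique2)
qed

lemma mexp_carrier: "A \<in> carrier_mat n n \<Longrightarrow> mexp A \<in> carrier_mat n n"
  unfolding mexp_def by auto

section \<open>The Euclidean operator norm\<close>

lemma vnorm_nonneg: "0 \<le> vnorm v"
  unfolding vnorm_def by (simp add: sum_nonneg)

lemma entry_le_vnorm: "i < dim_vec v \<Longrightarrow> \<bar>vec_index v i\<bar> \<le> vnorm v"
  unfolding vnorm_def
  by (rule real_le_rsqrt) (simp add: member_le_sum[of i "{..<dim_vec v}" "\<lambda>i. (vec_index v i)\<^sup>2"])

lemma vnorm_le_sum: "vnorm v \<le> (\<Sum>i<dim_vec v. \<bar>vec_index v i\<bar>)"
  using L2_set_le_sum_abs[of "vec_index v" "{..<dim_vec v}"] by (simp add: vnorm_def L2_set_def)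

lemma vnorm_mult_le:
  assumes K: "\<And>i j. i < dim_row A \<Longrightarrow> j < dim_col A \<Longrightarrow> \<bar>A $$ (i, j)\<bar> \<le> K"
    and v: "v \<in> carrier_vec (dim_col A)" "vnorm v \<le> 1"
  shows "vnorm (A *\<^sub>v v) \<le> real (dim_row A * dim_col A) * K"
proof -
  have "\<bar>vec_index (A *\<^sub>v v) i\<bar> \<le> real (dim_col A) * K" if i: "i < dim_row A" for i
  proof -
    have "\<bar>vec_index (A *\<^sub>v v) i\<bar> = \<bar>\<Sum>j<dim_col A. A $$ (i, j) * vec_index v j\<bar>"
      using v i by (simp add: scalar_prod_def lessThan_atLeast0)
    also have "\<dots> \<le> (\<Sum>j<dim_col A. \<bar>A $$ (i, j)\<bar> * \<bar>vec_index v j\<bar>)"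
      by (rule order_trans[OF sum_abs]) (simp add: abs_mult)
    also have "\<dots> \<le> (\<Sum>j<dim_col A. K * 1)"
    proof (intro sum_mono mult_mono)
      fix j assume "j \<in> {..<dim_col A}"
      then show "\<bar>vec_index v j\<bar> \<le> 1" "\<bar>A $$ (i, j)\<bar> \<le> K" "0 \<le> K"
        using entry_le_vnorm[of j v] v K[OF i, of j] by auto
    qed auto
    finally show ?thesis by simp
  qed
  then have "(\<Sum>i<dim_row A. \<bar>vec_index (A *\<^sub>v v) i\<bar>) \<le> (\<Sum>i<dim_row A. real (dim_col A) * K)"
    by (intro sum_mono) auto
  with vnorm_le_sum[of "A *\<^sub>v v"] show ?thesis by simp
qed

lemma opnorm_le:
  assumes "\<And>i j. i < dim_row A \<Longrightarrow> j < dim_col A \<Longrightarrow> \<bar>A $$ (i, j)\<bar> \<le> K"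
  shows "opnorm A \<le> real (dim_row A * dim_col A) * K"
  unfolding opnorm_def
proof (rule cSup_least)
  have "vnorm (0\<^sub>v (dim_col A)) \<le> 1" by (simp add: vnorm_def)
  then show "{vnorm (A *\<^sub>v v) |v. v \<in> carrier_vec (dim_col A) \<and> vnorm v \<le> 1} \<noteq> {}"
    using zero_carrier_vec by blast
qed (use vnorm_mult_le[OF assms] in auto)

lemma vnorm_le_opnorm:
  assumes "v \<in> carrier_vec (dim_col A)" "vnorm v \<le> 1"
  shows "vnorm (A *\<^sub>v v) \<le> opnorm A"
  unfolding opnorm_def
proof (rule cSup_upper)
  have "\<bar>A $$ (i, j)\<bar> \<le> norm (emb 0 0 A)" if "i < dim_row A" "j < dim_col A" for i j
    using that by (rule entry_le_norm_emb)
  then show "bdd_above {vnorm (A *\<^sub>v v) |v. v \<in> carrier_vec (dim_col A) \<and> vnorm v \<le> 1}"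
    using vnorm_mult_le[of A "norm (emb 0 0 A)"] unfolding bdd_above_def by blast
qed (use assms in auto)

lemma opnorm_nonneg: "0 \<le> opnorm A"
  using vnorm_le_opnorm[of "0\<^sub>v (dim_col A)" A] vnorm_nonneg[of "A *\<^sub>v 0\<^sub>v (dim_col A)"]
  by (simp add: vnorm_def)

lemma entry_le_opnorm:
  assumes "i < dim_row A" "j < dim_col A"
  shows "\<bar>A $$ (i, j)\<bar> \<le> opnorm A"
proof -
  let ?v = "unit_vec (dim_col A) j"
  have "vnorm ?v = 1"
    using assms by (simp add: vnorm_def unit_vec_def power2_eq_square if_distrib[of "\<lambda>x. x * _"] cong: if_cong)
  moreover have "vec_index (A *\<^sub>v ?v) i = A $$ (i, j)"
    using assms by simp
  ultimately show ?thesis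
    using entry_le_vnorm[of i "A *\<^sub>v ?v"] vnorm_le_opnorm[of ?v A] assms by simp
qed

text \<open>With \<open>emb_le_opnorm\<close> this makes the Euclidean norm and the norm of
  \<open>bop\<close> equivalent up to the number of entries, a constant factor that does not affect
  exponential rates.\<close>

lemma opnorm_le_emb: "opnorm A \<le> real (dim_row A * dim_col A) * norm (emb r c A)"
  by (rule opnorm_le) (rule entry_le_norm_emb)

lemma emb_le_opnorm: "norm (emb r c A) \<le> real (dim_row A * dim_col A) * opnorm A"
  by (rule norm_emb_le) (rule entry_le_opnorm)

section \<open>Inverses and Hurwitz matrices\<close>

text \<open>\<open>inverts_mat\<close> leaves the size of a competitor open; comparing dimensions in
  the two product equations fixes it, and then the usual uniqueness of inverses applies.\<close>

lemma minv_eqI: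
  assumes "A \<in> carrier_mat n n" "B \<in> carrier_mat n n" "A * B = 1\<^sub>m n" "B * A = 1\<^sub>m n"
  shows "minv A = B"
  unfolding minv_def
proof (rule the_equality)
  show "inverts_mat A B \<and> inverts_mat B A"
    using assms by (simp add: inverts_mat_def)
  fix B' assume B': "inverts_mat A B' \<and> inverts_mat B' A"
  then have AB: "A * B' = 1\<^sub>m n" "B' * A = 1\<^sub>m (dim_row B')"
    using assms by (auto simp: inverts_mat_def)
  have "dim_col B' = n" using arg_cong[OF AB(1), of dim_col] by simp
  moreover have "dim_row B' = n" using arg_cong[OF AB(2), of dim_col] assms by simp
  ultimately have c: "B' \<in> carrier_mat n n" by auto
  have "B' = B * A * B'" using assms c by simp
  also have "\<dots> = B * (A * B')" using assms c by (intro assoc_mult_mat) auto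
  also have "\<dots> = B" using AB assms by simp
  finally show "B' = B" .
qed

lemma minv_inverse:
  assumes "A \<in> carrier_mat n n" "invertible_mat A"
  shows "minv A \<in> carrier_mat n n" "A * minv A = 1\<^sub>m n" "minv A * A = 1\<^sub>m n"
proof -
  from assms obtain B where B: "inverts_mat A B" "inverts_mat B A"
    unfolding invertible_mat_def by auto
  have AB: "A * B = 1\<^sub>m n" "B * A = 1\<^sub>m (dim_row B)"
    using B assms by (auto simp: inverts_mat_def)
  have "dim_col B = n" using arg_cong[OF AB(1), of dim_col] by simp
  moreover have "dim_row B = n" using arg_cong[OF AB(2), of dim_col] assms by simp
  ultimately have c: "B \<in> carrier_mat n n" by auto
  then have "minv A = B"
    by (intro minv_eqI[OF assms(1)]) (use AB in auto)
  then show "minv A \<in> carrier_mat n n" "A * minv A = 1\<^sub>m n" "minv A * A = 1\<^sub>m n"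
    using AB c by auto
qed

text \<open>The number 0 does not have negative real part, so it is no eigenvalue. The complex
  determinant is therefore nonzero, and it is the image of the real one.\<close>

lemma hurwitz_invertible:
  assumes D: "D \<in> carrier_mat n n" and hw: "hurwitz D"
  shows "invertible_mat D"
proof -
  let ?D = "map_mat complex_of_real D"
  have "char_matrix ?D 0 = ?D"
    using D by (auto simp: char_matrix_def intro!: eq_matI)
  moreover have "\<not> eigenvalue ?D 0"
    using hw unfolding hurwitz_def by force
  ultimately have "det ?D \<noteq> 0"
    using D eigenvalue_det[of ?D n 0] by auto
  then have "det D \<noteq> 0"
    by (simp add: of_real_hom.hom_det)
  then have "D \<in> Units (ring_mat TYPE(real) n ())"
    by (rule det_non_zero_imp_unit[OF D])
  then obtain B where "B \<in> carrier_mat n n" "B * D = 1\<^sub>m n" "D * B = 1\<^sub>m n"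
    unfolding Units_def by (auto simp: ring_mat_def)
  then show ?thesis
    using D unfolding invertible_mat_def inverts_mat_def by auto
qed

text \<open>The eigenvalues of \<open>(D + m I) / (m - c)\<close> lie in the open unit disc as soon as \<open>m\<close> is large, so that
  the powers of this matrix are bounded; summing the exponential series of \<open>s (D + m I)\<close>
  and multiplying by \<open>e\<^sup>-\<^sup>s\<^sup>m\<close> gives the decay rate \<open>c\<close>.\<close>

lemma hurwitz_shift_powers:
  assumes D: "D \<in> carrier_mat n n" and n: "0 < n" and hw: "hurwitz D"
  obtains m c K where "0 < c" "c < m" "0 \<le> K"
    "\<And>k i j. i < n \<Longrightarrow> j < n \<Longrightarrow> \<bar>((D + m \<cdot>\<^sub>m 1\<^sub>m n) ^\<^sub>m k) $$ (i, j)\<bar> \<le> K * (m - c) ^ k"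
proof -
  let ?h = "map_mat complex_of_real"
  let ?D = "?h D"
  have cD: "?D \<in> carrier_mat n n" using D by simp
  let ?S = "spectrum ?D"
  have fin: "finite ?S" using card_finite_spectrum[OF cD] by auto
  have ne: "?S \<noteq> {}" by (rule spectrum_non_empty[OF cD n])
  have ev: "\<mu> \<in> ?S \<longleftrightarrow> eigenvalue ?D \<mu>" for \<mu> by (simp add: spectrum_def)
  \<comment> \<open>Half of the spectral gap, so that \<open>Re \<mu> \<le> - 2 * c\<close> leaves a
    surplus \<open>c\<close> over the claimed rate.\<close>
  define c where "c = Min ((\<lambda>\<mu>. - Re \<mu>) ` ?S) / 2"
  have "0 < Min ((\<lambda>\<mu>. - Re \<mu>) ` ?S)"
    using fin ne hw ev by (subst Min_gr_iff) (auto simp: hurwitz_def)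
  then have c: "0 < c" by (simp add: c_def)
  have re: "Re \<mu> \<le> - 2 * c" if "\<mu> \<in> ?S" for \<mu>
  proof -
    have "Min ((\<lambda>\<mu>. - Re \<mu>) ` ?S) \<le> - Re \<mu>"
      by (rule Min_le) (use fin that in auto)
    then show ?thesis by (simp add: c_def)
  qed
  define R where "R = Max (norm ` ?S)"
  have R: "norm \<mu> \<le> R" if "\<mu> \<in> ?S" for \<mu>
    unfolding R_def using fin that by (intro Max_ge) auto
  \<comment> \<open>Chosen to give \<open>R\<^sup>2 < 2 * c * m\<close>. Then the square of the
    modulus of \<open>\<mu> + m\<close> is at most \<open>R\<^sup>2 - 4 * c * m + m\<^sup>2\<close>,
    which is below \<open>(m - c)\<^sup>2\<close>.\<close>
  define m where "m = R\<^sup>2 / (2 * c) + c + 1"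
  have m: "c < m" "R\<^sup>2 < 2 * c * m"
  proof -
    have "0 \<le> R\<^sup>2 / (2 * c)" using c by simp
    then show "c < m" by (simp add: m_def)
    have "2 * c * m = R\<^sup>2 + 2 * c * (c + 1)" using c by (simp add: m_def field_simps)
    then show "R\<^sup>2 < 2 * c * m" using c by simp
  qed
  define A where "A = (1 / (m - c)) \<cdot>\<^sub>m (D + m \<cdot>\<^sub>m 1\<^sub>m n)"
  have A: "A \<in> carrier_mat n n" and hA: "?h A \<in> carrier_mat n n"
    using D by (auto simp: A_def)
  have "norm \<nu> < 1" if "\<nu> \<in> spectrum (?h A)" for \<nu>
  proof -
    from that obtain v where v: "v \<in> carrier_vec n" "v \<noteq> 0\<^sub>v n" "?h A *\<^sub>v v = \<nu> \<cdot>\<^sub>v v"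
      using hA A by (auto simp: spectrum_def eigenvalue_def eigenvector_def)
    \<comment> \<open>The eigenvalue of \<open>D\<close> that the affine map from \<open>D\<close>
      to \<open>A\<close> sends to \<open>\<nu>\<close>.\<close>
    define \<mu> where "\<mu> = complex_of_real (m - c) * \<nu> - complex_of_real m"
    have "?D *\<^sub>v v = \<mu> \<cdot>\<^sub>v v"
    proof (rule eq_vecI)
      fix i assume "i < dim_vec (\<mu> \<cdot>\<^sub>v v)"
      then have i: "i < n" using v by simp
      have mv: "vec_index (X *\<^sub>v v) i = (\<Sum>j<n. X $$ (i, j) * vec_index v j)" if "X \<in> carrier_mat n n" for X
        using that v i by (simp add: scalar_prod_def lessThan_atLeast0)
      have "vec_index (?h A *\<^sub>v v) i = \<nu> * vec_index v i"
        using v i by simp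
      moreover have "vec_index (?h A *\<^sub>v v) i =
        complex_of_real (1 / (m - c)) * (vec_index (?D *\<^sub>v v) i + complex_of_real m * vec_index v i)"
      proof -
        have e: "(\<Sum>j<n. (if i = j then 1 else 0) * vec_index v j) = vec_index v i"
          using i by (simp add: if_distrib[of "\<lambda>x. x * _"] cong: if_cong)
        have ent: "?h A $$ (i, j) * x = complex_of_real (1 / (m - c)) *
            (?D $$ (i, j) * x + complex_of_real m * ((if i = j then 1 else 0) * x))" if "j < n" for j x
          using that i D by (simp add: A_def algebra_simps)
        have "vec_index (?h A *\<^sub>v v) i = (\<Sum>j<n. complex_of_real (1 / (m - c)) *
            (?D $$ (i, j) * vec_index v j + complex_of_real m * ((if i = j then 1 else 0) * vec_index v j)))"
          unfolding mv[OF hA] by (rule sum.cong) (use ent in auto)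
        also have "\<dots> = complex_of_real (1 / (m - c)) * ((\<Sum>j<n. ?D $$ (i, j) * vec_index v j)
            + complex_of_real m * vec_index v i)"
          by (simp only: sum_distrib_left[symmetric] sum.distrib e)
        finally show ?thesis unfolding mv[OF cD] .
      qed
      ultimately have "complex_of_real (m - c) * (complex_of_real (1 / (m - c)) * (vec_index (?D *\<^sub>v v) i + complex_of_real m * vec_index v i))
          = complex_of_real (m - c) * (\<nu> * vec_index v i)" by simp
      moreover have "complex_of_real (m - c) * complex_of_real (1 / (m - c)) = 1"
        using m by (simp flip: of_real_mult)
      ultimately have "vec_index (?D *\<^sub>v v) i = \<mu> * vec_index v i"
        unfolding mult.assoc[symmetric] \<mu>_def by (simp add: algebra_simps)
      then show "vec_index (?D *\<^sub>v v) i = vec_index (\<mu> \<cdot>\<^sub>v v) i"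
        using v i by simp
    qed (use D v in auto)
    then have \<mu>S: "\<mu> \<in> ?S"
      using v D by (auto simp: spectrum_def eigenvalue_def eigenvector_def)
    have "norm (complex_of_real (m - c) * \<nu>) < m - c"
    proof (rule power2_less_imp_less)
      have "(norm (complex_of_real (m - c) * \<nu>))\<^sup>2 = (norm (\<mu> + complex_of_real m))\<^sup>2"
        by (simp add: \<mu>_def)
      also have "\<dots> = (norm \<mu>)\<^sup>2 + 2 * m * Re \<mu> + m\<^sup>2"
        unfolding cmod_power2 by (simp add: power2_eq_square algebra_simps)
      also have "\<dots> \<le> R\<^sup>2 + 2 * m * (- 2 * c) + m\<^sup>2"
        using R[OF \<mu>S] re[OF \<mu>S] m c by (intro add_mono power_mono mult_left_mono) auto
      also have "\<dots> < (m - c)\<^sup>2"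
        using m mult_pos_pos[OF c c] by (simp add: power2_eq_square algebra_simps)
      finally show "(norm (complex_of_real (m - c) * \<nu>))\<^sup>2 < (m - c)\<^sup>2" .
    qed (use m in auto)
    moreover have "norm (complex_of_real (m - c)) = m - c"
      using m by (simp only: norm_of_real)
    ultimately show ?thesis
      using m mult_less_cancel_left_pos[of "m - c" "norm \<nu>" 1] by (simp add: norm_mult)
  qed
  then have "spectral_radius (?h A) < 1"
    using spectral_radius_mem_max(1)[OF hA n] by auto
  from spectral_radius_jnf_norm_bound_less_1_upper_triangular[OF hA this]
  obtain K where K: "\<And>k. norm_bound (?h A ^\<^sub>m k) K" by auto
  have bnd: "\<bar>(A ^\<^sub>m k) $$ (i, j)\<bar> \<le> max K 0" if "i < n" "j < n" for i j k
  proof -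
    note Ak = carrier_matD[OF pow_carrier_mat[OF A, of k]]
    have "norm_bound (?h (A ^\<^sub>m k)) K"
      using K[of k] unfolding of_real_hom.mat_hom_pow[OF A] .
    then have "norm (?h (A ^\<^sub>m k) $$ (i, j)) \<le> K"
      unfolding norm_bound_def index_map_mat Ak using that by blast
    also have "?h (A ^\<^sub>m k) $$ (i, j) = complex_of_real ((A ^\<^sub>m k) $$ (i, j))"
      by (rule index_map_mat(1)) (simp_all only: Ak that)
    finally show ?thesis by simp
  qed
  have pow: "(a \<cdot>\<^sub>m X) ^\<^sub>m k = a ^ k \<cdot>\<^sub>m (X ^\<^sub>m k)" if "X \<in> carrier_mat n n" for a :: real and X k
  proof (induction k)
    case 0
    show ?case using that by (auto intro!: eq_matI)
  next
    case (Suc k)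
    have "X ^\<^sub>m k \<in> carrier_mat n n" by (rule pow_carrier_mat[OF that])
    then show ?case
      using that Suc by (auto simp: mult_smult_distrib[where nr=n and n=n and nc=n] mult_smult_assoc_mat[where nr=n and n=n and nc=n] intro!: eq_matI)
  qed
  show thesis
  proof (rule that[OF c m(1)])
    show "0 \<le> max K 0" by simp
    fix k i j assume ij: "i < n" "j < n"
    have DA: "D + m \<cdot>\<^sub>m 1\<^sub>m n = (m - c) \<cdot>\<^sub>m A"
      using m D by (auto simp: A_def field_simps intro!: eq_matI)
    have Ak: "A ^\<^sub>m k \<in> carrier_mat n n" by (rule pow_carrier_mat[OF A])
    have "((D + m \<cdot>\<^sub>m 1\<^sub>m n) ^\<^sub>m k) $$ (i, j) = (m - c) ^ k * (A ^\<^sub>m k) $$ (i, j)"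
      unfolding DA pow[OF A] using ij carrier_matD[OF Ak] by (simp only: index_smult_mat(1))
    then show "\<bar>((D + m \<cdot>\<^sub>m 1\<^sub>m n) ^\<^sub>m k) $$ (i, j)\<bar> \<le> max K 0 * (m - c) ^ k"
      using bnd[OF ij, of k] m by (simp add: abs_mult mult.commute mult_left_mono)
  qed
qed

lemma hurwitz_exp_decay:
  assumes D: "D \<in> carrier_mat n n" and n: "0 < n" and hw: "hurwitz D"
  obtains c K where "0 < c" "1 \<le> K"
    "\<And>s. 0 \<le> s \<Longrightarrow> norm (exp (s *\<^sub>R emb r r D) * pj r n) \<le> K * exp (- c * s)"
proof -
  from hurwitz_shift_powers[OF assms] obtain m c K where c: "0 < c" "c < m" "0 \<le> K" and
    K: "\<And>k i j. i < n \<Longrightarrow> j < n \<Longrightarrow> \<bar>((D + m \<cdot>\<^sub>m 1\<^sub>m n) ^\<^sub>m k) $$ (i, j)\<bar> \<le> K * (m - c) ^ k"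
    by metis
  let ?X = "emb r r D" and ?p = "pj r n"
  define Y where "Y = emb r r (D + m \<cdot>\<^sub>m 1\<^sub>m n)"
  have Y: "Y = ?X + m *\<^sub>R ?p"
    unfolding Y_def pj_def using D by (simp add: emb_add emb_smult)
  have comm: "?p * ?X = ?X" "?X * ?p = ?X"
    using D by (auto simp: emb_one_left emb_one_right)
  define L where "L = real (n * n) * K"
  have pow: "norm (Y ^ k * ?p) \<le> L * (m - c) ^ k" for k
  proof -
    let ?Z = "(D + m \<cdot>\<^sub>m 1\<^sub>m n) ^\<^sub>m k"
    have Z: "?Z \<in> carrier_mat n n" using D by (intro pow_carrier_mat) auto
    have "norm (emb r r ?Z) \<le> real (dim_row ?Z * dim_col ?Z) * (K * (m - c) ^ k)"
      by (rule norm_emb_le) (use K in \<open>simp only: carrier_matD[OF Z]\<close>)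
    moreover have "emb r r ?Z = Y ^ k * ?p"
      unfolding Y_def by (rule emb_pow) (use D in auto)
    ultimately show ?thesis by (simp only: carrier_matD[OF Z] L_def mult.assoc)
  qed
  have "norm (exp (s *\<^sub>R ?X) * ?p) \<le> (L + 1) * exp (- c * s)" if s: "0 \<le> s" for s
  proof -
    \<comment> \<open>On the corner \<open>m *\<^sub>R ?p\<close> acts like
      \<open>m *\<^sub>R 1\<close>, which commutes with everything and contributes only the scalar
      \<open>exp (s * m)\<close>.\<close>
    have "?p * Y = (?X + m *\<^sub>R 1) * ?p"
      by (simp add: Y comm pj_idem algebra_simps)
    then have "?p * exp (s *\<^sub>R Y) = exp (s *\<^sub>R (?X + m *\<^sub>R 1)) * ?p"
      by (rule exp_intertwine_scaleR)
    also have "exp (s *\<^sub>R (?X + m *\<^sub>R 1)) = exp (s *\<^sub>R ?X) * exp (of_real (s * m))"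
      by (subst exp_add_commuting[symmetric]) (auto simp: scaleR_add_right of_real_def)
    also have "\<dots> = exp (s * m) *\<^sub>R exp (s *\<^sub>R ?X)"
      by (simp only: exp_of_real) (simp add: of_real_def)
    finally have 1: "?p * exp (s *\<^sub>R Y) = exp (s * m) *\<^sub>R (exp (s *\<^sub>R ?X) * ?p)" by simp
    have "?p * Y = Y * ?p" by (simp add: Y comm algebra_simps)
    then have 2: "?p * exp (s *\<^sub>R Y) = exp (s *\<^sub>R Y) * ?p"
      by (rule exp_intertwine_scaleR)
    have sums: "(\<lambda>k. ((s *\<^sub>R Y) ^ k /\<^sub>R fact k) * ?p) sums (exp (s *\<^sub>R Y) * ?p)"
      unfolding exp_def by (intro sums_mult2 summable_sums summable_exp_generic)
    have bound: "norm (((s *\<^sub>R Y) ^ k /\<^sub>R fact k) * ?p) \<le> L * ((s * (m - c)) ^ k /\<^sub>R fact k)" for k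
    proof -
      have "norm (((s *\<^sub>R Y) ^ k /\<^sub>R fact k) * ?p) = s ^ k / fact k * norm (Y ^ k * ?p)"
        using s by (simp add: scaleR_power divide_inverse)
      also have "\<dots> \<le> s ^ k / fact k * (L * (m - c) ^ k)"
        using s by (intro mult_left_mono pow) auto
      finally show ?thesis by (simp add: power_mult_distrib divide_inverse mult_ac)
    qed
    have esums: "(\<lambda>k. L * ((s * (m - c)) ^ k /\<^sub>R fact k)) sums (L * exp (s * (m - c)))"
      by (intro sums_mult exp_converges)
    have "norm (exp (s *\<^sub>R Y) * ?p) \<le> L * exp (s * (m - c))"
      using norm_suminf_le[OF bound sums_summable[OF esums]] sums_unique[OF sums] sums_unique[OF esums] by simp
    then have "exp (s * m) * norm (exp (s *\<^sub>R ?X) * ?p) \<le> L * exp (s * (m - c))"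
      using 1 2 by simp
    also have "\<dots> = exp (s * m) * (L * exp (- c * s))"
      by (simp add: exp_add[symmetric] algebra_simps)
    finally have "norm (exp (s *\<^sub>R ?X) * ?p) \<le> L * exp (- c * s)" by simp
    then show ?thesis by (simp add: distrib_right add_increasing2)
  qed
  moreover have "1 \<le> L + 1" using c by (simp add: L_def)
  ultimately show thesis using that c by blast
qed

text \<open>\<open>D' - D\<close> is treated as a forcing of the flow of \<open>D\<close>. At half
  the rate the convolution contributes \<open>2 / c\<close>, so the tolerance
  \<open>c / (4 * K)\<close> reproduces the weighted maximum with factor \<open>1 / 2\<close>, which
  can be absorbed.\<close>

lemma exp_decay_perturb:
  fixes D D' q q' :: "'a::{real_normed_algebra_1,banach}"
  assumes decay: "\<And>s. 0 \<le> s \<Longrightarrow> norm (exp (s *\<^sub>R D) * q) \<le> K * exp (- c * s)"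
    and K: "1 \<le> K" and c: "0 < c" and q: "q * q = q" "q * D = D" "q * D' = D'"
    and close: "norm (D' - D) \<le> c / (4 * K)" and s: "0 \<le> s"
  shows "norm (exp (s *\<^sub>R D') * q) \<le> 2 * K * norm q * exp (- (c / 2) * s)"
proof -
  let ?y = "\<lambda>r. exp (r *\<^sub>R D') * q"
  have yd: "(?y has_vector_derivative D * ?y r + (D' - D) * ?y r) (at r)" for r
  proof -
    have "(?y has_vector_derivative (D' * exp (r *\<^sub>R D')) * q) (at r)"
      by (intro bounded_linear.has_vector_derivative[OF bounded_linear_mult_left] exp_scaleR_has_vector_derivative_left)
    then show ?thesis by (simp add: algebra_simps)
  qed
  have "continuous_on {0..s} (\<lambda>r. norm (?y r) * exp ((c / 2) * r))"
  proof -
    have 1: "continuous_on {0..s} ?y"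
      using yd by (meson continuous_at_imp_continuous_on has_vector_derivative_continuous)
    have 2: "continuous_on {0..s} (\<lambda>r. exp ((c / 2) * r))"
      by (intro continuous_intros)
    show ?thesis by (rule continuous_on_mult[OF continuous_on_norm[OF 1] 2])
  qed
  from continuous_attains_sup[OF _ _ this] s obtain r where r: "0 \<le> r" "r \<le> s"
    and max: "\<And>r'. 0 \<le> r' \<Longrightarrow> r' \<le> s \<Longrightarrow> norm (?y r') * exp ((c / 2) * r') \<le> norm (?y r) * exp ((c / 2) * r)"
    by auto
  define \<beta> where "\<beta> = norm (?y r) * exp ((c / 2) * r)"
  have y: "norm (?y r') \<le> \<beta> * exp (- (c / 2) * r')" if "0 \<le> r'" "r' \<le> s" for r'
    using max[OF that] by (simp add: \<beta>_def exp_minus field_simps)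
  have \<beta>0: "0 \<le> \<beta>" by (simp add: \<beta>_def)
  have "norm (?y r - exp (r *\<^sub>R D) * ?y 0) \<le>
      K * (c / (4 * K)) * \<beta> * ((exp (- (c / 2) * r) - exp (- c * r)) / (- (c / 2) - - c))
      + 0 * ((exp (- (c / 2) * r) - exp (- c * r)) / (- (c / 2) - - c))"
  proof (rule duhamel_exp_bound[OF r(1) yd])
    fix r' assume r': "0 \<le> r'" "r' \<le> r"
    have "q * (D' - D) = D' - D" by (simp add: algebra_simps q)
    moreover have "exp ((r - r') *\<^sub>R D) * q * (D' - D) * ?y r' = exp ((r - r') *\<^sub>R D) * ((q * (D' - D)) * ?y r')"
      by (simp only: mult.assoc)
    ultimately have "norm (exp ((r - r') *\<^sub>R D) * ((D' - D) * ?y r')) = norm (exp ((r - r') *\<^sub>R D) * q * (D' - D) * ?y r')"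
      by simp
    also have "\<dots> \<le> norm (exp ((r - r') *\<^sub>R D) * q) * norm (D' - D) * norm (?y r')"
      by (rule norm_mult3)
    also have "\<dots> \<le> (K * exp (- c * (r - r'))) * (c / (4 * K)) * (\<beta> * exp (- (c / 2) * r'))"
      using r r' K c by (intro mult_mono decay close y) (auto intro!: mult_nonneg_nonneg)
    finally show "norm (exp ((r - r') *\<^sub>R D) * ((D' - D) * ?y r')) \<le>
      exp (- c * (r - r')) * (K * (c / (4 * K)) * \<beta> * exp (- (c / 2) * r') + 0 * exp (- (c / 2) * r'))"
      by (simp only: mult_zero_left add_0_right) (simp only: mult_ac)
  qed (use c in auto)
  also have "\<dots> = \<beta> / 2 * (exp (- (c / 2) * r) - exp (- c * r))"
    using K c by (simp add: field_simps)
  also have "\<dots> \<le> \<beta> / 2 * exp (- (c / 2) * r)"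
    using \<beta>0 by (intro mult_left_mono) auto
  finally have 1: "norm (?y r - exp (r *\<^sub>R D) * q) \<le> \<beta> / 2 * exp (- (c / 2) * r)" by simp
  have "norm (exp (r *\<^sub>R D) * q) = norm (exp (r *\<^sub>R D) * q * q)" by (simp add: mult.assoc q)
  also have "\<dots> \<le> (K * exp (- c * r)) * norm q"
    by (intro order_trans[OF norm_mult_ineq] mult_right_mono decay r) auto
  also have "\<dots> \<le> (K * exp (- (c / 2) * r)) * norm q"
    using K c r by (intro mult_right_mono mult_left_mono) auto
  finally have 2: "norm (exp (r *\<^sub>R D) * q) \<le> K * norm q * exp (- (c / 2) * r)" by (simp add: mult_ac)
  have "norm (?y r) \<le> norm (exp (r *\<^sub>R D) * q) + norm (?y r - exp (r *\<^sub>R D) * q)"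
    by (rule norm_triangle_sub)
  with 1 2 have "norm (?y r) \<le> (K * norm q + \<beta> / 2) * exp (- (c / 2) * r)"
    by (simp add: distrib_right)
  then have "\<beta> \<le> K * norm q + \<beta> / 2"
    by (simp add: \<beta>_def exp_minus field_simps)
  then have "\<beta> \<le> 2 * K * norm q" by simp
  then show ?thesis
    using y[OF s order_refl] by (meson exp_ge_zero mult_right_mono order_trans)
qed

section \<open>Compact sets of modes\<close>

text \<open>Continuity of inversion in a corner with unit \<open>e\<close>, by the identity
  \<open>g x - b = g x * (a - f x) * b\<close>. It first bounds \<open>g x\<close> by twice the norm
  of \<open>b\<close> and then shows that the difference vanishes.\<close>

lemma tendsto_corner_inverse:
  fixes f g :: "'x \<Rightarrow> 'a::real_normed_algebra"
  assumes f: "(f \<longlongrightarrow> a) F"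
    and fg: "\<forall>\<^sub>F x in F. g x * f x = e \<and> g x * e = g x"
    and ab: "a * b = e" "e * b = b"
  shows "(g \<longlongrightarrow> b) F"
proof -
  have "((\<lambda>x. norm (a - f x) * norm b) \<longlongrightarrow> norm (a - a) * norm b) F"
    by (intro tendsto_intros f)
  then have small: "\<forall>\<^sub>F x in F. norm (a - f x) * norm b < 1 / 2"
    using order_tendstoD(2)[of "\<lambda>x. norm (a - f x) * norm b" 0 F "1 / 2"] by simp
  have "\<forall>\<^sub>F x in F. norm (g x - b) \<le> 2 * norm b * (norm (a - f x) * norm b)"
    using fg small
  proof eventually_elim
    case (elim x)
    have "g x - b = g x * e - e * b" using elim ab by simp
    also have "\<dots> = g x * (a - f x) * b"
      using elim ab by (simp add: left_diff_distrib right_diff_distrib mult.assoc)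
    finally have "norm (g x - b) \<le> norm (g x) * norm (a - f x) * norm b"
      by (simp add: norm_mult3)
    then have 1: "norm (g x - b) \<le> norm (g x) * (norm (a - f x) * norm b)" by (simp add: mult.assoc)
    also have "\<dots> \<le> norm (g x) * (1 / 2)" using elim by (intro mult_left_mono) auto
    finally have "norm (g x) \<le> norm b + norm (g x) * (1 / 2)"
      using norm_triangle_sub[of "g x" b] by linarith
    then have "norm (g x) \<le> 2 * norm b" by simp
    then have "norm (g x) * (norm (a - f x) * norm b) \<le> 2 * norm b * (norm (a - f x) * norm b)"
      by (intro mult_right_mono) auto
    with 1 show ?case by linarith
  qed
  moreover have "((\<lambda>x. 2 * norm b * (norm (a - f x) * norm b)) \<longlongrightarrow> 2 * norm b * (norm (a - a) * norm b)) F"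
    by (intro tendsto_intros f)
  then have "((\<lambda>x. 2 * norm b * (norm (a - f x) * norm b)) \<longlongrightarrow> 0) F" by simp
  ultimately have "((\<lambda>x. g x - b) \<longlongrightarrow> 0) F"
    by (rule Lim_null_comparison)
  then show ?thesis by (simp add: LIM_zero_cancel)
qed

text \<open>Compactness of \<open>K\<close> is stated through \<open>mode_embed\<close>; pulling
  neighbourhoods back along this map, within \<open>K\<close>, gives a notion of convergence for
  modes themselves.\<close>

definition mode_nhds :: "mode set \<Rightarrow> mode \<Rightarrow> mode filter" where
  "mode_nhds K \<sigma> = inf (filtercomap mode_embed (nhds (mode_embed \<sigma>))) (principal K)"

lemma eventually_mode_nhds:
  "eventually P (mode_nhds K \<sigma>) \<longleftrightarrow>
     (\<exists>U. open U \<and> mode_embed \<sigma> \<in> U \<and> (\<forall>\<sigma>'\<in>K. mode_embed \<sigma>' \<in> U \<longrightarrow> P \<sigma>'))"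
  (is "_ \<longleftrightarrow> ?rhs")
proof
  assume "eventually P (mode_nhds K \<sigma>)"
  then show ?rhs
    unfolding mode_nhds_def eventually_inf_principal eventually_filtercomap eventually_nhds by blast
next
  assume ?rhs
  then obtain U where "open U" "mode_embed \<sigma> \<in> U" "\<forall>\<sigma>'\<in>K. mode_embed \<sigma>' \<in> U \<longrightarrow> P \<sigma>'" by blast
  then show "eventually P (mode_nhds K \<sigma>)"
    unfolding mode_nhds_def eventually_inf_principal eventually_filtercomap eventually_nhds
    by (intro exI[of _ "\<lambda>y. y \<in> U"]) blast
qed

lemma eventually_mode_nhds_in: "eventually (\<lambda>\<sigma>'. \<sigma>' \<in> K) (mode_nhds K \<sigma>)"
  unfolding eventually_mode_nhds by (intro exI[of _ UNIV]) auto

text \<open>A finite subcover of neighbourhoods with local constants; since \<open>Q\<close> is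
  monotone in the constant, their maximum works everywhere.\<close>

lemma compact_modes_uniform:
  fixes Q :: "real \<Rightarrow> mode \<Rightarrow> bool"
  assumes comp: "compact (mode_embed ` K)"
    and loc: "\<And>\<sigma>. \<sigma> \<in> K \<Longrightarrow> \<exists>C. eventually (Q C) (mode_nhds K \<sigma>)"
    and mono: "\<And>C C' \<sigma>. C \<le> C' \<Longrightarrow> Q C \<sigma> \<Longrightarrow> Q C' \<sigma>"
  obtains C where "\<And>\<sigma>. \<sigma> \<in> K \<Longrightarrow> Q C \<sigma>" "1 \<le> C"
proof -
  have "\<forall>\<sigma>\<in>K. \<exists>U C. open U \<and> mode_embed \<sigma> \<in> U \<and> (\<forall>\<sigma>'\<in>K. mode_embed \<sigma>' \<in> U \<longrightarrow> Q C \<sigma>')"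
    using loc unfolding eventually_mode_nhds by metis
  then obtain U C where UC: "\<And>\<sigma>. \<sigma> \<in> K \<Longrightarrow> open (U \<sigma>)" "\<And>\<sigma>. \<sigma> \<in> K \<Longrightarrow> mode_embed \<sigma> \<in> U \<sigma>"
    "\<And>\<sigma> \<sigma>'. \<sigma> \<in> K \<Longrightarrow> \<sigma>' \<in> K \<Longrightarrow> mode_embed \<sigma>' \<in> U \<sigma> \<Longrightarrow> Q (C \<sigma>) \<sigma>'"
    by metis
  from compactE_image[OF comp, of K U] UC obtain K' where K': "K' \<subseteq> K" "finite K'" "mode_embed ` K \<subseteq> (\<Union>\<sigma>\<in>K'. U \<sigma>)"
    by (metis (no_types, lifting) UN_iff image_subsetI)
  define C' where "C' = Max (insert 1 (C ` K'))"
  have "Q C' \<sigma>" if "\<sigma> \<in> K" for \<sigma>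
  proof -
    have "mode_embed \<sigma> \<in> (\<Union>\<sigma>\<in>K'. U \<sigma>)" by (rule subsetD[OF K'(3) imageI[OF that]])
    then obtain \<sigma>' where s: "\<sigma>' \<in> K'" "mode_embed \<sigma> \<in> U \<sigma>'" by (rule UN_E)
    have "C \<sigma>' \<le> C'" unfolding C'_def using K' s by (intro Max_ge) auto
    moreover have "Q (C \<sigma>') \<sigma>" by (rule UC(3)) (use s that K'(1) in auto)
    ultimately show ?thesis by (rule mono)
  qed
  moreover have "1 \<le> C'" unfolding C'_def using K' by (intro Max_ge) auto
  ultimately show thesis by (rule that)
qed

lemma tendsto_locally_bounded:
  fixes f :: "'x \<Rightarrow> 'a::real_normed_vector"
  assumes "(f \<longlongrightarrow> a) F"
  shows "\<exists>C. eventually (\<lambda>x. norm (f x) \<le> C) F"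
proof -
  have "eventually (\<lambda>x. norm (f x) < norm a + 1) F"
    by (rule order_tendstoD(2)[OF tendsto_norm[OF assms]]) simp
  then show ?thesis by (intro exI[of _ "norm a + 1"]) (auto elim: eventually_mono)
qed

locale modes =
  fixes d :: nat and K :: "mode set"
  assumes d2: "2 \<le> d"
    and K_modes: "\<And>\<sigma>. \<sigma> \<in> K \<Longrightarrow> 1 \<le> ml \<sigma> \<and> ml \<sigma> \<le> d - 1 \<and>
        mP \<sigma> \<in> carrier_mat d d \<and> invertible_mat (mP \<sigma>) \<and>
        mLam \<sigma> \<in> carrier_mat d d \<and> mR \<sigma> \<in> carrier_mat d d"
    and K_compact: "compact (mode_embed ` K)"
    and D_hurwitz: "\<And>\<sigma>. \<sigma> \<in> K \<Longrightarrow> hurwitz (bD \<sigma>)"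
begin

abbreviation "e \<equiv> pj 0 d"
abbreviation "p \<sigma> \<equiv> pj 0 (ml \<sigma>)"
abbreviation "q \<sigma> \<equiv> pj (ml \<sigma>) (d - ml \<sigma>)"
definition "eP \<sigma> = emb 0 0 (mP \<sigma>)"
definition "ePi \<sigma> = emb 0 0 (minv (mP \<sigma>))"
definition "eL \<sigma> = emb 0 0 (mLam \<sigma>)"
definition "eR \<sigma> = emb 0 0 (mR \<sigma>)"
definition "eA \<sigma> = emb 0 0 (bA \<sigma>)"
definition "eB \<sigma> = emb 0 (ml \<sigma>) (bB \<sigma>)"
definition "eC \<sigma> = emb (ml \<sigma>) 0 (bC \<sigma>)"
definition "eD \<sigma> = emb (ml \<sigma>) (ml \<sigma>) (bD \<sigma>)"
definition "eDi \<sigma> = emb (ml \<sigma>) (ml \<sigma>) (minv (bD \<sigma>))"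
definition "eM \<sigma> = emb 0 0 (Mm \<sigma>)"
definition "eT \<sigma> = emb 0 0 (Tm \<sigma>)"
definition "eTi \<sigma> = emb 0 0 (minv (Tm \<sigma>))"
definition "eQ \<sigma> = eDi \<sigma> * eC \<sigma>"

context
  fixes \<sigma> assumes \<sigma>: "\<sigma> \<in> K"
begin

lemma ml_bounds: "1 \<le> ml \<sigma>" "ml \<sigma> < d" "ml \<sigma> + (d - ml \<sigma>) = d"
  using K_modes[OF \<sigma>] d2 by auto

lemma mdim_eq: "mdim \<sigma> = d"
  using K_modes[OF \<sigma>] carrier_matD(1)[of "mP \<sigma>" d d] by (simp add: mdim_def)

lemma carriers: "mP \<sigma> \<in> carrier_mat d d" "mLam \<sigma> \<in> carrier_mat d d" "mR \<sigma> \<in> carrier_mat d d"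
  using K_modes[OF \<sigma>] by auto

lemma minv_mP: "minv (mP \<sigma>) \<in> carrier_mat d d" "mP \<sigma> * minv (mP \<sigma>) = 1\<^sub>m d" "minv (mP \<sigma>) * mP \<sigma> = 1\<^sub>m d"
  using minv_inverse[of "mP \<sigma>" d] K_modes[OF \<sigma>] by auto

lemma block_facts:
  "bA \<sigma> \<in> carrier_mat (ml \<sigma>) (ml \<sigma>)" "bB \<sigma> \<in> carrier_mat (ml \<sigma>) (d - ml \<sigma>)"
  "bC \<sigma> \<in> carrier_mat (d - ml \<sigma>) (ml \<sigma>)" "bD \<sigma> \<in> carrier_mat (d - ml \<sigma>) (d - ml \<sigma>)"
  "mLam \<sigma> * minv (mP \<sigma>) = four_block_mat (bA \<sigma>) (bB \<sigma>) (bC \<sigma>) (bD \<sigma>)"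
proof -
  have s: "split_block (mLam \<sigma> * minv (mP \<sigma>)) (ml \<sigma>) (ml \<sigma>) = (bA \<sigma>, bB \<sigma>, bC \<sigma>, bD \<sigma>)"
    by (simp add: bA_def bB_def bC_def bD_def blocks_def)
  have dims: "dim_row (mLam \<sigma> * minv (mP \<sigma>)) = ml \<sigma> + (d - ml \<sigma>)" "dim_col (mLam \<sigma> * minv (mP \<sigma>)) = ml \<sigma> + (d - ml \<sigma>)"
    using carriers minv_mP ml_bounds by auto
  show "bA \<sigma> \<in> carrier_mat (ml \<sigma>) (ml \<sigma>)" "bB \<sigma> \<in> carrier_mat (ml \<sigma>) (d - ml \<sigma>)"
    "bC \<sigma> \<in> carrier_mat (d - ml \<sigma>) (ml \<sigma>)" "bD \<sigma> \<in> carrier_mat (d - ml \<sigma>) (d - ml \<sigma>)"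
    "mLam \<sigma> * minv (mP \<sigma>) = four_block_mat (bA \<sigma>) (bB \<sigma>) (bC \<sigma>) (bD \<sigma>)"
    using split_block[OF s dims] by auto
qed

lemma minv_bD: "minv (bD \<sigma>) \<in> carrier_mat (d - ml \<sigma>) (d - ml \<sigma>)"
  "bD \<sigma> * minv (bD \<sigma>) = 1\<^sub>m (d - ml \<sigma>)" "minv (bD \<sigma>) * bD \<sigma> = 1\<^sub>m (d - ml \<sigma>)"
  using minv_inverse[OF block_facts(4) hurwitz_invertible[OF block_facts(4) D_hurwitz[OF \<sigma>]]] by auto

lemma e_split: "e = p \<sigma> + q \<sigma>"
  using pj_add[of 0 "ml \<sigma>" "d - ml \<sigma>"] ml_bounds by simp

lemma pq: "p \<sigma> * p \<sigma> = p \<sigma>" "q \<sigma> * q \<sigma> = q \<sigma>" "p \<sigma> * q \<sigma> = 0" "q \<sigma> * p \<sigma> = 0"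
  by (simp_all add: pj_idem) (simp_all add: pj_def emb_mult_disjoint)

lemma corners:
  "p \<sigma> * eA \<sigma> = eA \<sigma>" "eA \<sigma> * p \<sigma> = eA \<sigma>" "q \<sigma> * eD \<sigma> = eD \<sigma>" "eD \<sigma> * q \<sigma> = eD \<sigma>"
  "p \<sigma> * eB \<sigma> = eB \<sigma>" "eB \<sigma> * q \<sigma> = eB \<sigma>" "q \<sigma> * eC \<sigma> = eC \<sigma>" "eC \<sigma> * p \<sigma> = eC \<sigma>"
  "q \<sigma> * eDi \<sigma> = eDi \<sigma>" "eDi \<sigma> * q \<sigma> = eDi \<sigma>"
  unfolding eA_def eB_def eC_def eD_def eDi_def using block_facts minv_bD
  by (auto simp: emb_one_left emb_one_right)

lemma e_mult: "e * eP \<sigma> = eP \<sigma>" "eP \<sigma> * e = eP \<sigma>" "e * ePi \<sigma> = ePi \<sigma>" "ePi \<sigma> * e = ePi \<sigma>"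
  "e * eL \<sigma> = eL \<sigma>" "eL \<sigma> * e = eL \<sigma>" "e * eR \<sigma> = eR \<sigma>" "eR \<sigma> * e = eR \<sigma>"
  unfolding eP_def ePi_def eL_def eR_def using carriers minv_mP
  by (auto simp: emb_one_left emb_one_right)

lemma inverses: "eP \<sigma> * ePi \<sigma> = e" "ePi \<sigma> * eP \<sigma> = e" "eD \<sigma> * eDi \<sigma> = q \<sigma>" "eDi \<sigma> * eD \<sigma> = q \<sigma>"
  unfolding eP_def ePi_def eD_def eDi_def pj_def using carriers minv_mP block_facts minv_bD
  by (auto simp: emb_mult)

lemma eL_ePi: "eL \<sigma> * ePi \<sigma> = eA \<sigma> + eB \<sigma> + eC \<sigma> + eD \<sigma>"
proof -
  have "eL \<sigma> * ePi \<sigma> = emb 0 0 (four_block_mat (bA \<sigma>) (bB \<sigma>) (bC \<sigma>) (bD \<sigma>))"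
    unfolding eL_def ePi_def block_facts(5)[symmetric] using carriers minv_mP by (auto simp: emb_mult)
  then show ?thesis
    unfolding eA_def eB_def eC_def eD_def by (simp add: emb_four_block[OF block_facts(1-4)])
qed

lemma Mm_carrier: "Mm \<sigma> \<in> carrier_mat (ml \<sigma>) (ml \<sigma>)"
  unfolding Mm_def using block_facts minv_bD by auto

lemma eM_eq: "eM \<sigma> = eA \<sigma> - eB \<sigma> * eQ \<sigma>"
proof -
  have "eM \<sigma> = emb 0 0 (bA \<sigma>) - emb 0 0 (bB \<sigma> * minv (bD \<sigma>) * bC \<sigma>)"
    unfolding eM_def Mm_def by (rule emb_minus) (use block_facts minv_bD in auto)
  also have "emb 0 0 (bB \<sigma> * minv (bD \<sigma>) * bC \<sigma>) = eB \<sigma> * eDi \<sigma> * eC \<sigma>"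
    unfolding eB_def eDi_def eC_def using block_facts minv_bD by (auto simp: emb_mult)
  finally show ?thesis by (simp add: eA_def eQ_def mult.assoc)
qed

lemma corners_Q: "q \<sigma> * eQ \<sigma> = eQ \<sigma>" "eQ \<sigma> * p \<sigma> = eQ \<sigma>" "p \<sigma> * eQ \<sigma> = 0" "eQ \<sigma> * q \<sigma> = 0" "eQ \<sigma> * eQ \<sigma> = 0"
  "e * eQ \<sigma> = eQ \<sigma>" "eQ \<sigma> * e = eQ \<sigma>" "eD \<sigma> * eQ \<sigma> = eC \<sigma>"
proof -
  show 1: "q \<sigma> * eQ \<sigma> = eQ \<sigma>" and 2: "eQ \<sigma> * p \<sigma> = eQ \<sigma>"
    unfolding eQ_def by (simp_all add: corners mult.assoc[symmetric]) (simp add: corners mult.assoc)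
  have "p \<sigma> * (q \<sigma> * eQ \<sigma>) = 0" "eQ \<sigma> * p \<sigma> * q \<sigma> = 0" "eQ \<sigma> * p \<sigma> * (q \<sigma> * eQ \<sigma>) = 0"
    by (simp_all add: mult.assoc pq) (simp add: mult.assoc[symmetric] pq)+
  then show "p \<sigma> * eQ \<sigma> = 0" "eQ \<sigma> * q \<sigma> = 0" "eQ \<sigma> * eQ \<sigma> = 0" by (simp_all add: 1 2)
  then show "e * eQ \<sigma> = eQ \<sigma>" "eQ \<sigma> * e = eQ \<sigma>" by (simp_all add: e_split algebra_simps 1 2)
  show "eD \<sigma> * eQ \<sigma> = eC \<sigma>"
    unfolding eQ_def by (simp add: mult.assoc[symmetric] inverses corners)
qed

lemma eM_corners: "p \<sigma> * eM \<sigma> = eM \<sigma>" "eM \<sigma> * p \<sigma> = eM \<sigma>"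
  unfolding eM_def using Mm_carrier by (auto simp: emb_one_left emb_one_right)

lemma Tm_carrier: "Tm \<sigma> \<in> carrier_mat d d"
  unfolding Tm_def mdim_eq using carriers ml_bounds block_facts minv_bD by auto

lemma eT_eq: "eT \<sigma> = (e + eQ \<sigma>) * eP \<sigma>"
proof -
  let ?F = "four_block_mat (1\<^sub>m (ml \<sigma>)) (0\<^sub>m (ml \<sigma>) (d - ml \<sigma>)) (minv (bD \<sigma>) * bC \<sigma>) (1\<^sub>m (d - ml \<sigma>))"
  have c: "minv (bD \<sigma>) * bC \<sigma> \<in> carrier_mat (d - ml \<sigma>) (ml \<sigma>)" using block_facts minv_bD by auto
  have "eT \<sigma> = emb 0 0 ?F * eP \<sigma>"
    unfolding eT_def Tm_def mdim_eq eP_def using carriers ml_bounds by (subst emb_mult) auto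
  also have "emb 0 0 ?F = p \<sigma> + emb (ml \<sigma>) 0 (minv (bD \<sigma>) * bC \<sigma>) + q \<sigma>"
    by (subst emb_four_block[OF _ _ c]) (auto simp: emb_zero pj_def)
  also have "emb (ml \<sigma>) 0 (minv (bD \<sigma>) * bC \<sigma>) = eQ \<sigma>"
    unfolding eQ_def eDi_def eC_def using block_facts minv_bD by (auto simp: emb_mult)
  finally show ?thesis by (simp add: e_split algebra_simps)
qed

text \<open>\<open>Q\<close> maps slow to fast coordinates, so \<open>Q\<close> squares to 0 and
  \<open>e - Q\<close> inverts \<open>e + Q\<close> in the corner.\<close>

lemma eT_inverse_formula:
  "eT \<sigma> * (ePi \<sigma> * (e - eQ \<sigma>)) = e" "(ePi \<sigma> * (e - eQ \<sigma>)) * eT \<sigma> = e"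
proof -
  have "eT \<sigma> * (ePi \<sigma> * (e - eQ \<sigma>)) = (e + eQ \<sigma>) * (eP \<sigma> * ePi \<sigma>) * (e - eQ \<sigma>)"
    by (simp add: eT_eq mult.assoc)
  also have "\<dots> = e" by (simp add: inverses algebra_simps corners_Q pj_idem)
  finally show "eT \<sigma> * (ePi \<sigma> * (e - eQ \<sigma>)) = e" .
  have "(ePi \<sigma> * (e - eQ \<sigma>)) * eT \<sigma> = ePi \<sigma> * ((e - eQ \<sigma>) * (e + eQ \<sigma>)) * eP \<sigma>"
    by (simp add: eT_eq mult.assoc)
  also have "(e - eQ \<sigma>) * (e + eQ \<sigma>) = e" by (simp add: algebra_simps corners_Q pj_idem)
  finally show "(ePi \<sigma> * (e - eQ \<sigma>)) * eT \<sigma> = e" by (simp add: e_mult inverses)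
qed

text \<open>As \<open>minv\<close> is given by a description, an explicit candidate is built from
  blocks. The two product equations are checked in \<open>bop\<close> and pulled back by injectivity
  of \<open>emb\<close>.\<close>

lemma minv_Tm: "minv (Tm \<sigma>) \<in> carrier_mat d d" "eTi \<sigma> = ePi \<sigma> * (e - eQ \<sigma>)"
proof -
  let ?F = "four_block_mat (1\<^sub>m (ml \<sigma>)) (0\<^sub>m (ml \<sigma>) (d - ml \<sigma>)) (- (minv (bD \<sigma>) * bC \<sigma>)) (1\<^sub>m (d - ml \<sigma>))"
  define X where "X = minv (mP \<sigma>) * ?F"
  have c: "- (minv (bD \<sigma>) * bC \<sigma>) \<in> carrier_mat (d - ml \<sigma>) (ml \<sigma>)" using block_facts minv_bD by auto
  have X: "X \<in> carrier_mat d d" unfolding X_def using minv_mP ml_bounds by auto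
  have "emb 0 0 X = ePi \<sigma> * emb 0 0 ?F"
    unfolding X_def ePi_def using minv_mP ml_bounds by (subst emb_mult) auto
  also have "emb 0 0 ?F = p \<sigma> + emb (ml \<sigma>) 0 (- (minv (bD \<sigma>) * bC \<sigma>)) + q \<sigma>"
    by (subst emb_four_block[OF _ _ c]) (auto simp: emb_zero pj_def)
  also have "emb (ml \<sigma>) 0 (- (minv (bD \<sigma>) * bC \<sigma>)) = - emb (ml \<sigma>) 0 (minv (bD \<sigma>) * bC \<sigma>)"
    using block_facts minv_bD unfolding emb_def by (simp add: sum_negf)
  also have "emb (ml \<sigma>) 0 (minv (bD \<sigma>) * bC \<sigma>) = eQ \<sigma>"
    unfolding eQ_def eDi_def eC_def using block_facts minv_bD by (auto simp: emb_mult)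
  finally have eX: "emb 0 0 X = ePi \<sigma> * (e - eQ \<sigma>)" by (simp add: e_split algebra_simps)
  have "minv (Tm \<sigma>) = X"
  proof (rule minv_eqI[OF Tm_carrier X])
    have "emb 0 0 (Tm \<sigma> * X) = emb 0 0 (1\<^sub>m d)" "emb 0 0 (X * Tm \<sigma>) = emb 0 0 (1\<^sub>m d)"
      using eT_inverse_formula unfolding emb_mult_carrier[OF Tm_carrier X, of 0 0 0]
        emb_mult_carrier[OF X Tm_carrier, of 0 0 0] eX eT_def pj_def by auto
    then show "Tm \<sigma> * X = 1\<^sub>m d" "X * Tm \<sigma> = 1\<^sub>m d"
      by (auto elim!: emb_eqD[rotated 2] simp: carrier_matD[OF Tm_carrier] carrier_matD[OF X])
  qed
  then show "minv (Tm \<sigma>) \<in> carrier_mat d d" "eTi \<sigma> = ePi \<sigma> * (e - eQ \<sigma>)"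
    using X eX by (simp_all add: eTi_def)
qed

lemma eT_inverses: "eT \<sigma> * eTi \<sigma> = e" "eTi \<sigma> * eT \<sigma> = e" "e * eT \<sigma> = eT \<sigma>" "eT \<sigma> * e = eT \<sigma>" "e * eTi \<sigma> = eTi \<sigma>" "eTi \<sigma> * e = eTi \<sigma>"
proof -
  show "eT \<sigma> * eTi \<sigma> = e" "eTi \<sigma> * eT \<sigma> = e"
    unfolding minv_Tm(2) by (rule eT_inverse_formula)+
  show "e * eT \<sigma> = eT \<sigma>" "eT \<sigma> * e = eT \<sigma>" "e * eTi \<sigma> = eTi \<sigma>" "eTi \<sigma> * e = eTi \<sigma>"
    unfolding eT_def eTi_def using minv_Tm(1) Tm_carrier by (auto simp: emb_one_left emb_one_right)
qed

text \<open>The summands are, in this order, the \<open>M\<close>, \<open>B\<close>,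
  \<open>N\<close>, \<open>S\<close> and scaled \<open>D\<close> of
  \<open>slow_fast\<close>.\<close>

definition "sing_gen \<epsilon> = eM \<sigma> + eB \<sigma> + eQ \<sigma> * eM \<sigma> + eQ \<sigma> * eB \<sigma> + (1 / \<epsilon>) *\<^sub>R eD \<sigma>"

lemma gen_carrier_emb:
  assumes "0 < \<epsilon>"
  shows "gen \<epsilon> \<sigma> \<in> carrier_mat d d" "emb 0 0 (gen \<epsilon> \<sigma>) = ePi \<sigma> * (p \<sigma> + (1 / \<epsilon>) *\<^sub>R q \<sigma>) * eL \<sigma>"
proof -
  have E: "emb 0 0 (E_mat d (ml \<sigma>) x) = p \<sigma> + x *\<^sub>R q \<sigma>" for x
  proof -
    have "E_mat d (ml \<sigma>) x = four_block_mat (1\<^sub>m (ml \<sigma>)) (0\<^sub>m (ml \<sigma>) (d - ml \<sigma>)) (0\<^sub>m (d - ml \<sigma>) (ml \<sigma>)) (x \<cdot>\<^sub>m 1\<^sub>m (d - ml \<sigma>))"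
      using ml_bounds by (auto simp: E_mat_def intro!: eq_matI)
    then show ?thesis by (simp only:) (subst emb_four_block; auto simp: emb_zero emb_smult pj_def)
  qed
  have cE: "E_mat d (ml \<sigma>) x \<in> carrier_mat d d" for x by (simp add: E_mat_def)
  define X where "X = minv (mP \<sigma>) * E_mat d (ml \<sigma>) (1 / \<epsilon>)"
  have X: "X \<in> carrier_mat d d" unfolding X_def by (rule mult_carrier_mat[OF minv_mP(1) cE])
  have eX: "emb 0 0 X = ePi \<sigma> * (p \<sigma> + (1 / \<epsilon>) *\<^sub>R q \<sigma>)"
    unfolding X_def ePi_def E[symmetric] by (rule emb_mult_carrier[OF minv_mP(1) cE])
  let ?Y = "E_mat d (ml \<sigma>) \<epsilon> * mP \<sigma>"
  have Y: "?Y \<in> carrier_mat d d" by (rule mult_carrier_mat[OF cE carriers(1)])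
  have eY: "emb 0 0 ?Y = (p \<sigma> + \<epsilon> *\<^sub>R q \<sigma>) * eP \<sigma>"
    unfolding eP_def E[symmetric] by (rule emb_mult_carrier[OF cE carriers(1)])
  have "minv ?Y = X"
  proof (rule minv_eqI[OF Y X])
    have "emb 0 0 (?Y * X) = emb 0 0 ?Y * emb 0 0 X" by (rule emb_mult_carrier[OF Y X])
    also have "\<dots> = (p \<sigma> + \<epsilon> *\<^sub>R q \<sigma>) * (eP \<sigma> * ePi \<sigma>) * (p \<sigma> + (1 / \<epsilon>) *\<^sub>R q \<sigma>)"
      unfolding eX eY by (simp add: mult.assoc)
    also have "\<dots> = e" unfolding inverses using assms by (simp add: e_split algebra_simps pq)
    finally show "?Y * X = 1\<^sub>m d"
      unfolding pj_def using X Y by (auto elim!: emb_eqD[rotated 2])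
    have "emb 0 0 (X * ?Y) = emb 0 0 X * emb 0 0 ?Y" by (rule emb_mult_carrier[OF X Y])
    also have "\<dots> = ePi \<sigma> * ((p \<sigma> + (1 / \<epsilon>) *\<^sub>R q \<sigma>) * (p \<sigma> + \<epsilon> *\<^sub>R q \<sigma>)) * eP \<sigma>"
      unfolding eX eY by (simp add: mult.assoc)
    also have "(p \<sigma> + (1 / \<epsilon>) *\<^sub>R q \<sigma>) * (p \<sigma> + \<epsilon> *\<^sub>R q \<sigma>) = e" using assms by (simp add: e_split algebra_simps pq)
    finally show "X * ?Y = 1\<^sub>m d"
      unfolding e_mult inverses unfolding pj_def using X Y by (auto elim!: emb_eqD[rotated 2])
  qed
  then have g: "gen \<epsilon> \<sigma> = X * mLam \<sigma>" by (simp add: gen_def mdim_eq)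
  show "gen \<epsilon> \<sigma> \<in> carrier_mat d d" unfolding g using X carriers by auto
  show "emb 0 0 (gen \<epsilon> \<sigma>) = ePi \<sigma> * (p \<sigma> + (1 / \<epsilon>) *\<^sub>R q \<sigma>) * eL \<sigma>"
    unfolding g eX[symmetric] eL_def by (rule emb_mult_carrier[OF X carriers(2)])
qed

text \<open>Multiplying the blocks on the right by \<open>e - Q\<close> cancels \<open>C\<close>
  because \<open>D Q = C\<close> and turns \<open>A\<close> into \<open>M = A - B Q\<close>.
  Multiplying by \<open>e + Q\<close> on the left then adds \<open>Q M\<close> and
  \<open>Q B\<close> to the fast row, while \<open>Q D = 0\<close> keeps the singular term in its
  corner.\<close>

lemma eT_gen:
  assumes "0 < \<epsilon>"
  shows "eT \<sigma> * emb 0 0 (gen \<epsilon> \<sigma>) = sing_gen \<epsilon> * eT \<sigma>"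
proof -
  have z: "p \<sigma> * eC \<sigma> = 0" "p \<sigma> * eD \<sigma> = 0" "q \<sigma> * eA \<sigma> = 0" "q \<sigma> * eB \<sigma> = 0"
    "eA \<sigma> * eQ \<sigma> = 0" "eC \<sigma> * eQ \<sigma> = 0" "eQ \<sigma> * eD \<sigma> = 0"
  proof -
    have "p \<sigma> * (q \<sigma> * eC \<sigma>) = 0" "p \<sigma> * (q \<sigma> * eD \<sigma>) = 0" "q \<sigma> * (p \<sigma> * eA \<sigma>) = 0" "q \<sigma> * (p \<sigma> * eB \<sigma>) = 0"
      by (simp_all add: mult.assoc[symmetric] pq)
    then show "p \<sigma> * eC \<sigma> = 0" "p \<sigma> * eD \<sigma> = 0" "q \<sigma> * eA \<sigma> = 0" "q \<sigma> * eB \<sigma> = 0"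
      by (simp_all add: corners)
    have "(eA \<sigma> * p \<sigma>) * eQ \<sigma> = 0" "(eC \<sigma> * p \<sigma>) * eQ \<sigma> = 0" "eQ \<sigma> * (q \<sigma> * eD \<sigma>) = 0"
      by (simp_all add: mult.assoc corners_Q) (simp add: mult.assoc[symmetric] corners_Q)
    then show "eA \<sigma> * eQ \<sigma> = 0" "eC \<sigma> * eQ \<sigma> = 0" "eQ \<sigma> * eD \<sigma> = 0"
      by (simp_all add: corners)
  qed
  have "eA \<sigma> * p \<sigma> * q \<sigma> = 0" "eB \<sigma> * q \<sigma> * p \<sigma> = 0" "eC \<sigma> * p \<sigma> * q \<sigma> = 0" "eD \<sigma> * q \<sigma> * p \<sigma> = 0"
    "q \<sigma> * (p \<sigma> * eM \<sigma>) = 0"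
    by (simp_all add: mult.assoc pq) (simp add: mult.assoc[symmetric] pq)
  then have ee: "eA \<sigma> * e = eA \<sigma>" "eB \<sigma> * e = eB \<sigma>" "eC \<sigma> * e = eC \<sigma>" "eD \<sigma> * e = eD \<sigma>" "q \<sigma> * eM \<sigma> = 0"
    by (simp_all add: e_split distrib_left corners eM_corners)
  have "eT \<sigma> * emb 0 0 (gen \<epsilon> \<sigma>) = (e + eQ \<sigma>) * (eP \<sigma> * ePi \<sigma>) * (p \<sigma> + (1 / \<epsilon>) *\<^sub>R q \<sigma>) * (eL \<sigma> * e)"
    unfolding gen_carrier_emb(2)[OF assms] eT_eq by (simp add: mult.assoc e_mult)
  also have "eL \<sigma> * e = eL \<sigma> * ePi \<sigma> * (e - eQ \<sigma>) * eT \<sigma>"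
  proof -
    have "eL \<sigma> * e = eL \<sigma> * ((ePi \<sigma> * (e - eQ \<sigma>)) * eT \<sigma>)" by (simp only: eT_inverse_formula)
    then show ?thesis by (simp only: mult.assoc)
  qed
  also have "(e + eQ \<sigma>) * (eP \<sigma> * ePi \<sigma>) * (p \<sigma> + (1 / \<epsilon>) *\<^sub>R q \<sigma>) * (eL \<sigma> * ePi \<sigma> * (e - eQ \<sigma>) * eT \<sigma>) =
     ((e + eQ \<sigma>) * e) * ((p \<sigma> + (1 / \<epsilon>) *\<^sub>R q \<sigma>) * (eA \<sigma> + eB \<sigma> + eC \<sigma> + eD \<sigma>) * (e - eQ \<sigma>)) * eT \<sigma>"
    unfolding eL_ePi inverses by (simp only: mult.assoc)
  also have "(p \<sigma> + (1 / \<epsilon>) *\<^sub>R q \<sigma>) * (eA \<sigma> + eB \<sigma> + eC \<sigma> + eD \<sigma>) = eA \<sigma> + eB \<sigma> + (1 / \<epsilon>) *\<^sub>R (eC \<sigma> + eD \<sigma>)"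
    by (simp add: algebra_simps z corners)
  also have "\<dots> * (e - eQ \<sigma>) = eM \<sigma> + eB \<sigma> + (1 / \<epsilon>) *\<^sub>R eD \<sigma>"
    by (simp add: algebra_simps z ee corners_Q eM_eq)
  also have "(e + eQ \<sigma>) * e = e + eQ \<sigma>" by (simp add: distrib_right pj_idem corners_Q)
  also have "(e + eQ \<sigma>) * (eM \<sigma> + eB \<sigma> + (1 / \<epsilon>) *\<^sub>R eD \<sigma>) = sing_gen \<epsilon>"
    unfolding sing_gen_def by (simp add: e_split algebra_simps z corners eM_corners ee)
  finally show ?thesis .
qed

end

section \<open>Continuity in the mode and constants uniform over the compact set\<close>

lemma emb_mat_fun:
  assumes "A \<in> carrier_mat d d"
  shows "emb 0 0 A = (\<Sum>i<d. \<Sum>j<d. mat_fun A (i, j) *\<^sub>R munit i j)"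
  unfolding emb_def mat_fun_def using assms by simp

lemma tendsto_mode_embed: "(mode_embed \<longlongrightarrow> mode_embed \<sigma>) (mode_nhds K \<sigma>)"
  unfolding mode_nhds_def
  by (rule filterlim_mono[OF filterlim_filtercomap order_refl inf_le1])

context
  fixes \<sigma>0 assumes \<sigma>0: "\<sigma>0 \<in> K"
begin

text \<open>The first component of \<open>mode_embed\<close> lies in a discrete space, so the slow
  dimension and with it both projections are locally constant.\<close>

lemma eventually_ml: "eventually (\<lambda>\<sigma>. ml \<sigma> = ml \<sigma>0 \<and> \<sigma> \<in> K) (mode_nhds K \<sigma>0)"
proof -
  have "((\<lambda>\<sigma>. fst (mode_embed \<sigma>)) \<longlongrightarrow> fst (mode_embed \<sigma>0)) (mode_nhds K \<sigma>0)"
    by (rule tendsto_fst[OF tendsto_mode_embed])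
  from topological_tendstoD[OF this open_discrete, of "{ml \<sigma>0}"]
  show ?thesis
    using eventually_mode_nhds_in[of K \<sigma>0] by (auto simp: mode_embed_def elim: eventually_elim2)
qed

lemma tendsto_emb_component:
  assumes c: "continuous_on UNIV h" and h: "\<And>\<sigma>. h (mode_embed \<sigma>) = mat_fun (f \<sigma>)"
    and f: "\<And>\<sigma>. \<sigma> \<in> K \<Longrightarrow> f \<sigma> \<in> carrier_mat d d"
  shows "((\<lambda>\<sigma>. emb 0 0 (f \<sigma>)) \<longlongrightarrow> emb 0 0 (f \<sigma>0)) (mode_nhds K \<sigma>0)"
proof -
  have comp: "((\<lambda>\<sigma>. mat_fun (f \<sigma>) x) \<longlongrightarrow> mat_fun (f \<sigma>0) x) (mode_nhds K \<sigma>0)" for x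
  proof -
    have "continuous_on UNIV (\<lambda>y. h y x)"
      by (rule continuous_on_product_then_coordinatewise[OF c])
    from continuous_on_tendsto_compose[OF this tendsto_mode_embed] show ?thesis by (simp add: h)
  qed
  have "((\<lambda>\<sigma>. \<Sum>i<d. \<Sum>j<d. mat_fun (f \<sigma>) (i, j) *\<^sub>R munit i j) \<longlongrightarrow>
      (\<Sum>i<d. \<Sum>j<d. mat_fun (f \<sigma>0) (i, j) *\<^sub>R munit i j)) (mode_nhds K \<sigma>0)"
    by (intro tendsto_intros comp)
  moreover have "eventually (\<lambda>\<sigma>. (\<Sum>i<d. \<Sum>j<d. mat_fun (f \<sigma>) (i, j) *\<^sub>R munit i j) = emb 0 0 (f \<sigma>)) (mode_nhds K \<sigma>0)"
    using eventually_mode_nhds_in[of K \<sigma>0] by eventually_elim (simp add: emb_mat_fun f)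
  ultimately show ?thesis
    unfolding emb_mat_fun[OF f[OF \<sigma>0], symmetric] by (rule Lim_transform_eventually)
qed

lemma tendsto_data:
  "(eP \<longlongrightarrow> eP \<sigma>0) (mode_nhds K \<sigma>0)" "(eL \<longlongrightarrow> eL \<sigma>0) (mode_nhds K \<sigma>0)" "(eR \<longlongrightarrow> eR \<sigma>0) (mode_nhds K \<sigma>0)"
proof -
  have "continuous_on UNIV (\<lambda>x :: nat \<times> (nat \<times> nat \<Rightarrow> real) \<times> (nat \<times> nat \<Rightarrow> real) \<times> (nat \<times> nat \<Rightarrow> real). fst (snd x))"
    "continuous_on UNIV (\<lambda>x :: nat \<times> (nat \<times> nat \<Rightarrow> real) \<times> (nat \<times> nat \<Rightarrow> real) \<times> (nat \<times> nat \<Rightarrow> real). fst (snd (snd x)))"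
    "continuous_on UNIV (\<lambda>x :: nat \<times> (nat \<times> nat \<Rightarrow> real) \<times> (nat \<times> nat \<Rightarrow> real) \<times> (nat \<times> nat \<Rightarrow> real). snd (snd (snd x)))"
    by (intro continuous_on_fst continuous_on_snd continuous_on_id)+
  note this[THEN tendsto_emb_component]
  from this(1)[of mP] this(2)[of mLam] this(3)[of mR]
  show "(eP \<longlongrightarrow> eP \<sigma>0) (mode_nhds K \<sigma>0)" "(eL \<longlongrightarrow> eL \<sigma>0) (mode_nhds K \<sigma>0)" "(eR \<longlongrightarrow> eR \<sigma>0) (mode_nhds K \<sigma>0)"
    unfolding eP_def[abs_def] eL_def[abs_def] eR_def[abs_def] by (simp_all add: mode_embed_def carriers)
qed

lemma tendsto_pq:
  "((\<lambda>\<sigma>. p \<sigma>) \<longlongrightarrow> p \<sigma>0) (mode_nhds K \<sigma>0)" "((\<lambda>\<sigma>. q \<sigma>) \<longlongrightarrow> q \<sigma>0) (mode_nhds K \<sigma>0)"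
  by (rule tendsto_eventually, use eventually_ml in eventually_elim, simp)+

lemma tendsto_ePi: "(ePi \<longlongrightarrow> ePi \<sigma>0) (mode_nhds K \<sigma>0)"
proof (rule tendsto_corner_inverse[OF tendsto_data(1)])
  show "\<forall>\<^sub>F \<sigma> in mode_nhds K \<sigma>0. ePi \<sigma> * eP \<sigma> = e \<and> ePi \<sigma> * e = ePi \<sigma>"
    using eventually_mode_nhds_in[of K \<sigma>0] by eventually_elim (simp add: inverses e_mult)
qed (simp_all add: \<sigma>0 inverses e_mult)

text \<open>Written as corners of one product, the blocks inherit continuity from the data and from
  the locally constant projections.\<close>

lemma block_formulas:
  assumes "\<sigma> \<in> K"
  shows "eB \<sigma> = p \<sigma> * (eL \<sigma> * ePi \<sigma>) * q \<sigma>" "eC \<sigma> = q \<sigma> * (eL \<sigma> * ePi \<sigma>) * p \<sigma>"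
    "eD \<sigma> = q \<sigma> * (eL \<sigma> * ePi \<sigma>) * q \<sigma>" "eA \<sigma> = p \<sigma> * (eL \<sigma> * ePi \<sigma>) * p \<sigma>"
proof -
  note cs = corners[OF assms] and pq = pq[OF assms]
  have "p \<sigma> * (q \<sigma> * eC \<sigma>) = 0" "p \<sigma> * (q \<sigma> * eD \<sigma>) = 0" "q \<sigma> * (p \<sigma> * eA \<sigma>) = 0" "q \<sigma> * (p \<sigma> * eB \<sigma>) = 0"
    by (simp_all only: mult.assoc[symmetric] pq mult_zero_left)
  then have z1: "p \<sigma> * eC \<sigma> = 0" "p \<sigma> * eD \<sigma> = 0" "q \<sigma> * eA \<sigma> = 0" "q \<sigma> * eB \<sigma> = 0"
    by (simp_all add: cs)
  have "eA \<sigma> * p \<sigma> * q \<sigma> = 0" "eB \<sigma> * q \<sigma> * p \<sigma> = 0" "eC \<sigma> * p \<sigma> * q \<sigma> = 0" "eD \<sigma> * q \<sigma> * p \<sigma> = 0"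
    by (simp_all only: mult.assoc pq mult_zero_right)
  then have z2: "eA \<sigma> * q \<sigma> = 0" "eB \<sigma> * p \<sigma> = 0" "eC \<sigma> * q \<sigma> = 0" "eD \<sigma> * p \<sigma> = 0"
    by (simp_all add: cs)
  show "eB \<sigma> = p \<sigma> * (eL \<sigma> * ePi \<sigma>) * q \<sigma>" "eC \<sigma> = q \<sigma> * (eL \<sigma> * ePi \<sigma>) * p \<sigma>"
    "eD \<sigma> = q \<sigma> * (eL \<sigma> * ePi \<sigma>) * q \<sigma>" "eA \<sigma> = p \<sigma> * (eL \<sigma> * ePi \<sigma>) * p \<sigma>"
    unfolding eL_ePi[OF assms] by (simp_all add: distrib_left distrib_right z1 z2 cs)
qed

lemma tendsto_blocks:
  "(eA \<longlongrightarrow> eA \<sigma>0) (mode_nhds K \<sigma>0)" "(eB \<longlongrightarrow> eB \<sigma>0) (mode_nhds K \<sigma>0)"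
  "(eC \<longlongrightarrow> eC \<sigma>0) (mode_nhds K \<sigma>0)" "(eD \<longlongrightarrow> eD \<sigma>0) (mode_nhds K \<sigma>0)"
proof -
  have cong: "(f \<longlongrightarrow> f \<sigma>0) (mode_nhds K \<sigma>0)" if "(g \<longlongrightarrow> g \<sigma>0) (mode_nhds K \<sigma>0)" "\<And>\<sigma>. \<sigma> \<in> K \<Longrightarrow> f \<sigma> = g \<sigma>"
    for f g :: "mode \<Rightarrow> bop"
  proof -
    have "eventually (\<lambda>\<sigma>. g \<sigma> = f \<sigma>) (mode_nhds K \<sigma>0)"
      using eventually_mode_nhds_in[of K \<sigma>0] by eventually_elim (simp add: that)
    then show ?thesis using that(1) by (simp add: that(2)[OF \<sigma>0] Lim_transform_eventually)
  qed
  note intros = tendsto_intros tendsto_pq tendsto_data tendsto_ePi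
  show "(eA \<longlongrightarrow> eA \<sigma>0) (mode_nhds K \<sigma>0)"
    by (rule cong[OF _ block_formulas(4)]) (intro intros)
  show "(eB \<longlongrightarrow> eB \<sigma>0) (mode_nhds K \<sigma>0)"
    by (rule cong[OF _ block_formulas(1)]) (intro intros)
  show "(eC \<longlongrightarrow> eC \<sigma>0) (mode_nhds K \<sigma>0)"
    by (rule cong[OF _ block_formulas(2)]) (intro intros)
  show "(eD \<longlongrightarrow> eD \<sigma>0) (mode_nhds K \<sigma>0)"
    by (rule cong[OF _ block_formulas(3)]) (intro intros)
qed

lemma tendsto_eDi: "(eDi \<longlongrightarrow> eDi \<sigma>0) (mode_nhds K \<sigma>0)"
proof (rule tendsto_corner_inverse[OF tendsto_blocks(4)])
  show "\<forall>\<^sub>F \<sigma> in mode_nhds K \<sigma>0. eDi \<sigma> * eD \<sigma> = q \<sigma>0 \<and> eDi \<sigma> * q \<sigma>0 = eDi \<sigma>"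
    using eventually_ml
  proof eventually_elim
    case (elim \<sigma>)
    then have "q \<sigma>0 = q \<sigma>" "\<sigma> \<in> K" by simp_all
    then show ?case using inverses(4)[of \<sigma>] corners(10)[of \<sigma>] by simp
  qed
qed (simp_all only: \<sigma>0 inverses corners)

lemma tendsto_eQ: "(eQ \<longlongrightarrow> eQ \<sigma>0) (mode_nhds K \<sigma>0)"
  unfolding eQ_def[abs_def] by (intro tendsto_intros tendsto_eDi tendsto_blocks)

end

lemma bounded_on_modes:
  fixes f g :: "mode \<Rightarrow> bop"
  assumes "\<And>\<sigma>0. \<sigma>0 \<in> K \<Longrightarrow> (g \<longlongrightarrow> g \<sigma>0) (mode_nhds K \<sigma>0)" "\<And>\<sigma>. \<sigma> \<in> K \<Longrightarrow> f \<sigma> = g \<sigma>"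
  shows "\<exists>C. \<forall>\<sigma>\<in>K. norm (f \<sigma>) \<le> C"
proof -
  obtain C where "\<And>\<sigma>. \<sigma> \<in> K \<Longrightarrow> norm (g \<sigma>) \<le> C"
    by (rule compact_modes_uniform[OF K_compact, of "\<lambda>C \<sigma>. norm (g \<sigma>) \<le> C"])
      (use tendsto_locally_bounded[OF assms(1)] in auto)
  then have "\<forall>\<sigma>\<in>K. norm (f \<sigma>) \<le> C" by (simp add: assms(2))
  then show ?thesis by blast
qed

lemma uniform_fast_decay:
  obtains c C1 where "0 < c" "1 \<le> C1"
    "\<And>\<sigma> s. \<sigma> \<in> K \<Longrightarrow> 0 \<le> s \<Longrightarrow> norm (exp (s *\<^sub>R eD \<sigma>) * q \<sigma>) \<le> C1 * exp (- c * s)"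
proof -
  \<comment> \<open>One number \<open>C\<close> encodes both the prefactor and the rate
    \<open>1 / C\<close>. The property is then monotone in \<open>C\<close>, as
    \<open>compact_modes_uniform\<close> requires.\<close>
  let ?Q = "\<lambda>C \<sigma>. 1 \<le> C \<and> (\<forall>s\<ge>0. norm (exp (s *\<^sub>R eD \<sigma>) * q \<sigma>) \<le> C * exp (- (1 / C) * s))"
  have weaken: "x \<le> C' * exp (- (1 / C') * s)"
    if "x \<le> C * exp (- c * s)" "0 \<le> C" "C \<le> C'" "1 / C' \<le> c" "0 \<le> s" for x C C' c s :: real
  proof -
    have "C * exp (- c * s) \<le> C' * exp (- (1 / C') * s)"
      using that mult_right_mono[of "1 / C'" c s] by (intro mult_mono) auto
    with that show ?thesis by linarith
  qed
  have loc: "\<exists>C. eventually (?Q C) (mode_nhds K \<sigma>0)" if \<sigma>0: "\<sigma>0 \<in> K" for \<sigma>0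
  proof -
    have n: "0 < d - ml \<sigma>0" using ml_bounds[OF \<sigma>0] by simp
    from hurwitz_exp_decay[OF block_facts(4)[OF \<sigma>0] n D_hurwitz[OF \<sigma>0], of "ml \<sigma>0"]
    obtain c L where c: "0 < c" "1 \<le> L" and
      dec: "\<And>s. 0 \<le> s \<Longrightarrow> norm (exp (s *\<^sub>R eD \<sigma>0) * q \<sigma>0) \<le> L * exp (- c * s)"
      unfolding eD_def by metis
    define C where "C = max (max 1 (2 * L * norm (q \<sigma>0))) (2 / c)"
    have "((\<lambda>\<sigma>. norm (eD \<sigma> - eD \<sigma>0)) \<longlongrightarrow> norm (eD \<sigma>0 - eD \<sigma>0)) (mode_nhds K \<sigma>0)"
      by (intro tendsto_intros tendsto_blocks \<sigma>0)
    then have "eventually (\<lambda>\<sigma>. norm (eD \<sigma> - eD \<sigma>0) < c / (4 * L)) (mode_nhds K \<sigma>0)"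
      by (rule order_tendstoD) (use c in simp)
    then have "eventually (?Q C) (mode_nhds K \<sigma>0)"
      using eventually_ml[OF \<sigma>0]
    proof eventually_elim
      case (elim \<sigma>)
      then have qeq: "q \<sigma> = q \<sigma>0" and \<sigma>: "\<sigma> \<in> K" by auto
      have dec': "norm (exp (s *\<^sub>R eD \<sigma>) * q \<sigma>0) \<le> 2 * L * norm (q \<sigma>0) * exp (- (c / 2) * s)" if "0 \<le> s" for s
        by (rule exp_decay_perturb[OF dec c(2,1)])
          (use that elim corners(3)[OF \<sigma>] corners(3)[OF \<sigma>0] pq(2)[OF \<sigma>0] qeq in auto)
      have "1 / C \<le> 1 / (2 / c)" unfolding C_def using c by (intro divide_left_mono) auto
      then have "1 / C \<le> c / 2" by simp
      then have "norm (exp (s *\<^sub>R eD \<sigma>) * q \<sigma>) \<le> C * exp (- (1 / C) * s)" if "0 \<le> s" for s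
        unfolding qeq using c by (intro weaken[OF dec'[OF that] _ _ _ that]) (auto simp: C_def)
      then show ?case by (simp add: C_def)
    qed
    then show "\<exists>C. eventually (?Q C) (mode_nhds K \<sigma>0)" by blast
  qed
  have mono: "?Q C' \<sigma>" if le: "C \<le> C'" and Q: "?Q C \<sigma>" for C C' \<sigma>
  proof -
    have "1 / C' \<le> 1 / C" using le Q by (intro divide_left_mono) auto
    then show "?Q C' \<sigma>" using le Q weaken[of _ C "1 / C" _ C'] by auto
  qed
  obtain C where C: "\<And>\<sigma>. \<sigma> \<in> K \<Longrightarrow> ?Q C \<sigma>" "1 \<le> C"
    by (rule compact_modes_uniform[of K ?Q, OF K_compact loc mono]) blast+
  show thesis
  proof (rule that[of "1 / C" C])
    show "0 < 1 / C" using C(2) by simp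
  qed (use C in auto)
qed

lemma uniform_bound:
  obtains b where "1 \<le> b"
    "\<And>\<sigma>. \<sigma> \<in> K \<Longrightarrow> norm (p \<sigma>) \<le> b" "\<And>\<sigma>. \<sigma> \<in> K \<Longrightarrow> norm (q \<sigma>) \<le> b"
    "\<And>\<sigma>. \<sigma> \<in> K \<Longrightarrow> norm (eB \<sigma>) \<le> b" "\<And>\<sigma>. \<sigma> \<in> K \<Longrightarrow> norm (eQ \<sigma> * eM \<sigma>) \<le> b"
    "\<And>\<sigma>. \<sigma> \<in> K \<Longrightarrow> norm (eQ \<sigma> * eB \<sigma>) \<le> b" "\<And>\<sigma>. \<sigma> \<in> K \<Longrightarrow> norm (eM \<sigma>) \<le> b"
    "\<And>\<sigma>. \<sigma> \<in> K \<Longrightarrow> norm (eD \<sigma>) \<le> b" "\<And>\<sigma>. \<sigma> \<in> K \<Longrightarrow> norm (eT \<sigma>) \<le> b"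
    "\<And>\<sigma>. \<sigma> \<in> K \<Longrightarrow> norm (eTi \<sigma>) \<le> b" "\<And>\<sigma>. \<sigma> \<in> K \<Longrightarrow> norm (eR \<sigma>) \<le> b"
proof -
  note intros = tendsto_intros tendsto_pq tendsto_data tendsto_ePi tendsto_blocks tendsto_eQ
  obtain b1 where b1: "\<forall>\<sigma>\<in>K. norm (p \<sigma>) \<le> b1"
    using bounded_on_modes[of "\<lambda>\<sigma>. p \<sigma>" "\<lambda>\<sigma>. p \<sigma>"] tendsto_pq by blast
  obtain b2 where b2: "\<forall>\<sigma>\<in>K. norm (q \<sigma>) \<le> b2"
    using bounded_on_modes[of "\<lambda>\<sigma>. q \<sigma>" "\<lambda>\<sigma>. q \<sigma>"] tendsto_pq by blast
  obtain b3 where b3: "\<forall>\<sigma>\<in>K. norm (eB \<sigma>) \<le> b3"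
    using bounded_on_modes[OF tendsto_blocks(2)] by blast
  have "\<exists>C. \<forall>\<sigma>\<in>K. norm (eQ \<sigma> * eM \<sigma>) \<le> C"
    by (rule bounded_on_modes[where g="\<lambda>\<sigma>. eQ \<sigma> * (eA \<sigma> - eB \<sigma> * eQ \<sigma>)"]) (intro intros, simp_all add: eM_eq)
  then obtain b4 where b4: "\<forall>\<sigma>\<in>K. norm (eQ \<sigma> * eM \<sigma>) \<le> b4" by blast
  have "\<exists>C. \<forall>\<sigma>\<in>K. norm (eQ \<sigma> * eB \<sigma>) \<le> C"
    by (rule bounded_on_modes[where g="\<lambda>\<sigma>. eQ \<sigma> * eB \<sigma>"]) (intro intros, simp_all)
  then obtain b5 where b5: "\<forall>\<sigma>\<in>K. norm (eQ \<sigma> * eB \<sigma>) \<le> b5" by blast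
  have "\<exists>C. \<forall>\<sigma>\<in>K. norm (eM \<sigma>) \<le> C"
    by (rule bounded_on_modes[where g="\<lambda>\<sigma>. eA \<sigma> - eB \<sigma> * eQ \<sigma>"]) (intro intros, simp_all add: eM_eq)
  then obtain b6 where b6: "\<forall>\<sigma>\<in>K. norm (eM \<sigma>) \<le> b6" by blast
  obtain b7 where b7: "\<forall>\<sigma>\<in>K. norm (eD \<sigma>) \<le> b7"
    using bounded_on_modes[OF tendsto_blocks(4)] by blast
  have "\<exists>C. \<forall>\<sigma>\<in>K. norm (eT \<sigma>) \<le> C"
    by (rule bounded_on_modes[where g="\<lambda>\<sigma>. (e + eQ \<sigma>) * eP \<sigma>"]) (intro intros, simp_all add: eT_eq)
  then obtain b8 where b8: "\<forall>\<sigma>\<in>K. norm (eT \<sigma>) \<le> b8" by blast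
  have "\<exists>C. \<forall>\<sigma>\<in>K. norm (eTi \<sigma>) \<le> C"
    by (rule bounded_on_modes[where g="\<lambda>\<sigma>. ePi \<sigma> * (e - eQ \<sigma>)"]) (intro intros, simp_all add: minv_Tm)
  then obtain b9 where b9: "\<forall>\<sigma>\<in>K. norm (eTi \<sigma>) \<le> b9" by blast
  obtain b10 where b10: "\<forall>\<sigma>\<in>K. norm (eR \<sigma>) \<le> b10"
    using bounded_on_modes[OF tendsto_data(3)] by blast
  define b where "b = Max {1, b1, b2, b3, b4, b5, b6, b7, b8, b9, b10}"
  have le: "1 \<le> b" "b1 \<le> b" "b2 \<le> b" "b3 \<le> b" "b4 \<le> b" "b5 \<le> b" "b6 \<le> b" "b7 \<le> b" "b8 \<le> b" "b9 \<le> b" "b10 \<le> b"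
    unfolding b_def by (rule Max_ge; simp)+
  show thesis
  proof (rule that[OF le(1)])
  qed (use le b1 b2 b3 b4 b5 b6 b7 b8 b9 b10 in \<open>meson order_trans\<close>)+
qed

lemma eM_eB_corners:
  assumes "\<sigma> \<in> K"
  shows "q \<sigma> * (eQ \<sigma> * x) = eQ \<sigma> * x" "eQ \<sigma> * eM \<sigma> * p \<sigma> = eQ \<sigma> * eM \<sigma>" "eQ \<sigma> * eB \<sigma> * q \<sigma> = eQ \<sigma> * eB \<sigma>"
  by (simp_all only: mult.assoc[symmetric] corners_Q[OF assms])
    (simp_all only: mult.assoc corners[OF assms] eM_corners[OF assms])

end

section \<open>Signals and flows\<close>

lemma signal_strict_mono:
  assumes sg: "signal Z \<tau> m t z" and "i < j" "enat j \<le> m"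
  shows "t i < t j"
  using assms(2,3)
proof (induction j)
  case (Suc j)
  have le: "enat j \<le> m" using Suc.prems(2) by (meson enat_ord_simps(1) le_SucI order_refl order_trans)
  have "t j < t (Suc j)" using sg Suc.prems(2) unfolding signal_def by blast
  with Suc.IH[OF _ le] Suc.prems(1) show ?case by (cases "i = j") auto
qed simp

lemma signal_mono:
  assumes "signal Z \<tau> m t z" "i \<le> j" "enat j \<le> m"
  shows "t i \<le> t j"
  using signal_strict_mono[OF assms(1), of i j] assms(2,3) by (cases "i = j") auto

text \<open>If every index had a successor switch before \<open>s\<close>, there would be infinitely
  many switches up to time \<open>s\<close>, against the divergence of \<open>t\<close>. Strict
  monotonicity of the switching times gives uniqueness, which the description in \<open>sidx\<close>
  relies on.\<close>

lemma signal_index: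
  assumes sg: "signal Z \<tau> m t z" and s: "0 \<le> s"
  obtains k where "enat k \<le> m" "t k \<le> s" "sidx m t s = k"
proof -
  define P where "P k \<longleftrightarrow> enat k \<le> m \<and> t k \<le> s \<and> (enat (Suc k) \<le> m \<longrightarrow> s < t (Suc k))" for k
  have "\<exists>k. P k"
  proof (rule ccontr)
    assume no: "\<not> (\<exists>k. P k)"
    have all: "enat k \<le> m \<and> t k \<le> s" for k
    proof (induction k)
      case 0
      then show ?case using sg s by (simp add: signal_def zero_enat_def[symmetric])
    next
      case (Suc k)
      with no show ?case unfolding P_def by (meson not_le)
    qed
    have "m = \<infinity>"
    proof (cases m)
      case (enat n)
      with all[of "Suc n"] show ?thesis by simp
    qed simp
    then have "filterlim t at_top sequentially" using sg by (simp add: signal_def)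
    then have "eventually (\<lambda>k. s < t k) sequentially" by (simp add: filterlim_at_top_dense)
    then obtain k where "s < t k" by (auto simp: eventually_sequentially)
    with all[of k] show False by simp
  qed
  then obtain k where k: "P k" ..
  have "k' = k" if "P k'" for k'
  proof (rule ccontr)
    have less: False if "i < j" "P i" "P j" for i j
    proof -
      have "enat (Suc i) \<le> m" using that unfolding P_def by (meson Suc_leI enat_ord_simps(1) order_trans)
      then have "s < t (Suc i)" "t (Suc i) \<le> t j"
        using that signal_mono[OF sg, of "Suc i" j] unfolding P_def by auto
      with that show False unfolding P_def by auto
    qed
    assume "k' \<noteq> k"
    with less[of k k'] less[of k' k] k that show False by (meson linorder_neqE_nat)
  qed
  with k have "sidx m t s = k"
    unfolding sidx_def P_def[symmetric] by (intro the_equality)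
  with k show thesis using that unfolding P_def by blast
qed

lemma sidx_last:
  assumes sg: "signal Z \<tau> (enat n) t z" and s: "t n \<le> s"
  shows "sidx (enat n) t s = n"
  unfolding sidx_def
proof (rule the_equality)
  show "enat n \<le> enat n \<and> t n \<le> s \<and> (enat (Suc n) \<le> enat n \<longrightarrow> s < t (Suc n))" using s by simp
  fix k assume k: "enat k \<le> enat n \<and> t k \<le> s \<and> (enat (Suc k) \<le> enat n \<longrightarrow> s < t (Suc k))"
  show "k = n"
  proof (rule ccontr)
    assume "k \<noteq> n"
    with k have "Suc k \<le> n" by simp
    with k signal_mono[OF sg, of "Suc k" n] s show False by auto
  qed
qed

text \<open>Blocks of a product that start at a later index are again products along an admissible
  signal, so bounds for whole flows apply to them.\<close>

lemma signal_segment: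
  assumes sg: "signal Z \<tau> m t z" and "enat (j + n) \<le> m"
  shows "signal Z \<tau> (enat n) (\<lambda>i. t (j + i) - t j) (\<lambda>i. z (j + i))"
proof -
  have le: "enat (j + i) \<le> m" if "i \<le> n" for i
    using assms(2) that by (meson add_left_mono enat_ord_simps(1) order_trans)
  have "t (j + i) < t (j + Suc i) \<and> \<tau> \<le> t (j + Suc i) - t (j + i) \<and> z (j + Suc i) \<noteq> z (j + i)" if "Suc i \<le> n" for i
    using sg le[OF that] unfolding signal_def by (metis add_Suc_right)
  then show ?thesis
    using sg le unfolding signal_def by auto
qed

lemma signal_mode_in:
  "signal Z \<tau> m t z \<Longrightarrow> enat k \<le> m \<Longrightarrow> z k \<in> Z"
  unfolding signal_def by blast

text \<open>The sizes \<open>n i\<close> may change at every jump, as they do in the bar system; in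
  \<open>bop\<close> the rectangular factors become an ordinary product.\<close>

lemma psi_emb:
  assumes A: "\<And>i. i \<le> k \<Longrightarrow> A i \<in> carrier_mat (n i) (n i)"
    and J: "\<And>i. i < k \<Longrightarrow> J i \<in> carrier_mat (n (Suc i)) (n i)"
  shows "psi t A J k \<in> carrier_mat (n k) (n 0) \<and> emb 0 0 (psi t A J k) =
    oprod (\<lambda>i. emb 0 0 (J i) * (exp ((t (Suc i) - t i) *\<^sub>R emb 0 0 (A i)) * pj 0 (n i))) 0 k * pj 0 (n 0)"
  using assms
proof (induction k)
  case 0
  then show ?case by (simp add: pj_def)
next
  case (Suc k)
  let ?s = "t (Suc k) - t k"
  have IH: "psi t A J k \<in> carrier_mat (n k) (n 0)" "emb 0 0 (psi t A J k) =
    oprod (\<lambda>i. emb 0 0 (J i) * (exp ((t (Suc i) - t i) *\<^sub>R emb 0 0 (A i)) * pj 0 (n i))) 0 k * pj 0 (n 0)"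
    using Suc by auto
  have sA: "?s \<cdot>\<^sub>m A k \<in> carrier_mat (n k) (n k)" using Suc.prems(1)[of k] by simp
  have c: "mexp (?s \<cdot>\<^sub>m A k) \<in> carrier_mat (n k) (n k)" by (rule mexp_carrier[OF sA])
  have Jk: "J k \<in> carrier_mat (n (Suc k)) (n k)" using Suc.prems(2) by simp
  have Jc: "J k * mexp (?s \<cdot>\<^sub>m A k) \<in> carrier_mat (n (Suc k)) (n k)" by (rule mult_carrier_mat[OF Jk c])
  have "emb 0 0 (psi t A J (Suc k)) = emb 0 0 (J k) * emb 0 0 (mexp (?s \<cdot>\<^sub>m A k)) * emb 0 0 (psi t A J k)"
    by (simp add: emb_mult_carrier[OF Jc IH(1), of 0 0 0] emb_mult_carrier[OF Jk c, of 0 0 0])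
  also have "emb 0 0 (mexp (?s \<cdot>\<^sub>m A k)) = exp (?s *\<^sub>R emb 0 0 (A k)) * pj 0 (n k)"
    by (simp add: emb_mexp[OF sA] emb_smult)
  finally show ?case
    using mult_carrier_mat[OF Jc IH(1)] by (simp add: IH(2) mult.assoc)
qed

lemma flow_emb:
  assumes A: "\<And>i. i \<le> k \<Longrightarrow> A i \<in> carrier_mat (n i) (n i)"
    and J: "\<And>i. i < k \<Longrightarrow> J i \<in> carrier_mat (n (Suc i)) (n i)"
    and idx: "sidx m t s = k"
  shows "flow (m, t, A, J) s \<in> carrier_mat (n k) (n 0)"
    and "emb 0 0 (flow (m, t, A, J) s) = exp ((s - t k) *\<^sub>R emb 0 0 (A k)) * pj 0 (n k) *
    (oprod (\<lambda>i. emb 0 0 (J i) * (exp ((t (Suc i) - t i) *\<^sub>R emb 0 0 (A i)) * pj 0 (n i))) 0 k * pj 0 (n 0))"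
proof -
  have f: "flow (m, t, A, J) s = mexp ((s - t k) \<cdot>\<^sub>m A k) * psi t A J k"
    by (simp add: flow_def idx Let_def)
  have sA: "(s - t k) \<cdot>\<^sub>m A k \<in> carrier_mat (n k) (n k)" using A[of k] by simp
  have c: "mexp ((s - t k) \<cdot>\<^sub>m A k) \<in> carrier_mat (n k) (n k)" by (rule mexp_carrier[OF sA])
  note psi = psi_emb[of k A n J t, OF A J]
  show "flow (m, t, A, J) s \<in> carrier_mat (n k) (n 0)"
    unfolding f using c psi by (auto intro: mult_carrier_mat)
  show "emb 0 0 (flow (m, t, A, J) s) = exp ((s - t k) *\<^sub>R emb 0 0 (A k)) * pj 0 (n k) *
    (oprod (\<lambda>i. emb 0 0 (J i) * (exp ((t (Suc i) - t i) *\<^sub>R emb 0 0 (A i)) * pj 0 (n i))) 0 k * pj 0 (n 0))"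
    unfolding f using c psi by (subst emb_mult_carrier[where s=0]) (auto simp: emb_mexp[OF sA] emb_smult)
qed

lemma prod_exp_increments:
  "(\<Prod>i=j..<j+n. exp (a * (t (Suc i) - t i))) = exp (a * (t (j + n) - t j))" for t :: "nat \<Rightarrow> real"
  by (induction n) (simp_all add: exp_add[symmetric] algebra_simps)

section \<open>The systems in the slow-fast coordinates\<close>

context modes
begin

text \<open>The jump of the full state seen in slow-fast coordinates, from those of the mode left to
  those of the mode entered. The \<open>\<epsilon>\<close> system, the bar system and the hat system
  all use it, which makes their products comparable.\<close>

definition Jt :: "(nat \<Rightarrow> mode) \<Rightarrow> nat \<Rightarrow> bop" where
  "Jt z i = eT (z (Suc i)) * eR (z i) * eTi (z i)"

definition sing_flow :: "real \<Rightarrow> mode \<Rightarrow> real \<Rightarrow> bop" where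
  "sing_flow \<epsilon> \<sigma> x = exp (x *\<^sub>R sing_gen \<sigma> \<epsilon>) * e"

lemma exp_gen_conj:
  assumes \<sigma>: "\<sigma> \<in> K" and \<epsilon>: "0 < \<epsilon>"
  shows "exp (x *\<^sub>R emb 0 0 (gen \<epsilon> \<sigma>)) * e = eTi \<sigma> * sing_flow \<epsilon> \<sigma> x * eT \<sigma>"
proof -
  let ?g = "emb 0 0 (gen \<epsilon> \<sigma>)"
  have "e * ?g = ?g * e"
    using gen_carrier_emb(1)[OF \<sigma> \<epsilon>] by (auto simp: emb_one_left emb_one_right)
  then have "exp (x *\<^sub>R ?g) * e = e * exp (x *\<^sub>R ?g)"
    by (metis exp_intertwine_scaleR)
  also have "\<dots> = eTi \<sigma> * (eT \<sigma> * exp (x *\<^sub>R ?g))"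
    by (simp add: eT_inverses[OF \<sigma>] mult.assoc[symmetric])
  also have "eT \<sigma> * exp (x *\<^sub>R ?g) = exp (x *\<^sub>R sing_gen \<sigma> \<epsilon>) * (e * eT \<sigma>)"
    by (simp add: eT_inverses[OF \<sigma>] exp_intertwine_scaleR[OF eT_gen[OF \<sigma> \<epsilon>]])
  finally show ?thesis by (simp add: sing_flow_def mult.assoc)
qed

lemma eps_flow_emb:
  assumes sg: "signal K \<tau> m t z" and \<epsilon>: "0 < \<epsilon>" and s: "0 \<le> s"
  obtains k where "enat k \<le> m" "t k \<le> s"
    "flow (m, t, \<lambda>k. gen \<epsilon> (z k), \<lambda>k. mR (z k)) s \<in> carrier_mat d d"
    "emb 0 0 (flow (m, t, \<lambda>k. gen \<epsilon> (z k), \<lambda>k. mR (z k)) s) =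
     eTi (z k) * sing_flow \<epsilon> (z k) (s - t k) * oprod (\<lambda>i. Jt z i * sing_flow \<epsilon> (z i) (t (Suc i) - t i)) 0 k * eT (z 0)"
proof -
  obtain k where k: "enat k \<le> m" "t k \<le> s" "sidx m t s = k"
    using signal_index[OF sg s] by metis
  have zK: "z i \<in> K" if "i \<le> k" for i
    using signal_mode_in[OF sg] k(1) that by (meson enat_ord_simps(1) order_trans)
  have A: "gen \<epsilon> (z i) \<in> carrier_mat d d" if "i \<le> k" for i
    by (rule gen_carrier_emb(1)[OF zK[OF that] \<epsilon>])
  have J: "mR (z i) \<in> carrier_mat d d" if "i < k" for i
    using zK[of i] that carriers by simp
  let ?W = "\<lambda>i. Jt z i * sing_flow \<epsilon> (z i) (t (Suc i) - t i)"
  let ?V = "\<lambda>i. emb 0 0 (mR (z i)) * (exp ((t (Suc i) - t i) *\<^sub>R emb 0 0 (gen \<epsilon> (z i))) * e)"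
  \<comment> \<open>Each interval is conjugated by its own \<open>T\<close>; between two intervals
    the factors \<open>eT\<close> and \<open>eTi\<close> join \<open>eR\<close> to form
    \<open>Jt\<close>, so only the outermost ones remain.\<close>
  have tel: "eT (z j) * oprod ?V 0 j * e = oprod ?W 0 j * eT (z 0)" if "j \<le> k" for j
    using that
  proof (induction j)
    case 0
    then show ?case using zK[of 0] by (simp add: eT_inverses)
  next
    case (Suc j)
    have V: "?V j = eR (z j) * (eTi (z j) * sing_flow \<epsilon> (z j) (t (Suc j) - t j) * eT (z j))"
      using zK[of j] Suc.prems by (simp add: exp_gen_conj[OF _ \<epsilon>] eR_def)
    have "eT (z (Suc j)) * oprod ?V 0 (Suc j) * e = ?W j * (eT (z j) * oprod ?V 0 j * e)"
      unfolding oprod.simps add_0 V Jt_def by (simp only: mult.assoc)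
    then show ?case using Suc by (simp add: mult.assoc)
  qed
  have fl: "flow (m, t, \<lambda>k. gen \<epsilon> (z k), \<lambda>k. mR (z k)) s \<in> carrier_mat d d"
    by (rule flow_emb(1)[where n="\<lambda>_. d", OF A J k(3)])
  have "emb 0 0 (flow (m, t, \<lambda>k. gen \<epsilon> (z k), \<lambda>k. mR (z k)) s) = exp ((s - t k) *\<^sub>R emb 0 0 (gen \<epsilon> (z k))) * e * (oprod ?V 0 k * e)"
    by (rule flow_emb(2)[where n="\<lambda>_. d", OF A J k(3)])
  also have "\<dots> = eTi (z k) * sing_flow \<epsilon> (z k) (s - t k) * (eT (z k) * oprod ?V 0 k * e)"
    using zK[of k] by (simp add: exp_gen_conj[OF _ \<epsilon>] mult.assoc)
  also have "\<dots> = eTi (z k) * sing_flow \<epsilon> (z k) (s - t k) * oprod ?W 0 k * eT (z 0)"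
    unfolding tel[OF order_refl] by (simp only: mult.assoc)
  finally show thesis using that k fl by blast
qed

lemma Jump_emb:
  assumes "z i \<in> K" "z (Suc i) \<in> K"
  shows "Tm (z (Suc i)) * mR (z i) * minv (Tm (z i)) \<in> carrier_mat d d"
    "emb 0 0 (Tm (z (Suc i)) * mR (z i) * minv (Tm (z i))) = Jt z i"
proof -
  note T = Tm_carrier[OF assms(2)] and R = carriers(3)[OF assms(1)] and Ti = minv_Tm(1)[OF assms(1)]
  note TR = mult_carrier_mat[OF T R]
  show "Tm (z (Suc i)) * mR (z i) * minv (Tm (z i)) \<in> carrier_mat d d"
    by (rule mult_carrier_mat[OF TR Ti])
  show "emb 0 0 (Tm (z (Suc i)) * mR (z i) * minv (Tm (z i))) = Jt z i"
    unfolding Jt_def eT_def eR_def eTi_def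
    by (simp only: emb_mult_carrier[OF TR Ti, of 0 0 0] emb_mult_carrier[OF T R, of 0 0 0])
qed

lemma ul_block_emb:
  assumes Q: "Q \<in> carrier_mat d d" and "r \<le> d" "c \<le> d"
  shows "ul_block r c Q \<in> carrier_mat r c" "emb 0 0 (ul_block r c Q) = pj 0 r * emb 0 0 Q * pj 0 c"
proof -
  show "ul_block r c Q \<in> carrier_mat r c" by (simp add: ul_block_def)
  obtain Q1 Q2 Q3 Q4 where s: "split_block Q r c = (Q1, Q2, Q3, Q4)" by (metis prod_cases4)
  have dims: "dim_row Q = r + (d - r)" "dim_col Q = c + (d - c)" using assms by auto
  note sb = split_block[OF s dims]
  have "ul_block r c Q = Q1"
    unfolding ul_block_def using sb(1,4) by (intro eq_matI) (auto simp: sb(5))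
  moreover have "emb 0 0 Q = emb 0 0 Q1 + emb 0 c Q2 + emb r 0 Q3 + emb r c Q4"
    by (subst sb(5)) (simp add: emb_four_block[OF sb(1-4)])
  moreover have "pj 0 r * emb r x Y = 0" "emb x c Y * pj 0 c = 0" for x Y
    unfolding pj_def by (simp_all add: emb_mult_disjoint)
  ultimately show "emb 0 0 (ul_block r c Q) = pj 0 r * emb 0 0 Q * pj 0 c"
    using sb(1,2) by (simp add: distrib_left distrib_right emb_one_left emb_one_right mult.assoc)
qed

lemma bar_flow_emb:
  assumes sg: "signal K \<tau> (enat n) t z" and s: "t n \<le> s"
  defines "r \<equiv> (enat n, t, \<lambda>k. Mm (z k),
      \<lambda>k. ul_block (ml (z (Suc k))) (ml (z k)) (Tm (z (Suc k)) * mR (z k) * minv (Tm (z k))))"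
  shows "r \<in> sys_bar K \<tau>" "dim_row (flow r s) \<le> d" "dim_col (flow r s) \<le> d"
    "emb 0 0 (flow r s) = exp ((s - t n) *\<^sub>R eM (z n)) * p (z n) *
       oprod (\<lambda>i. Jt z i * (exp ((t (Suc i) - t i) *\<^sub>R eM (z i)) * p (z i))) 0 n * p (z 0)"
proof -
  show "r \<in> sys_bar K \<tau>" unfolding r_def sys_bar_def using sg by blast
  have zK: "z i \<in> K" if "i \<le> n" for i
    using signal_mode_in[OF sg] that by simp
  have lt: "ml (z i) \<le> d" if "i \<le> n" for i using ml_bounds[OF zK[OF that]] by simp
  have A: "Mm (z i) \<in> carrier_mat (ml (z i)) (ml (z i))" if "i \<le> n" for i
    by (rule Mm_carrier[OF zK[OF that]])
  let ?J = "\<lambda>i. ul_block (ml (z (Suc i))) (ml (z i)) (Tm (z (Suc i)) * mR (z i) * minv (Tm (z i)))"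
  have J: "?J i \<in> carrier_mat (ml (z (Suc i))) (ml (z i))"
    and Je: "emb 0 0 (?J i) = p (z (Suc i)) * Jt z i * p (z i)" if "i < n" for i
    using Jump_emb[of z i] ul_block_emb[of "Tm (z (Suc i)) * mR (z i) * minv (Tm (z i))" "ml (z (Suc i))" "ml (z i)"]
      zK[of i] zK[of "Suc i"] lt[of i] lt[of "Suc i"] that by auto
  note fl = flow_emb[where n="\<lambda>i. ml (z i)", of n "\<lambda>k. Mm (z k)" ?J, OF A J sidx_last[OF sg s]]
  show "dim_row (flow r s) \<le> d" "dim_col (flow r s) \<le> d"
    using fl(1) lt[of n] lt[of 0] unfolding r_def by auto
  let ?E = "\<lambda>i. exp ((t (Suc i) - t i) *\<^sub>R eM (z i)) * p (z i)"
  have pE: "p (z i) * ?E i = ?E i" if "i \<le> n" for i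
  proof -
    have "p (z i) * eM (z i) = eM (z i) * p (z i)" by (simp add: eM_corners[OF zK[OF that]])
    from exp_intertwine_scaleR[OF this] show ?thesis
      by (metis mult.assoc pj_idem)
  qed
  have tel: "oprod (\<lambda>i. emb 0 0 (?J i) * ?E i) 0 j * p (z 0) = p (z j) * oprod (\<lambda>i. Jt z i * ?E i) 0 j * p (z 0)" if "j \<le> n" for j
    using that
  proof (induction j)
    case 0
    then show ?case by (simp add: pj_idem)
  next
    case (Suc j)
    have "oprod (\<lambda>i. emb 0 0 (?J i) * ?E i) 0 (Suc j) * p (z 0) = p (z (Suc j)) * Jt z j * p (z j) * ?E j * (oprod (\<lambda>i. emb 0 0 (?J i) * ?E i) 0 j * p (z 0))"
      using Suc.prems by (simp add: Je mult.assoc)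
    also have "\<dots> = p (z (Suc j)) * Jt z j * (p (z j) * ?E j) * (p (z j) * oprod (\<lambda>i. Jt z i * ?E i) 0 j * p (z 0))"
      using Suc by (simp add: mult.assoc)
    also have "\<dots> = p (z (Suc j)) * Jt z j * (exp ((t (Suc j) - t j) *\<^sub>R eM (z j)) * (p (z j) * p (z j))) * oprod (\<lambda>i. Jt z i * ?E i) 0 j * p (z 0)"
      using Suc.prems by (simp add: pE) (simp add: mult.assoc)
    finally show ?case by (simp add: pj_idem mult.assoc)
  qed
  have "emb 0 0 (flow r s) = exp ((s - t n) *\<^sub>R eM (z n)) * p (z n) * (oprod (\<lambda>i. emb 0 0 (?J i) * ?E i) 0 n * p (z 0))"
    using fl(2) unfolding r_def eM_def .
  also have "\<dots> = exp ((s - t n) *\<^sub>R eM (z n)) * (p (z n) * p (z n)) * oprod (\<lambda>i. Jt z i * ?E i) 0 n * p (z 0)"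
    unfolding tel[OF order_refl] by (simp only: mult.assoc)
  finally show "emb 0 0 (flow r s) = exp ((s - t n) *\<^sub>R eM (z n)) * p (z n) * oprod (\<lambda>i. Jt z i * ?E i) 0 n * p (z 0)"
    by (simp add: pj_idem)
qed

lemma hat_flow_emb:
  assumes sg: "signal K 0 (enat n) t z"
  defines "r \<equiv> (enat n, t,
      \<lambda>k. four_block_mat (0\<^sub>m (ml (z k)) (ml (z k))) (0\<^sub>m (ml (z k)) (mdim (z k) - ml (z k)))
                         (0\<^sub>m (mdim (z k) - ml (z k)) (ml (z k))) (bD (z k)),
      \<lambda>k. Tm (z (Suc k)) * mR (z k) * minv (Tm (z k)))"
  shows "r \<in> sys_hat K" "flow r (t n) \<in> carrier_mat d d"
    "emb 0 0 (flow r (t n)) = e * (oprod (\<lambda>i. Jt z i * (exp ((t (Suc i) - t i) *\<^sub>R eD (z i)) * e)) 0 n * e)"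
proof -
  show "r \<in> sys_hat K" unfolding r_def sys_hat_def using sg by blast
  have zK: "z i \<in> K" if "i \<le> n" for i
    using signal_mode_in[OF sg] that by simp
  let ?A = "\<lambda>k. four_block_mat (0\<^sub>m (ml (z k)) (ml (z k))) (0\<^sub>m (ml (z k)) (mdim (z k) - ml (z k)))
                         (0\<^sub>m (mdim (z k) - ml (z k)) (ml (z k))) (bD (z k))"
  let ?J = "\<lambda>k. Tm (z (Suc k)) * mR (z k) * minv (Tm (z k))"
  have A: "?A i \<in> carrier_mat d d" and Ae: "emb 0 0 (?A i) = eD (z i)" if "i \<le> n" for i
  proof -
    note z = zK[OF that]
    note D = block_facts(4)[OF z]
    show "?A i \<in> carrier_mat d d" using D ml_bounds[OF z] by (auto simp: mdim_eq[OF z])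
    show "emb 0 0 (?A i) = eD (z i)"
      unfolding mdim_eq[OF z] eD_def by (subst emb_four_block[OF _ _ _ D]) (auto simp: emb_zero)
  qed
  have J: "?J i \<in> carrier_mat d d" and Je: "emb 0 0 (?J i) = Jt z i" if "i < n" for i
    using Jump_emb[of z i] zK[of i] zK[of "Suc i"] that by auto
  note fl = flow_emb[where n="\<lambda>i. d", of n ?A ?J, OF A J sidx_last[OF sg order_refl]]
  show "flow r (t n) \<in> carrier_mat d d" using fl(1) unfolding r_def .
  have "oprod (\<lambda>i. emb 0 0 (?J i) * (exp ((t (Suc i) - t i) *\<^sub>R emb 0 0 (?A i)) * e)) 0 n =
     oprod (\<lambda>i. Jt z i * (exp ((t (Suc i) - t i) *\<^sub>R eD (z i)) * e)) 0 n"
    by (rule oprod_cong) (simp add: Je Ae)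
  then show "emb 0 0 (flow r (t n)) = e * (oprod (\<lambda>i. Jt z i * (exp ((t (Suc i) - t i) *\<^sub>R eD (z i)) * e)) 0 n * e)"
    using fl(2) unfolding r_def by simp
qed

text \<open>The signal has no switches (\<open>m = 0\<close>), so its flow is the bare exponential
  of \<open>M\<close>; the identity serves as every \<open>F k\<close>.\<close>

lemma tilde_const_flow_emb:
  assumes \<sigma>: "\<sigma> \<in> K" and s: "0 \<le> s"
  obtains r where "r \<in> sys_tilde d K" "dim_row (flow r s) \<le> d" "dim_col (flow r s) \<le> d"
    "emb 0 0 (flow r s) = exp (s *\<^sub>R eM \<sigma>) * p \<sigma>"
proof -
  let ?J = "\<lambda>k::nat. ul_block (ml \<sigma>) (ml \<sigma>) (Tm \<sigma> * 1\<^sub>m d * mR \<sigma> * minv (Tm \<sigma>))"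
  let ?r = "(enat 0, (\<lambda>i::nat. 0::real), (\<lambda>k::nat. Mm \<sigma>), ?J)"
  have sg: "signal K 0 (enat 0) (\<lambda>i. 0) (\<lambda>i. \<sigma>)"
    using \<sigma> by (simp add: signal_def)
  have "?r \<in> sys_tilde d K"
    unfolding sys_tilde_def Fhat_def
    by (rule CollectI, rule exI[of _ "enat 0"], rule exI[of _ "\<lambda>i. 0"], rule exI[of _ "\<lambda>i. \<sigma>"], rule exI[of _ "\<lambda>i. 1\<^sub>m d"])
      (use sg in auto)
  moreover note fl = flow_emb[where n="\<lambda>i. ml \<sigma>", of 0 "\<lambda>k. Mm \<sigma>" ?J, OF Mm_carrier[OF \<sigma>] _ sidx_last[OF sg s]]
  have "flow ?r s \<in> carrier_mat (ml \<sigma>) (ml \<sigma>)" using fl(1) by simp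
  moreover have "emb 0 0 (flow ?r s) = exp (s *\<^sub>R eM \<sigma>) * p \<sigma>"
    using fl(2) by (simp add: eM_def mult.assoc pj_idem)
  ultimately show thesis using that[of ?r] ml_bounds[OF \<sigma>] by auto
qed

end

section \<open>Lyapunov exponents as uniform exponential bounds\<close>

lemma elog_div_le_iff:
  assumes "0 < s" "0 \<le> x"
  shows "elog x / ereal s \<le> ereal a \<longleftrightarrow> x \<le> exp (a * s)"
proof (cases "x = 0")
  case False
  then have "ln x / s \<le> a \<longleftrightarrow> x \<le> exp (a * s)"
    using assms exp_le_cancel_iff[of "ln x" "a * s"] by (simp add: pos_divide_le_eq)
  then show ?thesis using False assms by (simp add: elog_def)
qed (use assms in \<open>simp add: elog_def\<close>)

lemma lyap_lessD:
  assumes "lyap S < ereal a"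
  obtains s0 where "0 < s0" "\<And>r s. r \<in> S \<Longrightarrow> s0 \<le> s \<Longrightarrow> opnorm (flow r s) \<le> exp (a * s)"
proof -
  have "eventually (\<lambda>s. (SUP r\<in>S. elog (opnorm (flow r s)) / ereal s) < ereal a) at_top"
    using assms unfolding lyap_def by (rule Limsup_lessD)
  then obtain s0 where s0: "\<And>s. s0 \<le> s \<Longrightarrow> (SUP r\<in>S. elog (opnorm (flow r s)) / ereal s) < ereal a"
    by (auto simp: eventually_at_top_linorder)
  show thesis
  proof (rule that[of "max 1 s0"])
    fix r s assume r: "r \<in> S" and s: "max 1 s0 \<le> s"
    have "elog (opnorm (flow r s)) / ereal s \<le> (SUP r\<in>S. elog (opnorm (flow r s)) / ereal s)"
      using r by (rule SUP_upper)
    also have "\<dots> \<le> ereal a" using s0[of s] s by simp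
    finally show "opnorm (flow r s) \<le> exp (a * s)"
      using s by (subst (asm) elog_div_le_iff) (auto simp: opnorm_nonneg)
  qed simp
qed

lemma lyap_sw_negD:
  assumes "lyap_sw S < 0"
  obtains \<delta> s0 where "0 < \<delta>" "0 < s0"
    "\<And>r k. r \<in> S \<Longrightarrow> 1 \<le> k \<Longrightarrow> enat k \<le> fst r \<Longrightarrow> s0 \<le> fst (snd r) k \<Longrightarrow>
       opnorm (flow r (fst (snd r) k)) \<le> exp (- \<delta> * fst (snd r) k)"
proof -
  \<comment> \<open>The exponent may be minus infinity, so a real number between it and 0 is chosen
    as the rate.\<close>
  from ereal_dense2[OF assms] obtain a where a: "lyap_sw S < ereal a" "ereal a < 0" by blast
  let ?A = "\<lambda>s. {(r, k). r \<in> S \<and> 1 \<le> k \<and> enat k \<le> fst r \<and> fst (snd r) k = s}"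
  have "eventually (\<lambda>s. (SUP rk\<in>?A s. elog (opnorm (flow (fst rk) s)) / ereal s) < ereal a) at_top"
    using a(1) unfolding lyap_sw_def by (rule Limsup_lessD)
  then obtain s0 where s0: "\<And>s. s0 \<le> s \<Longrightarrow> (SUP rk\<in>?A s. elog (opnorm (flow (fst rk) s)) / ereal s) < ereal a"
    by (auto simp: eventually_at_top_linorder)
  show thesis
  proof (rule that[of "- a" "max 1 s0"])
    show "0 < - a" using a(2) by (simp add: zero_ereal_def)
    fix r k assume r: "r \<in> S" "1 \<le> k" "enat k \<le> fst r" "max 1 s0 \<le> fst (snd r) k"
    let ?s = "fst (snd r) k"
    have "elog (opnorm (flow (fst (r, k)) ?s)) / ereal ?s \<le> (SUP rk\<in>?A ?s. elog (opnorm (flow (fst rk) ?s)) / ereal ?s)"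
      by (rule SUP_upper) (use r in auto)
    also have "\<dots> \<le> ereal a" using s0[of ?s] r by simp
    finally show "opnorm (flow r ?s) \<le> exp (- (- a) * ?s)"
      using r by (subst (asm) elog_div_le_iff) (auto simp: opnorm_nonneg)
  qed simp
qed

lemma lyap_leI:
  assumes bnd: "\<And>r s. r \<in> S \<Longrightarrow> 0 \<le> s \<Longrightarrow> opnorm (flow r s) \<le> C * exp (a * s)"
  shows "lyap S \<le> ereal a"
proof -
  \<comment> \<open>Making the prefactor at least 1 gives it a logarithm, and
    \<open>ln L / s\<close> disappears in the limit.\<close>
  define L where "L = max 1 C"
  have "lyap S \<le> Limsup at_top (\<lambda>s. ereal (ln L / s + a))"
    unfolding lyap_def
  proof (rule Limsup_mono, rule eventually_mono[OF eventually_gt_at_top[of 0]])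
    fix s :: real assume s: "0 < s"
    show "(SUP r\<in>S. elog (opnorm (flow r s)) / ereal s) \<le> ereal (ln L / s + a)"
    proof (rule SUP_least)
      fix r assume r: "r \<in> S"
      have "opnorm (flow r s) \<le> C * exp (a * s)" using bnd r s by simp
      also have "\<dots> \<le> L * exp (a * s)" unfolding L_def by (intro mult_right_mono) auto
      also have "\<dots> = exp ((ln L / s + a) * s)"
        using s by (simp add: L_def distrib_right exp_add)
      finally show "elog (opnorm (flow r s)) / ereal s \<le> ereal (ln L / s + a)"
        using s by (subst elog_div_le_iff) (auto simp: opnorm_nonneg)
    qed
  qed
  also have "\<dots> = ereal a"
  proof (rule lim_imp_Limsup)
    have "((\<lambda>s. ln L / s + a) \<longlongrightarrow> 0 + a) at_top"
      by (intro tendsto_intros real_tendsto_divide_at_top[OF tendsto_const] filterlim_ident)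
    then show "((\<lambda>s. ereal (ln L / s + a)) \<longlongrightarrow> ereal a) at_top" by simp
  qed simp
  finally show ?thesis .
qed

text \<open>Quantifies how much of an exponentially decaying factor is free to absorb an error: an
  amount linear in short times and bounded below for long ones. It follows from
  \<open>exp (- y) \<le> 1 / (1 + y)\<close>.\<close>

lemma min_div_le_one_minus_exp:
  fixes y :: real
  assumes "0 \<le> y"
  shows "min 1 y / 2 \<le> 1 - exp (- y)"
proof -
  have "exp (- y) \<le> 1 / (1 + y)"
    using exp_ge_add_one_self[of y] assms by (simp add: exp_minus divide_inverse)
  then have "1 - 1 / (1 + y) \<le> 1 - exp (- y)" by simp
  moreover have "min 1 y / 2 \<le> 1 - 1 / (1 + y)"
  proof -
    have "min 1 y * (1 + y) \<le> 2 * y" using assms by (auto simp: min_def algebra_simps mult_left_le_one_le)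
    then show ?thesis using assms by (simp add: field_simps)
  qed
  ultimately show ?thesis by linarith
qed

section \<open>Uniform estimates over all modes and signals\<close>

context modes
begin

lemma emb_le_opnorm_d:
  assumes "dim_row A \<le> d" "dim_col A \<le> d"
  shows "norm (emb 0 0 A) \<le> real (d * d) * opnorm A"
proof -
  have "real (dim_row A * dim_col A) \<le> real (d * d)" using assms by (simp add: mult_mono)
  then have "real (dim_row A * dim_col A) * opnorm A \<le> real (d * d) * opnorm A"
    by (rule mult_right_mono) (rule opnorm_nonneg)
  with emb_le_opnorm[of 0 0 A] show ?thesis by linarith
qed

lemma sing_gen_corners:
  assumes "\<sigma> \<in> K"
  shows "e * sing_gen \<sigma> \<epsilon> = sing_gen \<sigma> \<epsilon>" "sing_gen \<sigma> \<epsilon> * e = sing_gen \<sigma> \<epsilon>"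
proof -
  note cs = corners[OF assms] eM_corners[OF assms] corners_Q[OF assms] and pq = pq[OF assms]
  have l: "e * x = x" if "p \<sigma> * x = x \<or> q \<sigma> * x = x" for x
  proof -
    have "e * p \<sigma> = p \<sigma>" "e * q \<sigma> = q \<sigma>" by (simp_all add: e_split[OF assms] distrib_right pq)
    then have "e * (p \<sigma> * x) = p \<sigma> * x" "e * (q \<sigma> * x) = q \<sigma> * x" by (simp_all add: mult.assoc[symmetric])
    with that show ?thesis by auto
  qed
  have r: "x * e = x" if "x * p \<sigma> = x \<or> x * q \<sigma> = x" for x
  proof -
    have "p \<sigma> * e = p \<sigma>" "q \<sigma> * e = q \<sigma>" by (simp_all add: e_split[OF assms] distrib_left pq)
    then have "(x * p \<sigma>) * e = x * p \<sigma>" "(x * q \<sigma>) * e = x * q \<sigma>" by (simp_all add: mult.assoc)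
    with that show ?thesis by auto
  qed
  have "e * eM \<sigma> = eM \<sigma>" "e * eB \<sigma> = eB \<sigma>" "e * eD \<sigma> = eD \<sigma>" by (rule l; simp add: cs)+
  moreover have "eM \<sigma> * e = eM \<sigma>" "eB \<sigma> * e = eB \<sigma>" "eD \<sigma> * e = eD \<sigma>" by (rule r; simp add: cs)+
  moreover have "e * (eQ \<sigma> * x) = eQ \<sigma> * x" for x by (simp add: mult.assoc[symmetric] cs)
  ultimately show "e * sing_gen \<sigma> \<epsilon> = sing_gen \<sigma> \<epsilon>" "sing_gen \<sigma> \<epsilon> * e = sing_gen \<sigma> \<epsilon>"
    unfolding sing_gen_def[OF assms] by (simp_all add: distrib_left distrib_right mult.assoc)
qed

lemma e_sing_flow: "\<sigma> \<in> K \<Longrightarrow> e * sing_flow \<epsilon> \<sigma> x = sing_flow \<epsilon> \<sigma> x"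
proof -
  assume \<sigma>: "\<sigma> \<in> K"
  have "e * exp (x *\<^sub>R sing_gen \<sigma> \<epsilon>) = exp (x *\<^sub>R sing_gen \<sigma> \<epsilon>) * e"
    by (rule exp_intertwine_scaleR) (simp add: sing_gen_corners[OF \<sigma>])
  then show ?thesis unfolding sing_flow_def by (simp add: mult.assoc[symmetric]) (simp add: mult.assoc pj_idem)
qed

lemma sing_flow_estimates:
  assumes slow: "\<And>\<sigma> t. \<sigma> \<in> K \<Longrightarrow> 0 \<le> t \<Longrightarrow> norm (exp (t *\<^sub>R eM \<sigma>) * p \<sigma>) \<le> C0 * exp (\<omega> * t)"
    and \<omega>: "\<omega> < \<omega>'"
  obtains \<epsilon>0 C where "0 < \<epsilon>0" "1 \<le> C"
    "\<And>\<epsilon> \<sigma> t. \<lbrakk>0 < \<epsilon>; \<epsilon> < \<epsilon>0; \<sigma> \<in> K; 0 \<le> t\<rbrakk> \<Longrightarrow> norm (sing_flow \<epsilon> \<sigma> t) \<le> C * exp (\<omega>' * t)"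
    "\<And>\<epsilon> \<sigma> t. \<lbrakk>0 < \<epsilon>; \<epsilon> < \<epsilon>0; \<sigma> \<in> K; 0 \<le> t\<rbrakk> \<Longrightarrow>
       norm (q \<sigma> * sing_flow \<epsilon> \<sigma> t - exp ((t / \<epsilon>) *\<^sub>R eD \<sigma>) * q \<sigma>) \<le> C * min \<epsilon> t * exp (\<omega>' * t)"
    "\<And>\<epsilon> \<sigma> t. \<lbrakk>0 < \<epsilon>; \<epsilon> < \<epsilon>0; \<sigma> \<in> K; 0 \<le> t\<rbrakk> \<Longrightarrow>
       norm (p \<sigma> * sing_flow \<epsilon> \<sigma> t - exp (t *\<^sub>R eM \<sigma>) * p \<sigma>) \<le> C * \<epsilon> * exp (\<omega>' * t)"
proof -
  obtain b where b: "1 \<le> b" "\<And>\<sigma>. \<sigma> \<in> K \<Longrightarrow> norm (p \<sigma>) \<le> b" "\<And>\<sigma>. \<sigma> \<in> K \<Longrightarrow> norm (q \<sigma>) \<le> b"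
    "\<And>\<sigma>. \<sigma> \<in> K \<Longrightarrow> norm (eB \<sigma>) \<le> b" "\<And>\<sigma>. \<sigma> \<in> K \<Longrightarrow> norm (eQ \<sigma> * eM \<sigma>) \<le> b"
    "\<And>\<sigma>. \<sigma> \<in> K \<Longrightarrow> norm (eQ \<sigma> * eB \<sigma>) \<le> b"
    by (rule uniform_bound) blast
  obtain c C1 where c: "0 < c" "1 \<le> C1"
    "\<And>\<sigma> s. \<sigma> \<in> K \<Longrightarrow> 0 \<le> s \<Longrightarrow> norm (exp (s *\<^sub>R eD \<sigma>) * q \<sigma>) \<le> C1 * exp (- c * s)"
    by (rule uniform_fast_decay) blast
  have C0: "1 \<le> max 1 C0" by simp
  from slow_fast_estimates[OF b(1) C0 c(2,1) \<omega>, where 'a=bop] obtain \<epsilon>0 C where C: "0 < \<epsilon>0" "1 \<le> C"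
    "\<And>\<epsilon> p q M D B N S t. \<lbrakk>slow_fast p q M D B N (S::bop) b (max 1 C0) C1 \<omega> c; 0 < \<epsilon>; \<epsilon> < \<epsilon>0; 0 \<le> t\<rbrakk> \<Longrightarrow>
      let G = M + B + N + S + (1 / \<epsilon>) *\<^sub>R D; z = exp (t *\<^sub>R G) * (p + q) in
       norm (p * z) \<le> C * exp (\<omega>' * t) \<and> norm (q * z) \<le> C * exp (\<omega>' * t) \<and>
       norm (q * z - exp (t *\<^sub>R ((1 / \<epsilon>) *\<^sub>R D)) * q) \<le> C * min \<epsilon> t * exp (\<omega>' * t) \<and>
       norm (p * z - exp (t *\<^sub>R M) * p) \<le> C * \<epsilon> * exp (\<omega>' * t)"
    by metis
  have sf: "slow_fast (p \<sigma>) (q \<sigma>) (eM \<sigma>) (eD \<sigma>) (eB \<sigma>) (eQ \<sigma> * eM \<sigma>) (eQ \<sigma> * eB \<sigma>) b (max 1 C0) C1 \<omega> c"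
    if \<sigma>: "\<sigma> \<in> K" for \<sigma>
  proof
    show "norm (exp (t *\<^sub>R eM \<sigma>) * p \<sigma>) \<le> max 1 C0 * exp (\<omega> * t)" if "0 \<le> t" for t
      by (rule order_trans[OF slow[OF \<sigma> that]]) (simp add: mult_right_mono)
  qed (use b c \<sigma> pq[OF \<sigma>] corners[OF \<sigma>] eM_corners[OF \<sigma>] eM_eB_corners[OF \<sigma>] in auto)
  have est: "norm (p \<sigma> * sing_flow \<epsilon> \<sigma> t) \<le> C * exp (\<omega>' * t) \<and> norm (q \<sigma> * sing_flow \<epsilon> \<sigma> t) \<le> C * exp (\<omega>' * t) \<and>
       norm (q \<sigma> * sing_flow \<epsilon> \<sigma> t - exp ((t / \<epsilon>) *\<^sub>R eD \<sigma>) * q \<sigma>) \<le> C * min \<epsilon> t * exp (\<omega>' * t) \<and>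
       norm (p \<sigma> * sing_flow \<epsilon> \<sigma> t - exp (t *\<^sub>R eM \<sigma>) * p \<sigma>) \<le> C * \<epsilon> * exp (\<omega>' * t)"
    if "0 < \<epsilon>" "\<epsilon> < \<epsilon>0" "\<sigma> \<in> K" "0 \<le> t" for \<epsilon> \<sigma> t
    using C(3)[OF sf[OF that(3)] that(1,2,4)]
    by (simp add: sing_flow_def sing_gen_def[OF that(3)] e_split[OF that(3), symmetric] Let_def)
  show thesis
  \<comment> \<open>The full flow is the sum of its slow and fast rows, each bounded with constant
    \<open>C\<close>.\<close>
  proof (rule that[OF C(1), of "2 * C"])
    show "1 \<le> 2 * C" using C by simp
    fix \<epsilon> \<sigma> t assume A: "0 < \<epsilon>" "\<epsilon> < \<epsilon>0" "\<sigma> \<in> K" "0 \<le> (t::real)"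
    have "sing_flow \<epsilon> \<sigma> t = p \<sigma> * sing_flow \<epsilon> \<sigma> t + q \<sigma> * sing_flow \<epsilon> \<sigma> t"
      using e_sing_flow[OF A(3)] by (simp add: e_split[OF A(3)] distrib_right)
    also have "norm \<dots> \<le> C * exp (\<omega>' * t) + C * exp (\<omega>' * t)"
      using est[OF A] by (intro order_trans[OF norm_triangle_ineq] add_mono) auto
    finally show "norm (sing_flow \<epsilon> \<sigma> t) \<le> 2 * C * exp (\<omega>' * t)" by simp
    have le: "C * x * exp (\<omega>' * t) \<le> 2 * C * x * exp (\<omega>' * t)" if "0 \<le> x" for x
      using C that by (intro mult_right_mono) auto
    show "norm (q \<sigma> * sing_flow \<epsilon> \<sigma> t - exp ((t / \<epsilon>) *\<^sub>R eD \<sigma>) * q \<sigma>) \<le> 2 * C * min \<epsilon> t * exp (\<omega>' * t)"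
      using est[OF A] le[of "min \<epsilon> t"] A by auto
    show "norm (p \<sigma> * sing_flow \<epsilon> \<sigma> t - exp (t *\<^sub>R eM \<sigma>) * p \<sigma>) \<le> 2 * C * \<epsilon> * exp (\<omega>' * t)"
      using est[OF A] le[of \<epsilon>] A by auto
  qed
qed

text \<open>Reduces the flow at an arbitrary time to products that end with a jump. The last,
  incomplete interval and the change of coordinates cost constant factors, and the exponentials add
  up to \<open>exp (\<omega> * s)\<close>.\<close>

lemma eps_flow_bound:
  assumes sg: "signal K \<tau> m t z" and \<epsilon>: "0 < \<epsilon>" and s: "0 \<le> s"
    and b: "0 \<le> b" "\<And>\<sigma>. \<sigma> \<in> K \<Longrightarrow> norm (eT \<sigma>) \<le> b" "\<And>\<sigma>. \<sigma> \<in> K \<Longrightarrow> norm (eTi \<sigma>) \<le> b"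
    and C: "\<And>\<sigma> t. \<sigma> \<in> K \<Longrightarrow> 0 \<le> t \<Longrightarrow> norm (sing_flow \<epsilon> \<sigma> t) \<le> C * exp (\<omega> * t)" "0 \<le> C"
    and W: "\<And>k. enat k \<le> m \<Longrightarrow> norm (oprod (\<lambda>i. Jt z i * sing_flow \<epsilon> (z i) (t (Suc i) - t i)) 0 k) \<le> L * exp (\<omega> * t k)" "0 \<le> L"
  shows "opnorm (flow (m, t, \<lambda>k. gen \<epsilon> (z k), \<lambda>k. mR (z k)) s) \<le> real (d * d) * (b * C * L * b) * exp (\<omega> * s)"
proof -
  let ?W = "\<lambda>i. Jt z i * sing_flow \<epsilon> (z i) (t (Suc i) - t i)"
  let ?f = "flow (m, t, \<lambda>k. gen \<epsilon> (z k), \<lambda>k. mR (z k)) s"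
  obtain k where k: "enat k \<le> m" "t k \<le> s" "?f \<in> carrier_mat d d"
    "emb 0 0 ?f = eTi (z k) * sing_flow \<epsilon> (z k) (s - t k) * oprod ?W 0 k * eT (z 0)"
    by (rule eps_flow_emb[OF sg \<epsilon> s])
  have z0: "z 0 \<in> K" and zk: "z k \<in> K"
    using signal_mode_in[OF sg] k(1) by (auto simp: zero_enat_def[symmetric])
  have "norm (eTi (z k) * sing_flow \<epsilon> (z k) (s - t k) * oprod ?W 0 k * eT (z 0)) \<le>
      norm (eTi (z k) * sing_flow \<epsilon> (z k) (s - t k)) * norm (oprod ?W 0 k) * norm (eT (z 0))"
    by (rule norm_mult3)
  also have "norm (eTi (z k) * sing_flow \<epsilon> (z k) (s - t k)) \<le> norm (eTi (z k)) * norm (sing_flow \<epsilon> (z k) (s - t k))"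
    by (rule norm_mult_ineq)
  also have "norm (eTi (z k)) * norm (sing_flow \<epsilon> (z k) (s - t k)) * norm (oprod ?W 0 k) * norm (eT (z 0))
     \<le> b * (C * exp (\<omega> * (s - t k))) * (L * exp (\<omega> * t k)) * b"
    using b C W k zk z0 by (intro mult_mono) auto
  also have "\<dots> = (b * C * L * b) * (exp (\<omega> * (s - t k)) * exp (\<omega> * t k))" by (simp add: mult_ac)
  also have "exp (\<omega> * (s - t k)) * exp (\<omega> * t k) = exp (\<omega> * s)"
    by (simp add: exp_add[symmetric] algebra_simps)
  finally have "norm (emb 0 0 ?f) \<le> (b * C * L * b) * exp (\<omega> * s)"
    unfolding k(4) by (simp add: mult_right_mono)
  then have "real (d * d) * norm (emb 0 0 ?f) \<le> real (d * d) * ((b * C * L * b) * exp (\<omega> * s))"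
    by (rule mult_left_mono) simp
  with opnorm_le_emb[of ?f 0 0] k(3) show ?thesis by simp
qed

lemma norm_Jt:
  assumes "\<And>\<sigma>. \<sigma> \<in> K \<Longrightarrow> norm (eT \<sigma>) \<le> b" "\<And>\<sigma>. \<sigma> \<in> K \<Longrightarrow> norm (eTi \<sigma>) \<le> b" "\<And>\<sigma>. \<sigma> \<in> K \<Longrightarrow> norm (eR \<sigma>) \<le> b"
    and "z i \<in> K" "z (Suc i) \<in> K" "0 \<le> b"
  shows "norm (Jt z i) \<le> b * b * b"
  unfolding Jt_def using assms by (intro order_trans[OF norm_mult3] mult_mono) auto

lemma const_bar_slow:
  assumes bar: "\<And>r s. r \<in> sys_bar K \<tau> \<Longrightarrow> 0 \<le> s \<Longrightarrow> opnorm (flow r s) \<le> C * exp (\<omega> * s)"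
    and \<sigma>: "\<sigma> \<in> K" and t: "0 \<le> t"
  shows "norm (exp (t *\<^sub>R eM \<sigma>) * p \<sigma>) \<le> real (d * d) * C * exp (\<omega> * t)"
proof -
  have sg: "signal K \<tau> (enat 0) (\<lambda>i. 0) (\<lambda>i. \<sigma>)" using \<sigma> by (simp add: signal_def)
  note bf = bar_flow_emb[OF sg t]
  have "exp (t *\<^sub>R eM \<sigma>) * p \<sigma> * oprod (\<lambda>i. Jt (\<lambda>i. \<sigma>) i * (exp ((0 - 0) *\<^sub>R eM \<sigma>) * p \<sigma>)) 0 0 * p \<sigma> = exp (t *\<^sub>R eM \<sigma>) * p \<sigma>"
    by (simp add: mult.assoc pj_idem)
  then have "norm (exp (t *\<^sub>R eM \<sigma>) * p \<sigma>) \<le> real (d * d) * opnorm (flow (enat 0, (\<lambda>i. 0), \<lambda>k. Mm \<sigma>,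
      \<lambda>k. ul_block (ml \<sigma>) (ml \<sigma>) (Tm \<sigma> * mR \<sigma> * minv (Tm \<sigma>))) t)"
    using emb_le_opnorm_d[OF bf(2,3)] bf(4) by simp
  also have "\<dots> \<le> real (d * d) * (C * exp (\<omega> * t))"
    by (intro mult_left_mono bar bf(1) t) simp
  finally show ?thesis by (simp add: mult.assoc)
qed

text \<open>On an interval of length at least \<open>\<tau>\<close> the factor
  \<open>exp (\<omega> * \<delta>)\<close> lies below \<open>exp (\<omega>' * \<delta>)\<close> by
  the fixed ratio \<open>exp (- (\<omega>' - \<omega>) * \<tau>)\<close>. For small
  \<open>\<epsilon>\<close> this margin holds the error of the interval, including the prefactor
  \<open>L\<close>.\<close>

lemma dwell_time_bound:
  assumes \<tau>: "0 < \<tau>" and \<omega>: "\<omega> < \<omega>'"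
    and bar: "\<And>r s. r \<in> sys_bar K \<tau> \<Longrightarrow> 0 \<le> s \<Longrightarrow> opnorm (flow r s) \<le> Cb * exp (\<omega> * s)"
  obtains \<epsilon>0 C where "0 < \<epsilon>0"
    "\<And>\<epsilon> r s. \<lbrakk>0 < \<epsilon>; \<epsilon> < \<epsilon>0; r \<in> sys_eps K \<tau> \<epsilon>; 0 \<le> s\<rbrakk> \<Longrightarrow> opnorm (flow r s) \<le> C * exp (\<omega>' * s)"
proof -
  obtain b where b: "1 \<le> b"
    "\<And>\<sigma>. \<sigma> \<in> K \<Longrightarrow> norm (eT \<sigma>) \<le> b"
    "\<And>\<sigma>. \<sigma> \<in> K \<Longrightarrow> norm (eTi \<sigma>) \<le> b" "\<And>\<sigma>. \<sigma> \<in> K \<Longrightarrow> norm (eR \<sigma>) \<le> b"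
    by (rule uniform_bound) blast
  obtain c C1 where c: "0 < c" "1 \<le> C1"
    "\<And>\<sigma> s. \<sigma> \<in> K \<Longrightarrow> 0 \<le> s \<Longrightarrow> norm (exp (s *\<^sub>R eD \<sigma>) * q \<sigma>) \<le> C1 * exp (- c * s)"
    by (rule uniform_fast_decay) blast
  obtain \<epsilon>1 C where C: "0 < \<epsilon>1" "1 \<le> C"
    "\<And>\<epsilon> \<sigma> t. \<lbrakk>0 < \<epsilon>; \<epsilon> < \<epsilon>1; \<sigma> \<in> K; 0 \<le> t\<rbrakk> \<Longrightarrow> norm (sing_flow \<epsilon> \<sigma> t) \<le> C * exp (\<omega>' * t)"
    "\<And>\<epsilon> \<sigma> t. \<lbrakk>0 < \<epsilon>; \<epsilon> < \<epsilon>1; \<sigma> \<in> K; 0 \<le> t\<rbrakk> \<Longrightarrow>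
       norm (q \<sigma> * sing_flow \<epsilon> \<sigma> t - exp ((t / \<epsilon>) *\<^sub>R eD \<sigma>) * q \<sigma>) \<le> C * min \<epsilon> t * exp (\<omega>' * t)"
    "\<And>\<epsilon> \<sigma> t. \<lbrakk>0 < \<epsilon>; \<epsilon> < \<epsilon>1; \<sigma> \<in> K; 0 \<le> t\<rbrakk> \<Longrightarrow>
       norm (p \<sigma> * sing_flow \<epsilon> \<sigma> t - exp (t *\<^sub>R eM \<sigma>) * p \<sigma>) \<le> C * \<epsilon> * exp (\<omega>' * t)"
    by (rule sing_flow_estimates[OF const_bar_slow[OF bar] \<omega>]) blast+
  \<comment> \<open>Bounds products of bar steps: the bar flow, translated to the norm of
    \<open>bop\<close>, followed by one jump of norm at most \<open>b * b * b\<close>. The empty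
    product accounts for the 1.\<close>
  define L where "L = max 1 (b * b * b * (real (d * d) * Cb))"
  \<comment> \<open>The summand \<open>2 * C\<close> comes from the errors of the slow and the fast
    row, \<open>2 * C1 / (c * \<tau>)\<close> from the fast flow itself, which has no counterpart in
    the bar system.\<close>
  define k5 where "k5 = b * b * b * (2 * C + 2 * C1 / (c * \<tau>))"
  \<comment> \<open>Besides \<open>\<epsilon>1\<close>: the first bound keeps
    \<open>c / (2 * \<epsilon>)\<close> below \<open>c / \<epsilon> + \<omega>'\<close>, the second
    fits the errors into the margin of one interval.\<close>
  define \<epsilon>0 where "\<epsilon>0 = min \<epsilon>1 (min (c / 2 / (\<bar>\<omega>'\<bar> + 1)) ((1 - exp (- (\<omega>' - \<omega>) * \<tau>)) / (L * k5)))"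
  have L: "1 \<le> L" by (simp add: L_def)
  have k5: "0 < k5" unfolding k5_def using b(1) C(2) c \<tau> by (intro mult_pos_pos add_pos_pos) auto
  have gap: "0 < 1 - exp (- (\<omega>' - \<omega>) * \<tau>)"
    using mult_pos_pos[of "\<omega>' - \<omega>" \<tau>] \<omega> \<tau> by (simp add: algebra_simps)
  show thesis
  proof (rule that[of \<epsilon>0 "real (d * d) * (b * C * L * b)"])
    show "0 < \<epsilon>0" unfolding \<epsilon>0_def min_less_iff_conj using C(1) c L k5 gap by (intro conjI divide_pos_pos) auto
    fix \<epsilon> r s assume \<epsilon>: "0 < \<epsilon>" "\<epsilon> < \<epsilon>0" and r: "r \<in> sys_eps K \<tau> \<epsilon>" and s: "0 \<le> (s::real)"
    have \<epsilon>1: "\<epsilon> < \<epsilon>1" using \<epsilon> by (simp add: \<epsilon>0_def)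
    have \<epsilon>2: "\<epsilon> * (\<bar>\<omega>'\<bar> + 1) \<le> c / 2"
    proof -
      have "\<epsilon> \<le> c / 2 / (\<bar>\<omega>'\<bar> + 1)" using \<epsilon> by (simp add: \<epsilon>0_def)
      moreover have "0 < \<bar>\<omega>'\<bar> + 1" by simp
      ultimately show ?thesis by (simp only: pos_le_divide_eq)
    qed
    have \<epsilon>3: "L * k5 * \<epsilon> \<le> 1 - exp (- (\<omega>' - \<omega>) * \<tau>)"
    proof -
      have "\<epsilon> \<le> (1 - exp (- (\<omega>' - \<omega>) * \<tau>)) / (L * k5)" using \<epsilon> by (simp add: \<epsilon>0_def)
      moreover have "0 < L * k5" using L k5 by simp
      ultimately have "\<epsilon> * (L * k5) \<le> 1 - exp (- (\<omega>' - \<omega>) * \<tau>)" by (simp only: pos_le_divide_eq)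
      then show ?thesis by (simp add: mult_ac)
    qed
    have rate: "c / (2 * \<epsilon>) \<le> c / \<epsilon> + \<omega>'"
    proof -
      have "\<epsilon> * \<bar>\<omega>'\<bar> \<le> c / 2" using \<epsilon>2 \<epsilon>(1) by (simp add: distrib_left)
      then have "\<bar>\<omega>'\<bar> \<le> c / (2 * \<epsilon>)" using \<epsilon>(1) by (simp add: field_simps)
      moreover have "c / \<epsilon> = c / (2 * \<epsilon>) + c / (2 * \<epsilon>)" by simp
      ultimately show ?thesis by linarith
    qed
    obtain m t z where r_eq: "r = (m, t, \<lambda>k. gen \<epsilon> (z k), \<lambda>k. mR (z k))" and sg: "signal K \<tau> m t z"
      using r unfolding sys_eps_def by blast
    let ?\<delta> = "\<lambda>i. t (Suc i) - t i"
    let ?W = "\<lambda>i. Jt z i * sing_flow \<epsilon> (z i) (?\<delta> i)"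
    let ?U = "\<lambda>i. Jt z i * (exp (?\<delta> i *\<^sub>R eM (z i)) * p (z i))"
    have W: "norm (oprod ?W 0 k) \<le> L * exp (\<omega>' * t k)" if k: "enat k \<le> m" for k
    proof -
      have zK: "z i \<in> K" if "i \<le> k" for i
        using signal_mode_in[OF sg] k that by (meson enat_ord_simps(1) order_trans)
      have dw: "\<tau> \<le> ?\<delta> i" if "i < k" for i
      proof -
        have "enat (Suc i) \<le> m" using k that by (meson Suc_leI enat_ord_simps(1) order_trans)
        then show ?thesis using sg unfolding signal_def by blast
      qed
      have J: "norm (Jt z i) \<le> b * b * b" if "i < k" for i
        using b zK that by (intro norm_Jt) auto
      have "norm (oprod ?W 0 k) \<le> L * (\<Prod>i<k. exp (\<omega> * ?\<delta> i) + L * (k5 * \<epsilon> * exp (\<omega>' * ?\<delta> i)))"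
      proof (rule oprod_perturbation[OF L])
        fix j n assume jn: "j + n \<le> k"
        show "norm (oprod ?U j n) \<le> L * (\<Prod>i=j..<j+n. exp (\<omega> * ?\<delta> i))"
        \<comment> \<open>A step ends with its jump, whereas a bar flow ends inside an interval. The
          flow with \<open>n - 1\<close> switches is therefore evaluated at the next switching time,
          and the last jump is applied separately.\<close>
        proof (cases n)
          case (Suc n')
          have le: "enat (j + n') \<le> m" by (rule order_trans[OF _ k]) (use jn Suc in simp)
          note seg = signal_segment[OF sg le]
          have ts: "t (j + n') - t j \<le> t (j + Suc n') - t j" using dw[of "j + n'"] jn Suc \<tau> by simp
          note bf = bar_flow_emb[OF seg, of "t (j + Suc n') - t j", OF ts]
          let ?r = "(enat n', \<lambda>i. t (j + i) - t j, \<lambda>k. Mm (z (j + k)),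
             \<lambda>k. ul_block (ml (z (j + Suc k))) (ml (z (j + k))) (Tm (z (j + Suc k)) * mR (z (j + k)) * minv (Tm (z (j + k)))))"
          have up: "oprod ?U j (Suc i) * p (z j) = oprod ?U j (Suc i)" for i
            unfolding oprod_Suc_right by (simp add: mult.assoc pj_idem)
          have Ush: "oprod ?U j n' = oprod (\<lambda>i. Jt (\<lambda>i. z (j + i)) i * (exp ((t (j + Suc i) - t j - (t (j + i) - t j)) *\<^sub>R eM (z (j + i))) * p (z (j + i)))) 0 n'"
            by (subst oprod_shift) (simp add: Jt_def)
          have "oprod ?U j (Suc n') = oprod ?U j (Suc n') * p (z j)" by (simp only: up)
          also have "\<dots> = Jt z (j + n') * (exp (?\<delta> (j + n') *\<^sub>R eM (z (j + n'))) * p (z (j + n')) * oprod ?U j n' * p (z j))"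
            by (simp add: mult.assoc)
          also have "exp (?\<delta> (j + n') *\<^sub>R eM (z (j + n'))) * p (z (j + n')) * oprod ?U j n' * p (z j) = emb 0 0 (flow ?r (t (j + Suc n') - t j))"
            using bf(4) unfolding Ush by simp
          finally have "norm (oprod ?U j n) \<le> norm (Jt z (j + n')) * norm (emb 0 0 (flow ?r (t (j + Suc n') - t j)))"
            unfolding Suc by (simp only: norm_mult_ineq)
          also have "\<dots> \<le> (b * b * b) * (real (d * d) * (Cb * exp (\<omega> * (t (j + Suc n') - t j))))"
          proof (rule mult_mono)
            show "norm (Jt z (j + n')) \<le> b * b * b" using J jn Suc by simp
            have "norm (emb 0 0 (flow ?r (t (j + Suc n') - t j))) \<le> real (d * d) * opnorm (flow ?r (t (j + Suc n') - t j))"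
              by (rule emb_le_opnorm_d[OF bf(2,3)])
            also have "\<dots> \<le> real (d * d) * (Cb * exp (\<omega> * (t (j + Suc n') - t j)))"
            proof (intro mult_left_mono bar bf(1))
              have "t j \<le> t (j + n')" using signal_mono[OF sg _ le, of j] by simp
              then show "0 \<le> t (j + Suc n') - t j" using ts by simp
            qed simp
            finally show "norm (emb 0 0 (flow ?r (t (j + Suc n') - t j))) \<le> real (d * d) * (Cb * exp (\<omega> * (t (j + Suc n') - t j)))" .
          qed (use b in auto)
          also have "\<dots> \<le> L * exp (\<omega> * (t (j + n) - t j))"
            unfolding L_def Suc by (simp add: mult.assoc[symmetric] mult_right_mono)
          finally show ?thesis by (simp only: prod_exp_increments)
        qed (use L in simp)
      next
        fix i assume i: "i < k"
        note \<sigma> = zK[OF less_imp_le[OF i]]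
        have \<delta>: "0 \<le> ?\<delta> i" "0 < ?\<delta> i" using dw[OF i] \<tau> by auto
        let ?z = "sing_flow \<epsilon> (z i) (?\<delta> i)"
        have n1: "norm (p (z i) * ?z - exp (?\<delta> i *\<^sub>R eM (z i)) * p (z i)) \<le> C * \<epsilon> * exp (\<omega>' * ?\<delta> i)"
          by (rule C(5)[OF \<epsilon>(1) \<epsilon>1 \<sigma> \<delta>(1)])
        have "C * min \<epsilon> (?\<delta> i) * exp (\<omega>' * ?\<delta> i) \<le> C * \<epsilon> * exp (\<omega>' * ?\<delta> i)"
          using C(2) by (intro mult_right_mono mult_left_mono) auto
        then have n2: "norm (q (z i) * ?z - exp ((?\<delta> i / \<epsilon>) *\<^sub>R eD (z i)) * q (z i)) \<le> C * \<epsilon> * exp (\<omega>' * ?\<delta> i)"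
          using C(4)[OF \<epsilon>(1) \<epsilon>1 \<sigma> \<delta>(1)] by linarith
        have "norm (exp ((?\<delta> i / \<epsilon>) *\<^sub>R eD (z i)) * q (z i)) \<le> C1 * exp (- c * (?\<delta> i / \<epsilon>))"
          using \<epsilon>(1) \<delta> by (intro c(3) \<sigma>) auto
        also have "\<dots> = C1 * (exp (- ((c / \<epsilon> + \<omega>') * ?\<delta> i)) * exp (\<omega>' * ?\<delta> i))"
        proof -
          have "- c * (x / \<epsilon>) = - ((c / \<epsilon> + \<omega>') * x) + \<omega>' * x" for x by (simp add: algebra_simps)
          then show ?thesis by (simp only: exp_add)
        qed
        \<comment> \<open>The dwell time enters here: the exponent is at least
          \<open>y = c / (2 * \<epsilon>) * \<tau>\<close>, and \<open>exp (- y) \<le> 1 / y\<close>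
          turns decay into a factor \<open>\<epsilon>\<close>.\<close>
        also have "\<dots> \<le> C1 * (2 / (c * \<tau>) * \<epsilon> * exp (\<omega>' * ?\<delta> i))"
        proof (intro mult_left_mono mult_right_mono)
          have "c / (2 * \<epsilon>) * \<tau> \<le> (c / \<epsilon> + \<omega>') * ?\<delta> i"
            using rate dw[OF i] \<tau> c \<epsilon>(1) order_trans[OF _ rate, of 0] by (intro mult_mono) auto
          then have "c / (2 * \<epsilon>) * \<tau> \<le> exp ((c / \<epsilon> + \<omega>') * ?\<delta> i)"
            using exp_ge_add_one_self[of "(c / \<epsilon> + \<omega>') * ?\<delta> i"] by linarith
          moreover have "0 < c / (2 * \<epsilon>) * \<tau>" using c \<tau> \<epsilon>(1) by simp
          ultimately have "inverse (exp ((c / \<epsilon> + \<omega>') * ?\<delta> i)) \<le> inverse (c / (2 * \<epsilon>) * \<tau>)"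
            by (intro le_imp_inverse_le)
          also have "inverse (c / (2 * \<epsilon>) * \<tau>) = 2 / (c * \<tau>) * \<epsilon>"
            using c \<tau> \<epsilon>(1) by (simp add: field_simps)
          finally show "exp (- ((c / \<epsilon> + \<omega>') * ?\<delta> i)) \<le> 2 / (c * \<tau>) * \<epsilon>" by (simp only: exp_minus)
        qed (use c in auto)
        finally have n3: "norm (exp ((?\<delta> i / \<epsilon>) *\<^sub>R eD (z i)) * q (z i)) \<le> 2 * C1 / (c * \<tau>) * \<epsilon> * exp (\<omega>' * ?\<delta> i)"
          by (simp add: mult_ac)
        have "p (z i) * ?z + q (z i) * ?z = ?z"
          using e_sing_flow[OF \<sigma>] by (simp add: e_split[OF \<sigma>] distrib_right)
        moreover have "?W i - ?U i = Jt z i * (?z - exp (?\<delta> i *\<^sub>R eM (z i)) * p (z i))"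
          by (simp only: right_diff_distrib)
        moreover have "x + y - X = (x - X) + ((y - Y) + Y)" for x y X Y :: bop by simp
        ultimately have split: "?W i - ?U i = Jt z i * ((p (z i) * ?z - exp (?\<delta> i *\<^sub>R eM (z i)) * p (z i)) +
          ((q (z i) * ?z - exp ((?\<delta> i / \<epsilon>) *\<^sub>R eD (z i)) * q (z i)) + exp ((?\<delta> i / \<epsilon>) *\<^sub>R eD (z i)) * q (z i)))"
          by metis
        have "norm (?W i - ?U i) \<le> (b * b * b) * (C * \<epsilon> * exp (\<omega>' * ?\<delta> i) + (C * \<epsilon> * exp (\<omega>' * ?\<delta> i) + 2 * C1 / (c * \<tau>) * \<epsilon> * exp (\<omega>' * ?\<delta> i)))"
          unfolding split by (rule order_trans[OF norm_mult_ineq mult_mono[OF J[OF i] order_trans[OF norm_triangle_ineq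
            add_mono[OF n1 order_trans[OF norm_triangle_ineq add_mono[OF n2 n3]]]]]]) (use b in auto)
        also have "\<dots> = k5 * \<epsilon> * exp (\<omega>' * ?\<delta> i)"
        proof -
          have "a * (C * \<epsilon> * X + (C * \<epsilon> * X + u * \<epsilon> * X)) = a * (2 * C + u) * \<epsilon> * X" for a u X
            by (simp add: ring_distribs mult.assoc)
          then show ?thesis unfolding k5_def .
        qed
        finally show "norm (?W i - ?U i) \<le> k5 * \<epsilon> * exp (\<omega>' * ?\<delta> i)" .
      qed (use k5 \<epsilon> in auto)
      also have "\<dots> \<le> L * (\<Prod>i<k. exp (\<omega>' * ?\<delta> i))"
      proof (intro mult_left_mono prod_mono conjI)
        fix i assume "i \<in> {..<k}"
        then have i: "i < k" by simp
        show "0 \<le> exp (\<omega> * ?\<delta> i) + L * (k5 * \<epsilon> * exp (\<omega>' * ?\<delta> i))"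
          using L k5 \<epsilon> by (intro add_nonneg_nonneg mult_nonneg_nonneg) auto
        have "exp (\<omega> * ?\<delta> i) = exp (- (\<omega>' - \<omega>) * ?\<delta> i) * exp (\<omega>' * ?\<delta> i)"
          by (simp add: exp_add[symmetric] algebra_simps)
        also have "\<dots> \<le> exp (- (\<omega>' - \<omega>) * \<tau>) * exp (\<omega>' * ?\<delta> i)"
          using dw[OF i] \<omega> by (intro mult_right_mono) auto
        finally have "exp (\<omega> * ?\<delta> i) + L * (k5 * \<epsilon> * exp (\<omega>' * ?\<delta> i)) \<le> (exp (- (\<omega>' - \<omega>) * \<tau>) + L * k5 * \<epsilon>) * exp (\<omega>' * ?\<delta> i)"
          by (simp add: algebra_simps)
        also have "\<dots> \<le> 1 * exp (\<omega>' * ?\<delta> i)"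
          using \<epsilon>3 by (intro mult_right_mono) auto
        finally show "exp (\<omega> * ?\<delta> i) + L * (k5 * \<epsilon> * exp (\<omega>' * ?\<delta> i)) \<le> exp (\<omega>' * ?\<delta> i)" by simp
      qed (use L in simp)
      also have "(\<Prod>i<k. exp (\<omega>' * ?\<delta> i)) = exp (\<omega>' * (t k - t 0))"
        using prod_exp_increments[of \<omega>' t 0 k] by (simp add: lessThan_atLeast0)
      also have "t 0 = 0" using sg by (simp add: signal_def)
      finally show ?thesis by simp
    qed
    show "opnorm (flow r s) \<le> real (d * d) * (b * C * L * b) * exp (\<omega>' * s)"
      unfolding r_eq
      by (rule eps_flow_bound[OF sg \<epsilon>(1) s]) (use b C(2) C(3)[OF \<epsilon>(1) \<epsilon>1] W L in auto)
  qed
qed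

section \<open>Arbitrary switching and the hat system\<close>

definition hat_step :: "(nat \<Rightarrow> real) \<Rightarrow> (nat \<Rightarrow> mode) \<Rightarrow> nat \<Rightarrow> bop" where
  "hat_step t z i = Jt z i * (exp ((t (Suc i) - t i) *\<^sub>R eD (z i)) * e)"

text \<open>Since \<open>eD \<sigma> * p \<sigma> = 0\<close>, the slow part is frozen under the
  fast flow.\<close>

lemma exp_eD_p:
  assumes "\<sigma> \<in> K"
  shows "exp (x *\<^sub>R eD \<sigma>) * p \<sigma> = p \<sigma>"
proof -
  have "eD \<sigma> * q \<sigma> * p \<sigma> = 0" by (simp add: mult.assoc pq[OF assms])
  then have "p \<sigma> * 0 = eD \<sigma> * p \<sigma>" by (simp add: corners[OF assms])
  from exp_intertwine_scaleR[OF this, of x] show ?thesis by simp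
qed

lemma e_Jt: "z (Suc i) \<in> K \<Longrightarrow> e * Jt z i = Jt z i"
  unfolding Jt_def by (simp add: mult.assoc[symmetric] eT_inverses)

lemma Jt_e: "z i \<in> K \<Longrightarrow> Jt z i * e = Jt z i"
  unfolding Jt_def by (simp add: mult.assoc eT_inverses)

lemma hat_decay:
  assumes "lyap_sw (sys_hat K) < 0"
  obtains \<delta> s0 where "0 < \<delta>" "0 < s0"
    "\<And>n t z. \<lbrakk>signal K 0 (enat n) t z; 1 \<le> n; s0 \<le> t n\<rbrakk> \<Longrightarrow>
       norm (oprod (hat_step t z) 0 n) \<le> real (d * d) * exp (- \<delta> * t n)"
proof -
  from lyap_sw_negD[OF assms] obtain \<delta> s0 where \<delta>: "0 < \<delta>" "0 < s0" and
    dec: "\<And>r k. r \<in> sys_hat K \<Longrightarrow> 1 \<le> k \<Longrightarrow> enat k \<le> fst r \<Longrightarrow> s0 \<le> fst (snd r) k \<Longrightarrow>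
       opnorm (flow r (fst (snd r) k)) \<le> exp (- \<delta> * fst (snd r) k)"
    by blast
  show thesis
  proof (rule that[OF \<delta>])
    fix n t z assume sg: "signal K 0 (enat n) t z" and n: "1 \<le> n" and tn: "s0 \<le> t n"
    note hf = hat_flow_emb[OF sg]
    obtain n' where n': "n = Suc n'" using n by (cases n) auto
    have z: "z 0 \<in> K" "z n \<in> K" using signal_mode_in[OF sg] by auto
    have eq: "e * (oprod (hat_step t z) 0 n * e) = oprod (hat_step t z) 0 n"
    proof -
      have "e * oprod (hat_step t z) 0 n = oprod (hat_step t z) 0 n"
        using z unfolding n' by (simp add: hat_step_def mult.assoc[symmetric] e_Jt)
      moreover have "oprod (hat_step t z) 0 n * e = oprod (hat_step t z) 0 n"
        unfolding n' oprod_Suc_right by (simp add: hat_step_def mult.assoc pj_idem)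
      ultimately show ?thesis by simp
    qed
    let ?r = "(enat n, t,
      \<lambda>k. four_block_mat (0\<^sub>m (ml (z k)) (ml (z k))) (0\<^sub>m (ml (z k)) (mdim (z k) - ml (z k)))
                         (0\<^sub>m (mdim (z k) - ml (z k)) (ml (z k))) (bD (z k)),
      \<lambda>k. Tm (z (Suc k)) * mR (z k) * minv (Tm (z k)))"
    have "norm (oprod (hat_step t z) 0 n) \<le> real (d * d) * opnorm (flow ?r (t n))"
      using emb_le_opnorm_d[of "flow ?r (t n)"] hf(2,3) eq by (simp add: hat_step_def[abs_def])
    also have "\<dots> \<le> real (d * d) * exp (- \<delta> * t n)"
      using dec[OF hf(1) n] tn by (intro mult_left_mono) auto
    finally show "norm (oprod (hat_step t z) 0 n) \<le> real (d * d) * exp (- \<delta> * t n)" .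
  qed
qed

text \<open>A single switch after an arbitrarily long first interval already has to be contracted at an
  exponential rate, although the slow part of the state is not damped at all by the hat system. Hence the jumps
  annihilate the slow part.\<close>

lemma jump_kills_slow:
  assumes "lyap_sw (sys_hat K) < 0" and K: "z i \<in> K" "z (Suc i) \<in> K" "z (Suc i) \<noteq> z i"
  shows "Jt z i * p (z i) = 0"
proof -
  obtain \<delta> s0 where \<delta>: "0 < \<delta>" "0 < s0" and
    dec: "\<And>n t z. \<lbrakk>signal K 0 (enat n) t z; 1 \<le> n; s0 \<le> t n\<rbrakk> \<Longrightarrow>
       norm (oprod (hat_step t z) 0 n) \<le> real (d * d) * exp (- \<delta> * t n)"
    by (rule hat_decay[OF assms(1)]) blast
  have le: "norm (Jt z i * p (z i)) \<le> real (d * d) * norm (p (z i)) * exp (- \<delta> * s)" if s: "s0 \<le> s" for s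
  proof -
    \<comment> \<open>A signal with one switch at the arbitrary time \<open>s\<close>, from
      \<open>z i\<close> to \<open>z (Suc i)\<close>; it is admissible because these modes
      differ.\<close>
    let ?t = "\<lambda>k. real k * s" and ?z = "\<lambda>k. z (i + k)"
    have "signal K 0 (enat 1) ?t ?z"
      unfolding signal_def using K \<delta> s
      by (auto simp: le_Suc_eq less_Suc_eq one_enat_def)
    from dec[OF this] have 1: "norm (Jt z i * (exp (s *\<^sub>R eD (z i)) * e)) \<le> real (d * d) * exp (- \<delta> * s)"
      using s by (simp add: hat_step_def Jt_def)
    have "Jt z i * p (z i) = Jt z i * (exp (s *\<^sub>R eD (z i)) * e) * p (z i)"
    proof -
      have "e * p (z i) = p (z i)" by (simp add: e_split[OF K(1)] distrib_right pq[OF K(1)])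
      then show ?thesis by (simp add: mult.assoc exp_eD_p[OF K(1)])
    qed
    also have "norm \<dots> \<le> norm (Jt z i * (exp (s *\<^sub>R eD (z i)) * e)) * norm (p (z i))"
      by (rule norm_mult_ineq)
    also have "\<dots> \<le> real (d * d) * exp (- \<delta> * s) * norm (p (z i))"
      by (rule mult_right_mono[OF 1]) simp
    finally show ?thesis by (simp add: mult_ac)
  qed
  have "((\<lambda>s. real (d * d) * norm (p (z i)) * exp (- \<delta> * s)) \<longlongrightarrow> real (d * d) * norm (p (z i)) * 0) at_top"
    by (intro tendsto_intros filterlim_compose[OF exp_at_bot]
      filterlim_tendsto_neg_mult_at_bot[OF tendsto_const _ filterlim_ident]) (use \<delta> in simp)
  then have "norm (Jt z i * p (z i)) \<le> real (d * d) * norm (p (z i)) * 0"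
    by (rule tendsto_lowerbound) (use le in \<open>auto intro: eventually_at_top_linorderI[of s0]\<close>)
  then show ?thesis by simp
qed

text \<open>Since the slow part of the initial state is irrelevant, a short signal can be compared with the one
  whose first interval is prolonged by \<open>s0\<close>.\<close>

lemma hat_uniform_decay:
  assumes neg: "lyap_sw (sys_hat K) < 0"
  obtains \<delta> C where "0 < \<delta>" "1 \<le> C"
    "\<And>n t z. signal K 0 (enat n) t z \<Longrightarrow> norm (oprod (hat_step t z) 0 n) \<le> C * exp (- \<delta> * t n)"
proof -
  obtain b where b: "1 \<le> b" "\<And>\<sigma>. \<sigma> \<in> K \<Longrightarrow> norm (q \<sigma>) \<le> b" "\<And>\<sigma>. \<sigma> \<in> K \<Longrightarrow> norm (eD \<sigma>) \<le> b"
    by (rule uniform_bound) blast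
  obtain \<delta> s0 where \<delta>: "0 < \<delta>" "0 < s0" and
    dec: "\<And>n t z. \<lbrakk>signal K 0 (enat n) t z; 1 \<le> n; s0 \<le> t n\<rbrakk> \<Longrightarrow>
       norm (oprod (hat_step t z) 0 n) \<le> real (d * d) * exp (- \<delta> * t n)"
    by (rule hat_decay[OF neg]) blast
  \<comment> \<open>The 1 covers the empty product; \<open>exp (s0 * b) * b\<close> is the cost of
    undoing a prolongation by \<open>s0\<close> on the fast part.\<close>
  define C where "C = max 1 (real (d * d) * (exp (s0 * b) * b))"
  show thesis
  proof (rule that[OF \<delta>(1), of C])
    show "1 \<le> C" by (simp add: C_def)
    fix n t z assume sg: "signal K 0 (enat n) t z"
    have t0: "t 0 = 0" using sg by (simp add: signal_def)
    show "norm (oprod (hat_step t z) 0 n) \<le> C * exp (- \<delta> * t n)"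
    proof (cases n)
      case 0
      then show ?thesis by (simp add: t0 C_def)
    next
      case (Suc n')
      \<comment> \<open>All switches are delayed by \<open>s0\<close>, so only the first interval
        changes length and \<open>t' n\<close> reaches the range where the decay is known.\<close>
      define t' where "t' i = (if i = 0 then 0 else t i + s0)" for i
      have sg': "signal K 0 (enat n) t' z"
        using sg \<delta>(2) t0 unfolding signal_def t'_def by force
      have zK: "z i \<in> K" if "i \<le> n" for i using signal_mode_in[OF sg] that by simp
      have kill: "Jt z 0 * p (z 0) = 0"
        using zK[of 0] zK[of "Suc 0"] sg Suc by (intro jump_kills_slow[OF neg]) (auto simp: signal_def zero_enat_def)
      let ?E = "\<lambda>x. exp (x *\<^sub>R eD (z 0))"
      note z0 = zK[of 0, simplified]
      have tail: "oprod (hat_step t z) (Suc 0) n' = oprod (hat_step t' z) (Suc 0) n'"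
        by (rule oprod_cong) (simp add: hat_step_def t'_def)
      have qE: "q (z 0) * ?E x = ?E x * q (z 0)" "e * ?E x = ?E x * e" for x
      proof -
        have "e * eD (z 0) = eD (z 0) * e"
          using block_facts(4)[OF z0] e_split[OF z0] pq[OF z0] corners[OF z0]
          by (metis (no_types, lifting) add_0 distrib_left distrib_right mult.assoc mult_zero_left mult_zero_right)
        then show "e * ?E x = ?E x * e" by (rule exp_intertwine_scaleR)
        show "q (z 0) * ?E x = ?E x * q (z 0)" by (rule exp_intertwine_scaleR) (simp add: corners[OF z0])
      qed
      have eq: "e * q (z 0) = q (z 0)" by (simp add: e_split[OF z0] distrib_right pq[OF z0])
      have eEq: "e * (?E x * q (z 0)) = ?E x * q (z 0)" for x
        by (simp only: mult.assoc[symmetric] qE(2)) (simp only: mult.assoc eq)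
      have "hat_step t z 0 = Jt z 0 * ?E (t 1) * p (z 0) + Jt z 0 * ?E (t 1) * q (z 0)"
        by (simp add: hat_step_def t0 e_split[OF z0] distrib_left mult.assoc)
      also have "Jt z 0 * ?E (t 1) * p (z 0) = 0" by (simp add: mult.assoc exp_eD_p[OF z0] kill)
      \<comment> \<open>The prolongation is compensated by the inverse fast flow
        \<open>?E (- s0)\<close>. This is possible because the slow summand has just been
        annihilated by the jump and the rest lies in the range of \<open>q\<close>.\<close>
      also have "Jt z 0 * ?E (t 1) * q (z 0) = Jt z 0 * (?E (t 1 + s0) * ?E (- s0)) * q (z 0)"
        by (simp only: exp_scaleR_add[symmetric]) simp
      also have "\<dots> = hat_step t' z 0 * (?E (- s0) * q (z 0))"
        by (simp add: hat_step_def t'_def mult.assoc eEq[of "- s0", simplified])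
      finally have first: "hat_step t z 0 = hat_step t' z 0 * (?E (- s0) * q (z 0))" by simp
      have "oprod (hat_step t z) 0 n = oprod (hat_step t' z) 0 n * (?E (- s0) * q (z 0))"
        unfolding Suc oprod_Suc_right tail first by (simp add: mult.assoc)
      also have "norm \<dots> \<le> norm (oprod (hat_step t' z) 0 n) * norm (?E (- s0) * q (z 0))"
        by (rule norm_mult_ineq)
      also have "\<dots> \<le> (real (d * d) * exp (- \<delta> * t n)) * (exp (s0 * b) * b)"
      proof (rule mult_mono)
        have tn: "0 \<le> t n" using signal_mono[OF sg, of 0 n] t0 by simp
        have "norm (oprod (hat_step t' z) 0 n) \<le> real (d * d) * exp (- \<delta> * t' n)"
          using Suc tn by (intro dec[OF sg']) (auto simp: t'_def)
        also have "\<dots> \<le> real (d * d) * exp (- \<delta> * t n)"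
          using Suc \<delta> by (intro mult_left_mono) (auto simp: t'_def)
        finally show "norm (oprod (hat_step t' z) 0 n) \<le> real (d * d) * exp (- \<delta> * t n)" .
        have "norm (?E (- s0)) \<le> exp (norm ((- s0) *\<^sub>R eD (z 0)))" by (rule norm_exp)
        also have "\<dots> \<le> exp (s0 * b)" using b(3)[OF z0] \<delta> by simp
        finally show "norm (?E (- s0) * q (z 0)) \<le> exp (s0 * b) * b"
          using b(2)[OF z0] by (intro order_trans[OF norm_mult_ineq] mult_mono) auto
      qed auto
      also have "\<dots> \<le> C * exp (- \<delta> * t n)"
        unfolding C_def using mult_right_mono[OF max.cobounded2[of "real (d * d) * (exp (s0 * b) * b)" 1], of "exp (- \<delta> * t n)"]
        by (simp add: mult_ac)
      finally show ?thesis .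
    qed
  qed
qed

text \<open>The comparison products are those of the hat system run at speed
  \<open>1 / \<epsilon>\<close>. As every jump annihilates the slow row, only the fast error
  \<open>O(min \<epsilon> t)\<close> enters. In fast time this is at most a multiple of
  \<open>\<epsilon> * min 1 x\<close>, while the hat factor leaves a margin
  \<open>1 - exp (- \<delta> * x / 2)\<close>. The rate \<open>\<omega>'\<close> is carried by the
  last interval, after which no jump has occurred.\<close>

lemma fast_switching_bound:
  assumes neg: "lyap_sw (sys_hat K) < 0" and \<omega>: "\<omega> < \<omega>'"
    and slow: "\<And>\<sigma> t. \<sigma> \<in> K \<Longrightarrow> 0 \<le> t \<Longrightarrow> norm (exp (t *\<^sub>R eM \<sigma>) * p \<sigma>) \<le> C0 * exp (\<omega> * t)"
  obtains \<epsilon>0 C where "0 < \<epsilon>0"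
    "\<And>\<epsilon> r s. \<lbrakk>0 < \<epsilon>; \<epsilon> < \<epsilon>0; r \<in> sys_eps K 0 \<epsilon>; 0 \<le> s\<rbrakk> \<Longrightarrow> opnorm (flow r s) \<le> C * exp (\<omega>' * s)"
proof -
  obtain b where b: "1 \<le> b"
    "\<And>\<sigma>. \<sigma> \<in> K \<Longrightarrow> norm (eT \<sigma>) \<le> b"
    "\<And>\<sigma>. \<sigma> \<in> K \<Longrightarrow> norm (eTi \<sigma>) \<le> b" "\<And>\<sigma>. \<sigma> \<in> K \<Longrightarrow> norm (eR \<sigma>) \<le> b"
    by (rule uniform_bound) blast
  obtain \<delta> L where \<delta>: "0 < \<delta>" and L: "1 \<le> L" and
    hat: "\<And>n t z. signal K 0 (enat n) t z \<Longrightarrow> norm (oprod (hat_step t z) 0 n) \<le> L * exp (- \<delta> * t n)"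
    by (rule hat_uniform_decay[OF neg]) blast
  obtain \<epsilon>1 C where C: "0 < \<epsilon>1" "1 \<le> C"
    "\<And>\<epsilon> \<sigma> t. \<lbrakk>0 < \<epsilon>; \<epsilon> < \<epsilon>1; \<sigma> \<in> K; 0 \<le> t\<rbrakk> \<Longrightarrow> norm (sing_flow \<epsilon> \<sigma> t) \<le> C * exp (\<omega>' * t)"
    "\<And>\<epsilon> \<sigma> t. \<lbrakk>0 < \<epsilon>; \<epsilon> < \<epsilon>1; \<sigma> \<in> K; 0 \<le> t\<rbrakk> \<Longrightarrow>
       norm (q \<sigma> * sing_flow \<epsilon> \<sigma> t - exp ((t / \<epsilon>) *\<^sub>R eD \<sigma>) * q \<sigma>) \<le> C * min \<epsilon> t * exp (\<omega>' * t)"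
    by (rule sing_flow_estimates[OF slow \<omega>]) blast+
  define k6 where "k6 = b * b * b * C"
  \<comment> \<open>By \<open>min_div_le_one_minus_exp\<close> with
    \<open>y = \<delta> / 2 * x\<close>, the product \<open>\<mu> * min 1 x\<close> stays below the
    margin \<open>1 - exp (- (\<delta> / 2 * x))\<close>.\<close>
  define \<mu> where "\<mu> = min 1 (\<delta> / 2) / 2"
  define \<epsilon>0 where "\<epsilon>0 = min \<epsilon>1 (min (\<delta> / 2 / (\<bar>\<omega>'\<bar> + 1)) (\<mu> / (L * k6)))"
  have k6: "0 < k6" unfolding k6_def using b(1) C(2) by (intro mult_pos_pos) auto
  have \<mu>: "0 < \<mu>" unfolding \<mu>_def using \<delta> by simp
  show thesis
  proof (rule that[of \<epsilon>0 "real (d * d) * (b * C * L * b)"])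
    show "0 < \<epsilon>0" unfolding \<epsilon>0_def min_less_iff_conj using C(1) \<delta> L k6 \<mu> by (intro conjI divide_pos_pos) auto
    fix \<epsilon> r s assume \<epsilon>: "0 < \<epsilon>" "\<epsilon> < \<epsilon>0" and r: "r \<in> sys_eps K 0 \<epsilon>" and s: "0 \<le> (s::real)"
    have \<epsilon>1: "\<epsilon> < \<epsilon>1" using \<epsilon> by (simp add: \<epsilon>0_def)
    \<comment> \<open>Even a strongly negative \<open>\<omega>'\<close> is beaten by the hat decay:
      half of \<open>\<delta> / \<epsilon>\<close> remains after comparison with it.\<close>
    have rate: "\<delta> / (2 * \<epsilon>) \<le> \<delta> / \<epsilon> + \<omega>'"
    proof -
      have "\<epsilon> \<le> \<delta> / 2 / (\<bar>\<omega>'\<bar> + 1)" using \<epsilon> by (simp add: \<epsilon>0_def)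
      moreover have "0 < \<bar>\<omega>'\<bar> + 1" by simp
      ultimately have "\<epsilon> * (\<bar>\<omega>'\<bar> + 1) \<le> \<delta> / 2" by (simp only: pos_le_divide_eq)
      then have "\<epsilon> * \<bar>\<omega>'\<bar> \<le> \<delta> / 2" using \<epsilon>(1) by (simp add: distrib_left)
      then have "\<bar>\<omega>'\<bar> \<le> \<delta> / (2 * \<epsilon>)" using \<epsilon>(1) by (simp add: field_simps)
      moreover have "\<delta> / \<epsilon> = \<delta> / (2 * \<epsilon>) + \<delta> / (2 * \<epsilon>)" by simp
      ultimately show ?thesis by linarith
    qed
    have \<epsilon>3: "L * k6 * \<epsilon> \<le> \<mu>"
    proof -
      have "\<epsilon> \<le> \<mu> / (L * k6)" using \<epsilon> by (simp add: \<epsilon>0_def)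
      moreover have "0 < L * k6" using L k6 by simp
      ultimately have "\<epsilon> * (L * k6) \<le> \<mu>" by (simp only: pos_le_divide_eq)
      then show ?thesis by (simp add: mult_ac)
    qed
    obtain m t z where r_eq: "r = (m, t, \<lambda>k. gen \<epsilon> (z k), \<lambda>k. mR (z k))" and sg: "signal K 0 m t z"
      using r unfolding sys_eps_def by blast
    let ?\<delta> = "\<lambda>i. t (Suc i) - t i"
    let ?W = "\<lambda>i. Jt z i * sing_flow \<epsilon> (z i) (?\<delta> i)"
    \<comment> \<open>The hat system evolves with generator \<open>D\<close>, the fast row with
      \<open>D / \<epsilon>\<close>; dividing the switching times by \<open>\<epsilon>\<close>
      matches the two.\<close>
    let ?U = "hat_step (\<lambda>i. t i / \<epsilon>) z"
    have W: "norm (oprod ?W 0 k) \<le> L * exp (\<omega>' * t k)" if k: "enat k \<le> m" for k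
    proof -
      have zK: "z i \<in> K" if "i \<le> k" for i
        using signal_mode_in[OF sg] k that by (meson enat_ord_simps(1) order_trans)
      have dw: "0 < ?\<delta> i" "z (Suc i) \<noteq> z i" if "i < k" for i
      proof -
        have "enat (Suc i) \<le> m" using k that by (meson Suc_leI enat_ord_simps(1) order_trans)
        then show "0 < ?\<delta> i" "z (Suc i) \<noteq> z i" using sg unfolding signal_def by auto
      qed
      have J: "norm (Jt z i) \<le> b * b * b" if "i < k" for i
        using b zK that by (intro norm_Jt) auto
      have "norm (oprod ?W 0 k) \<le> L * (\<Prod>i<k. exp (- (\<delta> / \<epsilon>) * ?\<delta> i) + L * (k6 * min \<epsilon> (?\<delta> i) * exp (\<omega>' * ?\<delta> i)))"
      proof (rule oprod_perturbation[OF L])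
        fix j n assume jn: "j + n \<le> k"
        have le: "enat (j + n) \<le> m" by (rule order_trans[OF _ k]) (use jn in simp)
        have sg': "signal K 0 (enat n) (\<lambda>i. (t (j + i) - t j) / \<epsilon>) (\<lambda>i. z (j + i))"
          using signal_segment[OF sg le] \<epsilon>(1) unfolding signal_def
          by (auto simp: divide_right_mono divide_strict_right_mono diff_divide_distrib[symmetric])
        have "oprod ?U j n = oprod (hat_step (\<lambda>i. (t (j + i) - t j) / \<epsilon>) (\<lambda>i. z (j + i))) 0 n"
          by (subst oprod_shift) (simp add: hat_step_def[abs_def] Jt_def diff_divide_distrib[symmetric])
        then have "norm (oprod ?U j n) \<le> L * exp (- \<delta> * ((t (j + n) - t j) / \<epsilon>))"
          using hat[OF sg'] by simp
        also have "- \<delta> * ((t (j + n) - t j) / \<epsilon>) = - (\<delta> / \<epsilon>) * (t (j + n) - t j)" by simp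
        finally show "norm (oprod ?U j n) \<le> L * (\<Prod>i=j..<j+n. exp (- (\<delta> / \<epsilon>) * ?\<delta> i))"
          by (simp only: prod_exp_increments)
      next
        fix i assume i: "i < k"
        note \<sigma> = zK[OF less_imp_le[OF i]]
        have \<sigma>': "z (Suc i) \<in> K" using zK[of "Suc i"] i by simp
        let ?z = "sing_flow \<epsilon> (z i) (?\<delta> i)" and ?E = "exp ((?\<delta> i / \<epsilon>) *\<^sub>R eD (z i))"
        have kill: "Jt z i * p (z i) = 0"
          by (rule jump_kills_slow[OF neg \<sigma> \<sigma>' dw(2)[OF i]])
        \<comment> \<open>Inserting \<open>e = p + q\<close> in front of the flow and discarding the
          killed part leaves the fast row alone, so the slow error, which is only
          \<open>O(\<epsilon>)\<close> on short intervals, never appears.\<close>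
        have "Jt z i * ?z = Jt z i * e * ?z" by (simp only: Jt_e[of z i, OF \<sigma>])
        also have "\<dots> = Jt z i * (q (z i) * ?z)"
          by (simp add: e_split[OF \<sigma>] distrib_left kill mult.assoc)
        finally have 1: "Jt z i * ?z = Jt z i * (q (z i) * ?z)" .
        have "Jt z i * (?E * e) = Jt z i * (?E * q (z i))"
          by (simp add: e_split[OF \<sigma>] distrib_left exp_eD_p[OF \<sigma>] kill)
        then have split: "?W i - ?U i = Jt z i * (q (z i) * ?z - ?E * q (z i))"
          unfolding 1 hat_step_def by (simp add: right_diff_distrib diff_divide_distrib[symmetric])
        have "norm (?W i - ?U i) \<le> (b * b * b) * (C * min \<epsilon> (?\<delta> i) * exp (\<omega>' * ?\<delta> i))"
          unfolding split by (rule order_trans[OF norm_mult_ineq mult_mono[OF J[OF i] C(4)[OF \<epsilon>(1) \<epsilon>1 \<sigma>]]])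
            (use b dw(1)[OF i] in auto)
        then show "norm (?W i - ?U i) \<le> k6 * min \<epsilon> (?\<delta> i) * exp (\<omega>' * ?\<delta> i)"
          by (simp add: k6_def mult.assoc)
      next
        fix i assume i: "i < k"
        show "0 \<le> k6 * min \<epsilon> (?\<delta> i) * exp (\<omega>' * ?\<delta> i)"
          using k6 \<epsilon>(1) dw(1)[OF i] by (intro mult_nonneg_nonneg) auto
      qed simp
      also have "\<dots> \<le> L * (\<Prod>i<k. exp (\<omega>' * ?\<delta> i))"
      proof (intro mult_left_mono prod_mono conjI)
        fix i assume "i \<in> {..<k}"
        then have i: "i < k" by simp
        have min0: "0 \<le> min \<epsilon> (?\<delta> i)" using \<epsilon>(1) dw(1)[OF i] by simp
        show "0 \<le> exp (- (\<delta> / \<epsilon>) * ?\<delta> i) + L * (k6 * min \<epsilon> (?\<delta> i) * exp (\<omega>' * ?\<delta> i))"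
          using L k6 min0 by (intro add_nonneg_nonneg mult_nonneg_nonneg) auto
        \<comment> \<open>Fast time. Here
          \<open>min \<epsilon> (\<epsilon> * x) = \<epsilon> * min 1 x\<close>, so error and margin
          are compared as functions of \<open>x\<close> alone.\<close>
        define x where "x = ?\<delta> i / \<epsilon>"
        have x: "0 < x" "?\<delta> i = \<epsilon> * x" using \<epsilon>(1) dw(1)[OF i] by (auto simp: x_def)
        have split: "exp (- (\<delta> / \<epsilon>) * ?\<delta> i) = exp (- ((\<delta> / \<epsilon> + \<omega>') * ?\<delta> i)) * exp (\<omega>' * ?\<delta> i)"
        proof -
          have "- (\<delta> / \<epsilon>) * y = - ((\<delta> / \<epsilon> + \<omega>') * y) + \<omega>' * y" for y by (simp add: algebra_simps)
          then show ?thesis by (simp only: exp_add)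
        qed
        have "exp (- ((\<delta> / \<epsilon> + \<omega>') * ?\<delta> i)) \<le> exp (- (\<delta> / 2 * x))"
        proof -
          have "\<delta> / 2 * x = \<delta> / (2 * \<epsilon>) * ?\<delta> i" using \<epsilon>(1) by (simp add: x_def)
          also have "\<dots> \<le> (\<delta> / \<epsilon> + \<omega>') * ?\<delta> i" by (rule mult_right_mono[OF rate]) (use dw(1)[OF i] in simp)
          finally show ?thesis by simp
        qed
        moreover have "L * k6 * min \<epsilon> (?\<delta> i) \<le> 1 - exp (- (\<delta> / 2 * x))"
        proof -
          have "min \<epsilon> (?\<delta> i) = \<epsilon> * min 1 x" unfolding x(2) using \<epsilon>(1) by (auto simp: min_def)
          then have "L * k6 * min \<epsilon> (?\<delta> i) = (L * k6 * \<epsilon>) * min 1 x" by simp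
          also have "\<dots> \<le> \<mu> * min 1 x" using \<epsilon>3 x(1) by (intro mult_right_mono) auto
          also have "\<dots> = (min 1 (\<delta> / 2) * min 1 x) / 2" by (simp add: \<mu>_def)
          also have "\<dots> \<le> min 1 (\<delta> / 2 * x) / 2"
          proof (rule divide_right_mono)
            have "min 1 (\<delta> / 2) * min 1 x \<le> 1 * 1" using x(1) \<delta> by (intro mult_mono) auto
            moreover have "min 1 (\<delta> / 2) * min 1 x \<le> (\<delta> / 2) * x" using x(1) \<delta> by (intro mult_mono) auto
            ultimately show "min 1 (\<delta> / 2) * min 1 x \<le> min 1 (\<delta> / 2 * x)" by simp
          qed simp
          also have "\<dots> \<le> 1 - exp (- (\<delta> / 2 * x))"
            by (rule min_div_le_one_minus_exp) (use x(1) \<delta> in simp)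
          finally show ?thesis .
        qed
        ultimately have "exp (- ((\<delta> / \<epsilon> + \<omega>') * ?\<delta> i)) + L * k6 * min \<epsilon> (?\<delta> i) \<le> 1" by linarith
        from mult_right_mono[OF this, of "exp (\<omega>' * ?\<delta> i)"]
        show "exp (- (\<delta> / \<epsilon>) * ?\<delta> i) + L * (k6 * min \<epsilon> (?\<delta> i) * exp (\<omega>' * ?\<delta> i)) \<le> exp (\<omega>' * ?\<delta> i)"
          unfolding split by (simp add: distrib_right mult.assoc)
      qed (use L in simp)
      also have "(\<Prod>i<k. exp (\<omega>' * ?\<delta> i)) = exp (\<omega>' * (t k - t 0))"
        using prod_exp_increments[of \<omega>' t 0 k] by (simp add: lessThan_atLeast0)
      also have "t 0 = 0" using sg by (simp add: signal_def)
      finally show ?thesis by simp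
    qed
    show "opnorm (flow r s) \<le> real (d * d) * (b * C * L * b) * exp (\<omega>' * s)"
      unfolding r_eq
      by (rule eps_flow_bound[OF sg \<epsilon>(1) s]) (use b C(2) C(3)[OF \<epsilon>(1) \<epsilon>1] W L in auto)
  qed
qed

section \<open>Growth bounds for all times from asymptotic exponents\<close>

lemma exp_eM_crude:
  assumes b: "1 \<le> b" "norm (eM \<sigma>) \<le> b" "norm (p \<sigma>) \<le> b" and t: "0 \<le> t"
  shows "norm (exp (t *\<^sub>R eM \<sigma>) * p \<sigma>) \<le> exp (b * t) * b"
proof -
  have "norm (exp (t *\<^sub>R eM \<sigma>)) \<le> exp (norm (t *\<^sub>R eM \<sigma>))" by (rule norm_exp)
  also have "\<dots> \<le> exp (b * t)" using t mult_right_mono[OF b(2) t] by (simp add: mult.commute)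
  finally show ?thesis using b by (intro order_trans[OF norm_mult_ineq] mult_mono) auto
qed

lemma slow_of_tilde:
  assumes lt: "lyap (sys_tilde d K) < ereal \<omega>"
  obtains C where "\<And>\<sigma> t. \<sigma> \<in> K \<Longrightarrow> 0 \<le> t \<Longrightarrow> norm (exp (t *\<^sub>R eM \<sigma>) * p \<sigma>) \<le> C * exp (\<omega> * t)"
proof -
  obtain s0 where s0: "0 < s0" "\<And>r s. r \<in> sys_tilde d K \<Longrightarrow> s0 \<le> s \<Longrightarrow> opnorm (flow r s) \<le> exp (\<omega> * s)"
    by (rule lyap_lessD[OF lt]) blast
  obtain b where b: "1 \<le> b" "\<And>\<sigma>. \<sigma> \<in> K \<Longrightarrow> norm (p \<sigma>) \<le> b" "\<And>\<sigma>. \<sigma> \<in> K \<Longrightarrow> norm (eM \<sigma>) \<le> b"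
    by (rule uniform_bound) blast
  \<comment> \<open>The exponent controls only \<open>t \<ge> s0\<close>. Before that the crude
    bound is used, and \<open>exp ((b + \<bar>\<omega>\<bar>) * s0)\<close> compensates
    \<open>exp (\<omega> * t)\<close> for either sign of \<open>\<omega>\<close>.\<close>
  define C where "C = max (real (d * d)) (b * exp ((b + \<bar>\<omega>\<bar>) * s0))"
  show thesis
  proof (rule that[of C])
    fix \<sigma> t assume \<sigma>: "\<sigma> \<in> K" and t: "0 \<le> (t::real)"
    show "norm (exp (t *\<^sub>R eM \<sigma>) * p \<sigma>) \<le> C * exp (\<omega> * t)"
    proof (cases "s0 \<le> t")
      case True
      obtain r where r: "r \<in> sys_tilde d K" "dim_row (flow r t) \<le> d" "dim_col (flow r t) \<le> d"
        "emb 0 0 (flow r t) = exp (t *\<^sub>R eM \<sigma>) * p \<sigma>"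
        by (rule tilde_const_flow_emb[OF \<sigma> t])
      have "norm (exp (t *\<^sub>R eM \<sigma>) * p \<sigma>) \<le> real (d * d) * opnorm (flow r t)"
        unfolding r(4)[symmetric] by (rule emb_le_opnorm_d[OF r(2,3)])
      also have "\<dots> \<le> C * exp (\<omega> * t)"
        using s0(2)[OF r(1) True] by (intro mult_mono) (auto simp: C_def opnorm_nonneg le_max_iff_disj)
      finally show ?thesis .
    next
      case False
      have "norm (exp (t *\<^sub>R eM \<sigma>) * p \<sigma>) \<le> exp (b * t) * b"
        using b \<sigma> t by (intro exp_eM_crude) auto
      also have "exp (b * t) \<le> exp ((b + \<bar>\<omega>\<bar>) * s0) * exp (\<omega> * t)"
      proof -
        have "(b + \<bar>\<omega>\<bar>) * t \<le> (b + \<bar>\<omega>\<bar>) * s0" using False b by (intro mult_left_mono) auto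
        moreover have "- \<omega> * t \<le> \<bar>\<omega>\<bar> * t" using t by (intro mult_right_mono) auto
        ultimately show ?thesis by (simp add: exp_add[symmetric] algebra_simps)
      qed
      also have "exp ((b + \<bar>\<omega>\<bar>) * s0) * exp (\<omega> * t) * b = (b * exp ((b + \<bar>\<omega>\<bar>) * s0)) * exp (\<omega> * t)" by simp
      also have "\<dots> \<le> C * exp (\<omega> * t)" unfolding C_def by (intro mult_right_mono) auto
      finally show ?thesis using b by (simp add: mult_right_mono)
    qed
  qed
qed

text \<open>Exponential stability already provides a bound from time 0 on, which passes to
  \<open>exp (t M)\<close> through the signal without switching.\<close>

lemma slow_of_tilde_ES:
  assumes bnd: "\<And>r s. r \<in> sys_tilde d K \<Longrightarrow> 0 \<le> s \<Longrightarrow> opnorm (flow r s) \<le> C * exp (\<omega> * s)"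
    and \<sigma>: "\<sigma> \<in> K" and t: "0 \<le> t"
  shows "norm (exp (t *\<^sub>R eM \<sigma>) * p \<sigma>) \<le> real (d * d) * C * exp (\<omega> * t)"
proof -
  obtain r where r: "r \<in> sys_tilde d K" "dim_row (flow r t) \<le> d" "dim_col (flow r t) \<le> d"
    "emb 0 0 (flow r t) = exp (t *\<^sub>R eM \<sigma>) * p \<sigma>"
    by (rule tilde_const_flow_emb[OF \<sigma> t])
  have "norm (exp (t *\<^sub>R eM \<sigma>) * p \<sigma>) \<le> real (d * d) * opnorm (flow r t)"
    unfolding r(4)[symmetric] by (rule emb_le_opnorm_d[OF r(2,3)])
  also have "\<dots> \<le> real (d * d) * (C * exp (\<omega> * t))"
    by (intro mult_left_mono bnd r t) simp
  finally show ?thesis by (simp add: mult.assoc)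
qed

text \<open>With a positive dwell time only boundedly many jumps occur before a given time, so that the
  asymptotic growth bound extends to all times.\<close>

lemma bar_bound_of_lyap:
  assumes \<tau>: "0 < \<tau>" and lt: "lyap (sys_bar K \<tau>) < ereal \<omega>"
  obtains C where "\<And>r s. r \<in> sys_bar K \<tau> \<Longrightarrow> 0 \<le> s \<Longrightarrow> opnorm (flow r s) \<le> C * exp (\<omega> * s)"
proof -
  obtain s0 where s0: "0 < s0" "\<And>r s. r \<in> sys_bar K \<tau> \<Longrightarrow> s0 \<le> s \<Longrightarrow> opnorm (flow r s) \<le> exp (\<omega> * s)"
    by (rule lyap_lessD[OF lt]) blast
  obtain b where b: "1 \<le> b" "\<And>\<sigma>. \<sigma> \<in> K \<Longrightarrow> norm (p \<sigma>) \<le> b" "\<And>\<sigma>. \<sigma> \<in> K \<Longrightarrow> norm (eM \<sigma>) \<le> b"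
    "\<And>\<sigma>. \<sigma> \<in> K \<Longrightarrow> norm (eT \<sigma>) \<le> b" "\<And>\<sigma>. \<sigma> \<in> K \<Longrightarrow> norm (eTi \<sigma>) \<le> b" "\<And>\<sigma>. \<sigma> \<in> K \<Longrightarrow> norm (eR \<sigma>) \<le> b"
    by (rule uniform_bound) blast
  \<comment> \<open>With dwell time \<open>\<tau>\<close>, at most this many switches occur before
    time \<open>s0\<close>.\<close>
  define N where "N = nat \<lfloor>s0 / \<tau>\<rfloor>"
  \<comment> \<open>Each completed interval with its jump costs \<open>b * b * b * b\<close>, the
    final interval and the initial projection \<open>b\<close> each. The exponential compensates
    \<open>exp (\<omega> * s)\<close> up to time \<open>s0\<close>.\<close>
  define C where "C = max 1 (real (d * d) * ((b * b * b * b) ^ N * (b * b)) * exp ((b + \<bar>\<omega>\<bar>) * s0))"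
  show thesis
  proof (rule that[of C])
    fix r s assume r: "r \<in> sys_bar K \<tau>" and s: "0 \<le> (s::real)"
    show "opnorm (flow r s) \<le> C * exp (\<omega> * s)"
    proof (cases "s0 \<le> s")
      case True
      have "opnorm (flow r s) \<le> 1 * exp (\<omega> * s)" using s0(2)[OF r True] by simp
      also have "\<dots> \<le> C * exp (\<omega> * s)" by (intro mult_right_mono) (auto simp: C_def)
      finally show ?thesis .
    next
      case False
      obtain m t z where r_eq: "r = (m, t, \<lambda>k. Mm (z k),
        \<lambda>k. ul_block (ml (z (Suc k))) (ml (z k)) (Tm (z (Suc k)) * mR (z k) * minv (Tm (z k))))"
        and sg: "signal K \<tau> m t z"
        using r unfolding sys_bar_def by blast
      obtain k where k: "enat k \<le> m" "t k \<le> s" "sidx m t s = k"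
        using signal_index[OF sg s] by metis
      \<comment> \<open>Cutting the signal after the last switch before \<open>s\<close> leaves the
        flow at \<open>s\<close> unchanged and gives the finite form required by
        \<open>bar_flow_emb\<close>.\<close>
      have sgk: "signal K \<tau> (enat k) t z"
        using signal_segment[OF sg, of 0 k] k(1) sg by (simp add: signal_def)
      have fl: "flow r s = flow (enat k, t, \<lambda>k. Mm (z k),
        \<lambda>k. ul_block (ml (z (Suc k))) (ml (z k)) (Tm (z (Suc k)) * mR (z k) * minv (Tm (z k)))) s"
        unfolding r_eq flow_def by (simp add: k(3) sidx_last[OF sgk k(2)])
      note bf = bar_flow_emb[OF sgk k(2)]
      let ?\<delta> = "\<lambda>i. t (Suc i) - t i"
      let ?V = "\<lambda>i. Jt z i * (exp (?\<delta> i *\<^sub>R eM (z i)) * p (z i))"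
      have zK: "z i \<in> K" if "i \<le> k" for i using signal_mode_in[OF sgk] that by simp
      have t0: "t 0 = 0" using sg by (simp add: signal_def)
      have dw: "\<tau> \<le> ?\<delta> i" if "i < k" for i
        using sgk that unfolding signal_def by (simp add: Suc_le_eq)
      \<comment> \<open>The second conjunct counts the jumps; it bounds \<open>k\<close> by
        \<open>N\<close> and hence the power in the first.\<close>
      have V: "norm (oprod ?V 0 j) \<le> (b * b * b * b) ^ j * exp (b * t j) \<and> real j * \<tau> \<le> t j" if "j \<le> k" for j
        using that
      proof (induction j)
        case 0
        then show ?case by (simp add: t0)
      next
        case (Suc j)
        have j: "j < k" and \<sigma>: "z j \<in> K" "z (Suc j) \<in> K" using Suc.prems zK by auto
        have \<delta>0: "0 \<le> ?\<delta> j" using dw[OF j] \<tau> by linarith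
        have nV: "norm (?V j) \<le> (b * b * b) * (exp (b * ?\<delta> j) * b)"
          using b \<sigma> \<delta>0 by (intro order_trans[OF norm_mult_ineq] mult_mono norm_Jt exp_eM_crude) auto
        have IH: "norm (oprod ?V 0 j) \<le> (b * b * b * b) ^ j * exp (b * t j)" using Suc by simp
        have "norm (?V j * oprod ?V 0 j) \<le> ((b * b * b) * (exp (b * ?\<delta> j) * b)) * ((b * b * b * b) ^ j * exp (b * t j))"
          by (rule order_trans[OF norm_mult_ineq mult_mono[OF nV IH]]) (use b(1) in auto)
        also have "\<dots> = (b * b * b * b) ^ Suc j * (exp (b * ?\<delta> j) * exp (b * t j))" by simp
        also have "exp (b * ?\<delta> j) * exp (b * t j) = exp (b * t (Suc j))" by (simp add: exp_add[symmetric] algebra_simps)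
        finally have "norm (oprod ?V 0 (Suc j)) \<le> (b * b * b * b) ^ Suc j * exp (b * t (Suc j))" by simp
        moreover have "real (Suc j) * \<tau> \<le> t (Suc j)" using Suc dw[OF j] by (simp add: distrib_right)
        ultimately show ?case ..
      qed
      have "real k \<le> s0 / \<tau>"
        using V[OF order_refl] k(2) False \<tau> by (simp add: pos_le_divide_eq)
      then have kN: "k \<le> N" unfolding N_def by (simp add: le_nat_floor)
      have b4: "1 \<le> b * b * b * b" using mult_mono[of 1 b 1 b] mult_mono[of 1 "b * b" 1 "b * b"] b(1) by (simp add: mult.assoc)
      have "norm (emb 0 0 (flow r s)) \<le> norm (exp ((s - t k) *\<^sub>R eM (z k)) * p (z k) * oprod ?V 0 k) * norm (p (z 0))"
        unfolding fl bf(4) by (rule norm_mult_ineq)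
      also have "\<dots> \<le> ((exp (b * (s - t k)) * b) * ((b * b * b * b) ^ k * exp (b * t k))) * b"
        using b zK k(2) V[OF order_refl]
        by (intro mult_mono order_trans[OF norm_mult_ineq[of "exp ((s - t k) *\<^sub>R eM (z k)) * p (z k)"]] exp_eM_crude) auto
      also have "\<dots> = (b * b * b * b) ^ k * (b * b) * (exp (b * (s - t k)) * exp (b * t k))" by simp
      also have "exp (b * (s - t k)) * exp (b * t k) = exp (b * s)" by (simp add: exp_add[symmetric] algebra_simps)
      also have "(b * b * b * b) ^ k * (b * b) * exp (b * s) \<le> (b * b * b * b) ^ N * (b * b) * (exp ((b + \<bar>\<omega>\<bar>) * s0) * exp (\<omega> * s))"
      proof (intro mult_mono power_increasing kN b4)
        have "(b + \<bar>\<omega>\<bar>) * s \<le> (b + \<bar>\<omega>\<bar>) * s0" using False b by (intro mult_left_mono) auto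
        moreover have "- \<omega> * s \<le> \<bar>\<omega>\<bar> * s" using s by (intro mult_right_mono) auto
        ultimately show "exp (b * s) \<le> exp ((b + \<bar>\<omega>\<bar>) * s0) * exp (\<omega> * s)" by (simp add: exp_add[symmetric] algebra_simps)
      qed (use b in auto)
      finally have n: "norm (emb 0 0 (flow r s)) \<le> (b * b * b * b) ^ N * (b * b) * exp ((b + \<bar>\<omega>\<bar>) * s0) * exp (\<omega> * s)" by (simp add: mult.assoc)
      have "opnorm (flow r s) \<le> real (dim_row (flow r s) * dim_col (flow r s)) * norm (emb 0 0 (flow r s))"
        by (rule opnorm_le_emb)
      also have "\<dots> \<le> real (d * d) * ((b * b * b * b) ^ N * (b * b) * exp ((b + \<bar>\<omega>\<bar>) * s0) * exp (\<omega> * s))"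
        using bf(2,3) unfolding fl[symmetric] by (intro mult_mono n) (auto intro: mult_mono simp del: of_nat_mult)
      also have "\<dots> \<le> C * exp (\<omega> * s)"
        unfolding C_def mult.assoc[symmetric] by (intro mult_right_mono) (auto simp: mult.assoc)
      finally show ?thesis .
    qed
  qed
qed

section \<open>Comparison of exponents and exponential stability\<close>

lemma Limsup_lyap_le:
  assumes "\<And>\<omega> \<omega>'. x < ereal \<omega> \<Longrightarrow> \<omega> < \<omega>' \<Longrightarrow>
    \<exists>\<epsilon>0>0. \<exists>C. \<forall>\<epsilon> r s. 0 < \<epsilon> \<longrightarrow> \<epsilon> < \<epsilon>0 \<longrightarrow> r \<in> S \<epsilon> \<longrightarrow> 0 \<le> s \<longrightarrow> opnorm (flow r s) \<le> C * exp (\<omega>' * s)"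
  shows "Limsup (at_right 0) (\<lambda>\<epsilon>. lyap (S \<epsilon>)) \<le> x"
proof (rule ccontr)
  assume "\<not> ?thesis"
  then have "x < Limsup (at_right 0) (\<lambda>\<epsilon>. lyap (S \<epsilon>))" by simp
  \<comment> \<open>Arguing by contradiction provides two real rates strictly above
    \<open>x\<close>, also when \<open>x\<close> is minus infinity; if \<open>x\<close> is plus
    infinity the negated claim is already absurd.\<close>
  from ereal_dense2[OF this] obtain \<omega>' where w': "x < ereal \<omega>'" "ereal \<omega>' < Limsup (at_right 0) (\<lambda>\<epsilon>. lyap (S \<epsilon>))" by blast
  from ereal_dense2[OF w'(1)] obtain \<omega> where w: "x < ereal \<omega>" "\<omega> < \<omega>'" by auto
  from assms[OF w] obtain \<epsilon>0 C where e: "0 < \<epsilon>0"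
    "\<And>\<epsilon> r s. 0 < \<epsilon> \<Longrightarrow> \<epsilon> < \<epsilon>0 \<Longrightarrow> r \<in> S \<epsilon> \<Longrightarrow> 0 \<le> s \<Longrightarrow> opnorm (flow r s) \<le> C * exp (\<omega>' * s)" by blast
  have "eventually (\<lambda>\<epsilon>. lyap (S \<epsilon>) \<le> ereal \<omega>') (at_right 0)"
    by (rule eventually_at_rightI[OF _ e(1)]) (auto intro!: lyap_leI e(2))
  then have "Limsup (at_right 0) (\<lambda>\<epsilon>. lyap (S \<epsilon>)) \<le> ereal \<omega>'"
    by (rule Limsup_bounded)
  with w' show False by simp
qed

lemma eventually_ES:
  assumes "\<exists>\<epsilon>0>0. \<exists>C. \<forall>\<epsilon> r s. 0 < \<epsilon> \<longrightarrow> \<epsilon> < \<epsilon>0 \<longrightarrow> r \<in> S \<epsilon> \<longrightarrow> 0 \<le> s \<longrightarrow> opnorm (flow r s) \<le> C * exp (\<omega> * s)"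
    and \<omega>: "\<omega> < 0"
  shows "eventually (\<lambda>\<epsilon>. ES (S \<epsilon>)) (at_right 0)"
proof -
  from assms obtain \<epsilon>0 C where e: "0 < \<epsilon>0"
    "\<And>\<epsilon> r s. 0 < \<epsilon> \<Longrightarrow> \<epsilon> < \<epsilon>0 \<Longrightarrow> r \<in> S \<epsilon> \<Longrightarrow> 0 \<le> s \<Longrightarrow> opnorm (flow r s) \<le> C * exp (\<omega> * s)" by blast
  have "ES (S \<epsilon>)" if \<epsilon>: "0 < \<epsilon>" "\<epsilon> < \<epsilon>0" for \<epsilon>
  proof -
    have "opnorm (flow r s) \<le> max 1 C * exp (- (- \<omega>) * s)" if rs: "r \<in> S \<epsilon>" "0 \<le> s" for r s
    proof -
      have "opnorm (flow r s) \<le> C * exp (\<omega> * s)" by (rule e(2)[OF \<epsilon> rs])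
      also have "\<dots> \<le> max 1 C * exp (\<omega> * s)" by (intro mult_right_mono) auto
      finally show ?thesis by simp
    qed
    moreover have "0 < max 1 C" "0 < - \<omega>" using \<omega> by auto
    ultimately show ?thesis unfolding ES_def by blast
  qed
  then show ?thesis
    by (intro eventually_at_rightI[OF _ e(1)]) auto
qed

lemma dwell_time_part:
  assumes \<tau>: "0 < \<tau>"
  shows "Limsup (at_right 0) (\<lambda>\<epsilon>. lyap (sys_eps K \<tau> \<epsilon>)) \<le> lyap (sys_bar K \<tau>)"
    and "ES (sys_bar K \<tau>) \<Longrightarrow> eventually (\<lambda>\<epsilon>. ES (sys_eps K \<tau> \<epsilon>)) (at_right 0)"
proof -
  have main: "\<exists>\<epsilon>0>0. \<exists>C. \<forall>\<epsilon> r s. 0 < \<epsilon> \<longrightarrow> \<epsilon> < \<epsilon>0 \<longrightarrow> r \<in> sys_eps K \<tau> \<epsilon> \<longrightarrow> 0 \<le> s \<longrightarrow> opnorm (flow r s) \<le> C * exp (\<omega>' * s)"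
    if "\<And>r s. r \<in> sys_bar K \<tau> \<Longrightarrow> 0 \<le> s \<Longrightarrow> opnorm (flow r s) \<le> Cb * exp (\<omega> * s)" "\<omega> < \<omega>'" for Cb \<omega> \<omega>'
    by (rule dwell_time_bound[OF \<tau> that(2,1)]) blast+
  show "Limsup (at_right 0) (\<lambda>\<epsilon>. lyap (sys_eps K \<tau> \<epsilon>)) \<le> lyap (sys_bar K \<tau>)"
  proof (rule Limsup_lyap_le)
    fix \<omega> \<omega>' assume w: "lyap (sys_bar K \<tau>) < ereal \<omega>" "\<omega> < \<omega>'"
    obtain C where "\<And>r s. r \<in> sys_bar K \<tau> \<Longrightarrow> 0 \<le> s \<Longrightarrow> opnorm (flow r s) \<le> C * exp (\<omega> * s)"
      by (rule bar_bound_of_lyap[OF \<tau> w(1)]) blast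
    from main[OF this w(2)]
    show "\<exists>\<epsilon>0>0. \<exists>C. \<forall>\<epsilon> r s. 0 < \<epsilon> \<longrightarrow> \<epsilon> < \<epsilon>0 \<longrightarrow> r \<in> sys_eps K \<tau> \<epsilon> \<longrightarrow> 0 \<le> s \<longrightarrow> opnorm (flow r s) \<le> C * exp (\<omega>' * s)" .
  qed
  assume "ES (sys_bar K \<tau>)"
  then obtain c \<delta> where "0 < \<delta>" "\<forall>r\<in>sys_bar K \<tau>. \<forall>s\<ge>0. opnorm (flow r s) \<le> c * exp (- \<delta> * s)"
    unfolding ES_def by blast
  then show "eventually (\<lambda>\<epsilon>. ES (sys_eps K \<tau> \<epsilon>)) (at_right 0)"
    \<comment> \<open>Half of the decay rate is given up, because the perturbation argument needs a
      strict gap between the two rates.\<close>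
    by (intro eventually_ES[OF main[of c "- \<delta>" "- \<delta> / 2"]]) auto
qed

lemma fast_switching_part:
  assumes neg: "lyap_sw (sys_hat K) < 0"
  shows "Limsup (at_right 0) (\<lambda>\<epsilon>. lyap (sys_eps K 0 \<epsilon>)) \<le> lyap (sys_tilde d K)"
    and "ES (sys_tilde d K) \<Longrightarrow> eventually (\<lambda>\<epsilon>. ES (sys_eps K 0 \<epsilon>)) (at_right 0)"
proof -
  have main: "\<exists>\<epsilon>0>0. \<exists>C. \<forall>\<epsilon> r s. 0 < \<epsilon> \<longrightarrow> \<epsilon> < \<epsilon>0 \<longrightarrow> r \<in> sys_eps K 0 \<epsilon> \<longrightarrow> 0 \<le> s \<longrightarrow> opnorm (flow r s) \<le> C * exp (\<omega>' * s)"
    if "\<And>\<sigma> t. \<sigma> \<in> K \<Longrightarrow> 0 \<le> t \<Longrightarrow> norm (exp (t *\<^sub>R eM \<sigma>) * p \<sigma>) \<le> C0 * exp (\<omega> * t)" "\<omega> < \<omega>'" for C0 \<omega> \<omega>'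
    by (rule fast_switching_bound[OF neg that(2,1)]) blast+
  show "Limsup (at_right 0) (\<lambda>\<epsilon>. lyap (sys_eps K 0 \<epsilon>)) \<le> lyap (sys_tilde d K)"
  proof (rule Limsup_lyap_le)
    fix \<omega> \<omega>' assume w: "lyap (sys_tilde d K) < ereal \<omega>" "\<omega> < \<omega>'"
    obtain C where "\<And>\<sigma> t. \<sigma> \<in> K \<Longrightarrow> 0 \<le> t \<Longrightarrow> norm (exp (t *\<^sub>R eM \<sigma>) * p \<sigma>) \<le> C * exp (\<omega> * t)"
      by (rule slow_of_tilde[OF w(1)]) blast
    from main[OF this w(2)]
    show "\<exists>\<epsilon>0>0. \<exists>C. \<forall>\<epsilon> r s. 0 < \<epsilon> \<longrightarrow> \<epsilon> < \<epsilon>0 \<longrightarrow> r \<in> sys_eps K 0 \<epsilon> \<longrightarrow> 0 \<le> s \<longrightarrow> opnorm (flow r s) \<le> C * exp (\<omega>' * s)" .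
  qed
  assume "ES (sys_tilde d K)"
  then obtain c \<delta> where \<delta>: "0 < \<delta>" and "\<forall>r\<in>sys_tilde d K. \<forall>s\<ge>0. opnorm (flow r s) \<le> c * exp (- \<delta> * s)"
    unfolding ES_def by blast
  then have "norm (exp (t *\<^sub>R eM \<sigma>) * p \<sigma>) \<le> real (d * d) * c * exp (- \<delta> * t)" if "\<sigma> \<in> K" "0 \<le> t" for \<sigma> t
    using that by (intro slow_of_tilde_ES) auto
  \<comment> \<open>Again half of the rate \<open>\<delta>\<close> serves as the gap, and the
    remaining rate is still negative.\<close>
  from main[OF this, of "- \<delta> / 2"] \<delta> show "eventually (\<lambda>\<epsilon>. ES (sys_eps K 0 \<epsilon>)) (at_right 0)"
    by (intro eventually_ES[of _ "- \<delta> / 2"]) auto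
qed

end

theorem theorem2:
  fixes d :: nat and K :: "mode set"
  assumes d2: "2 \<le> d"
    and K_modes: "\<forall>\<sigma>\<in>K. 1 \<le> ml \<sigma> \<and> ml \<sigma> \<le> d - 1 \<and>
        mP \<sigma> \<in> carrier_mat d d \<and> invertible_mat (mP \<sigma>) \<and>
        mLam \<sigma> \<in> carrier_mat d d \<and> mR \<sigma> \<in> carrier_mat d d"
    and K_compact: "compact (mode_embed ` K)"
    and D_hurwitz: "\<forall>\<sigma>\<in>K. hurwitz (bD \<sigma>)"
  shows "(\<forall>\<tau>>0. Limsup (at_right 0) (\<lambda>\<epsilon>. lyap (sys_eps K \<tau> \<epsilon>)) \<le> lyap (sys_bar K \<tau>) \<and>
                (ES (sys_bar K \<tau>) \<longrightarrow> (\<forall>\<^sub>F \<epsilon> in at_right 0. ES (sys_eps K \<tau> \<epsilon>))))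
       \<and> (lyap_sw (sys_hat K) < 0 \<longrightarrow>
            Limsup (at_right 0) (\<lambda>\<epsilon>. lyap (sys_eps K 0 \<epsilon>)) \<le> lyap (sys_tilde d K) \<and>
            (ES (sys_tilde d K) \<longrightarrow> (\<forall>\<^sub>F \<epsilon> in at_right 0. ES (sys_eps K 0 \<epsilon>))))"
proof -
  interpret modes d K
    using assms by unfold_locales auto
  show ?thesis
    using dwell_time_part fast_switching_part by blast
qed

end
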